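(* Let $F$ be a left ($\tau$-)bimonad on a 0-cell $\mathcal A$ in a 2-category $\mathcal K$ and $B$ a left $F$-comodule monad with coaction $l_B:B\to FB$ and $\psi_{B,F}=(\mu\times B)(F\times\tau_{B,F})(l_B\times F)$. Let ${}_{\psi_B}{}^F_F\underline{\mathcal{YD}_s(\mathcal K,\mathcal A)}$ be the image of ${}_{\tau_B}{}^F_F\mathcal{YD}_{cl}(\mathcal K,\mathcal A)$ under the assignment $X\mapsto(X,\psi_{F,X},\phi_{X,F},\psi_{B,X})$ with $\psi_{F,X}=(\nu\times F)(F\times\tau_{F,X})(\Delta\times X)$, $\phi_{X,F}=(\mu\times X)(F\times\tau_{X,F})(l\times F)$, $\psi_{B,X}=(\nu\times B)(F\times\tau_{B,X})(l_B\times X)$. Then there is an action of categories $${}_{\psi_B}{}^F_F\underline{\mathcal{YD}_s(\mathcal K,\mathcal A)}\times{}^F_B\mathcal K\to{}^F_B\mathcal K,\qquad(X,M)\mapsto XM,$$ where $XM$ is a left $F$-comodule by $(\phi_{X,F}\times M)(X\times\lambda_M)$ and a left $B$-module by $(X\times\nu_M)(\psi_{B,X}\times M)$.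
   Context: Conventions: 1-cells are composed by juxtaposition, $\times$ is horizontal and $\circ$ (or juxtaposition) vertical composition of 2-cells; a 1-cell in a formula stands for its identity 2-cell. $\mathcal T(\mathcal A,B)=\mathrm{Mnd}(\mathcal K)(B)$, for a monad $B$: pairs $(X,\psi:BX\to XB)$ with $\psi(\mu_B\times X)=(X\times\mu_B)(\psi\times B)(B\times\psi)$, $\psi(\eta_B\times X)=X\times\eta_B$; morphisms $\zeta:X\to Y$ with $(\zeta\times B)\psi=\psi'(B\times\zeta)$. $\mathrm{Comnd}(\mathcal K)(F)$, for a comonad $F$: pairs $(X,\phi:XF\to FX)$ with $(\Delta\times X)\phi=(F\times\phi)(\phi\times F)(X\times\Delta)$, $(\varepsilon\times X)\phi=X\times\varepsilon$; morphisms with $(F\times\zeta)\phi=\phi'(\zeta\times F)$. $\tau:FX\to XF$ is left monadic if $(X,\tau)\in\mathrm{Mnd}(\mathcal K)(F)$, right comonadic if $(X\times\Delta)\tau=(\tau\times F)(F\times\tau)(\Delta\times X)$, $(X\times\varepsilon)\tau=\varepsilon\times X$; $\tau:XF\to FX$ is left comonadic if $(X,\tau)\in\mathrm{Comnd}(\mathcal K)(F)$, right monadic if $\tau(X\times\mu)=(\mu\times X)(F\times\tau)(\tau\times F)$, $\tau(X\times\eta)=\eta\times X$. A left bimonad $(\mathcal A,F,\mu,\eta,\Delta,\varepsilon,\lambda)$: $(F,\mu,\eta)$ a monad, $(F,\Delta,\varepsilon)$ a comonad, $\lambda:FF\to FF$ with $(F,\lambda)\in\mathrm{Mnd}(\mathcal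 K)(F)$ and $\in\mathrm{Comnd}(\mathcal K)(F)$, $\Delta\mu=(F\times\mu)(\lambda\times F)(F\times\Delta)$, $\varepsilon\mu=\varepsilon\times\varepsilon$, $\Delta\eta=\eta\times\eta$, $\varepsilon\eta=\mathrm{Id}$. A left $\tau$-bimonad is a left bimonad with $\lambda=(\mu\times F)(F\times\tau_{F,F})(\Delta\times F)$, $\tau_{F,F}:FF\to FF$ left and right monadic and left and right comonadic. Classical left Yetter–Drinfel'd module: $(X,\tau_{F,X},\tau_{X,F},\nu,l)$, $X:\mathcal A\to\mathcal A$, where $\tau_{F,X}:FX\to XF$ is left monadic and right comonadic, $\tau_{X,F}:XF\to FX$ is left comonadic and right monadic, $(X,\nu)$ is a left $F$-module, $(X,l)$ a left $F$-comodule, $\tau_{F,X}(F\times\nu)=(\nu\times F)(F\times\tau_{F,X})(\tau_{F,F}\times X)$, $(l\times F)\tau_{F,X}=(F\times\tau_{F,X})(\tau_{F,F}\times X)(F\times l)$, $\tau_{X,F}(\nu\times F)=(F\times\nu)(\tau_{F,F}\times X)(F\times\tau_{X,F})$, $(F\times l)\tau_{X,F}=(\tau_{F,F}\times X)(F\times\tau_{X,F})(l\times F)$, $(F\times\tau_{F,X})(\tau_{F,F}\times X)(F\times\tau_{X,F})=(\tau_{X,F}\times F)(X\times\tau_{F,F})(\tau_{F,X}\times F)$, and $(\mu\times X)(F\times\tau_{X,F})(l\times F)(\nu\times F)(F\times\tau_{F,X})(\Delta\times X)=(\mu\times\nu)(F\times\tau_{F,F}\times X)(\Delta\times l)$. $B$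 is a monad on $\mathcal A$ with $(F,\tau_{B,F})\in\mathcal T(\mathcal A,B)$; left $F$-comodule monad: $l_B=\psi_{B,F}(B\times\eta)$ is a left $F$-coaction with $(F\times\mu_B)(\psi_{B,F}\times B)(B\times l_B)=l_B\mu_B$, $l_B\eta_B=\eta\times\eta_B$. ${}_{\tau_B}{}^F_F\mathcal{YD}_{cl}(\mathcal K,\mathcal A)$: objects are classical left Yetter–Drinfel'd modules with $\tau_{B,X}:BX\to XB$ such that $(X,\tau_{B,X})\in\mathcal T(\mathcal A,B)$, $(X\times\tau_{B,F})(\tau_{B,X}\times F)(B\times\tau_{F,X})=(\tau_{F,X}\times B)(F\times\tau_{B,X})(\tau_{B,F}\times X)$, $(F\times\tau_{B,X})(\tau_{B,F}\times X)(B\times\tau_{X,F})=(\tau_{X,F}\times B)(X\times\tau_{B,F})(\tau_{B,X}\times F)$, $\tau_{B,X}(B\times\nu)=(\nu\times B)(F\times\tau_{B,X})(\tau_{B,F}\times X)$, $(l\times B)\tau_{B,X}=(F\times\tau_{B,X})(\tau_{B,F}\times X)(B\times l)$, and $(F\times l_B)\tau_{B,F}=(\tau_{F,F}\times B)(F\times\tau_{B,F})(l_B\times F)$. Morphisms are 2-cells that are morphisms in $\mathrm{Mnd}(\mathcal K)(F)$ and $\mathrm{Comnd}(\mathcal K)(F)$ (for $\psi_{F,X},\phi_{X,F}$), and in $\mathrm{Mnd}(\mathcal K)(B)$. Tensor product: $YX$ with $\tau_{-,YX}=(Y\times\tau_{-,X})(\tau_{-,Y}\times X)$, $\tau_{YX,F}=(\tau_{Y,F}\times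 X)(Y\times\tau_{X,F})$, $\nu_{YX}=(\nu_Y\times\nu_X)(F\times\tau_{F,Y}\times X)(\Delta\times YX)$, $l_{YX}=(\mu\times YX)(F\times\tau_{Y,F}\times X)(l_Y\times l_X)$. ${}^F_B\mathcal K$ (left relative $(F,B)$-modules): 1-cells $M:\mathcal A'\to\mathcal A$ (any $\mathcal A'$) that are left $F$-comodules $(M,\lambda_M)$ and left $B$-modules $(M,\nu_M)$ with $\lambda_M\nu_M=(F\times\nu_M)(\psi_{B,F}\times M)(B\times\lambda_M)$; morphisms are left $F$-colinear, left $B$-linear 2-cells.
   Formalization: Added since the claim fails otherwise: μ,η,Δ,ε of F are morphisms in Mnd(K)(B); (X×l_B)τ_{B,X}=(τ_{F,X}×B)(F×τ_{B,X})(l_B×X) for objects X. Closure under tensor product is claimed only for X satisfying the Yang–Baxter equations on FFX and XFF; the action laws hold for all X. *)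

theory Defs
  imports Main
begin

section \<open>Strict 2-categories\<close>

text \<open>
  Juxtaposition of 1-cells is \<open>\<cdot>\<close>, horizontal composition of 2-cells is \<open>\<star>\<close>, vertical
  composition is \<open>\<bullet>\<close>; all three are written in the order of function composition, so
  \<open>X \<cdot> Y\<close> and \<open>s \<bullet> t\<close> apply the right-hand factor first. \<open>\<langle>X\<rangle>\<close> is the identity 2-cell of \<open>X\<close>.
\<close>

record ('o, 'h, 'c) two_cat =
  Ob :: "'o set"
  One :: "'h set"
  Two :: "'c set"
  src :: "'h \<Rightarrow> 'o"
  tgt :: "'h \<Rightarrow> 'o"
  dom2 :: "'c \<Rightarrow> 'h"
  cod2 :: "'c \<Rightarrow> 'h"
  id1 :: "'o \<Rightarrow> 'h"  ("\<one>\<index>")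
  comp1 :: "'h \<Rightarrow> 'h \<Rightarrow> 'h"  (infixl "\<cdot>\<index>" 80)
  id2 :: "'h \<Rightarrow> 'c"  ("\<langle>_\<rangle>\<index>")
  vcomp :: "'c \<Rightarrow> 'c \<Rightarrow> 'c"  (infixl "\<bullet>\<index>" 70)
  hcomp :: "'c \<Rightarrow> 'c \<Rightarrow> 'c"  (infixl "\<star>\<index>" 75)

definition hom1 :: "('o, 'h, 'c, 'm) two_cat_scheme \<Rightarrow> 'o \<Rightarrow> 'o \<Rightarrow> 'h set" where
  "hom1 K a b = {X \<in> One K. src K X = a \<and> tgt K X = b}"

definition hom2 :: "('o, 'h, 'c, 'm) two_cat_scheme \<Rightarrow> 'h \<Rightarrow> 'h \<Rightarrow> 'c set" where
  "hom2 K X Y = {t \<in> Two K. dom2 K t = X \<and> cod2 K t = Y}"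

locale two_category =
  fixes K :: "('o, 'h, 'c, 'm) two_cat_scheme" (structure)
  assumes src_Ob: "X \<in> One K \<Longrightarrow> src K X \<in> Ob K"
    and tgt_Ob: "X \<in> One K \<Longrightarrow> tgt K X \<in> Ob K"
    and dom2_One: "t \<in> Two K \<Longrightarrow> dom2 K t \<in> One K"
    and cod2_One: "t \<in> Two K \<Longrightarrow> cod2 K t \<in> One K"
    and parallel_src: "t \<in> Two K \<Longrightarrow> src K (dom2 K t) = src K (cod2 K t)"
    and parallel_tgt: "t \<in> Two K \<Longrightarrow> tgt K (dom2 K t) = tgt K (cod2 K t)"
    and id1_hom: "a \<in> Ob K \<Longrightarrow> \<one> a \<in> hom1 K a a"
    and comp1_hom: "\<lbrakk>X \<in> hom1 K b c; Y \<in> hom1 K a b\<rbrakk> \<Longrightarrow> X \<cdot> Y \<in> hom1 K a c"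
    and comp1_assoc: "\<lbrakk>X \<in> hom1 K c d; Y \<in> hom1 K b c; Z \<in> hom1 K a b\<rbrakk>
          \<Longrightarrow> (X \<cdot> Y) \<cdot> Z = X \<cdot> (Y \<cdot> Z)"
    and comp1_id_left: "X \<in> hom1 K a b \<Longrightarrow> \<one> b \<cdot> X = X"
    and comp1_id_right: "X \<in> hom1 K a b \<Longrightarrow> X \<cdot> \<one> a = X"
    and id2_hom: "X \<in> One K \<Longrightarrow> \<langle>X\<rangle> \<in> hom2 K X X"
    and vcomp_hom: "\<lbrakk>s \<in> hom2 K Y Z; t \<in> hom2 K X Y\<rbrakk> \<Longrightarrow> s \<bullet> t \<in> hom2 K X Z"
    and vcomp_assoc: "\<lbrakk>r \<in> hom2 K Y Z; s \<in> hom2 K X Y; t \<in> hom2 K W X\<rbrakk>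
          \<Longrightarrow> (r \<bullet> s) \<bullet> t = r \<bullet> (s \<bullet> t)"
    and vcomp_id_left: "t \<in> hom2 K X Y \<Longrightarrow> \<langle>Y\<rangle> \<bullet> t = t"
    and vcomp_id_right: "t \<in> hom2 K X Y \<Longrightarrow> t \<bullet> \<langle>X\<rangle> = t"
    and hcomp_hom: "\<lbrakk>X \<in> hom1 K b c; Y \<in> hom1 K a b; s \<in> hom2 K X X'; t \<in> hom2 K Y Y'\<rbrakk>
          \<Longrightarrow> s \<star> t \<in> hom2 K (X \<cdot> Y) (X' \<cdot> Y')"
    and hcomp_assoc: "\<lbrakk>X \<in> hom1 K c d; Y \<in> hom1 K b c; Z \<in> hom1 K a b;
          r \<in> hom2 K X X'; s \<in> hom2 K Y Y'; t \<in> hom2 K Z Z'\<rbrakk>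
          \<Longrightarrow> (r \<star> s) \<star> t = r \<star> (s \<star> t)"
    and hcomp_id_left: "\<lbrakk>X \<in> hom1 K a b; t \<in> hom2 K X Y\<rbrakk> \<Longrightarrow> \<langle>\<one> b\<rangle> \<star> t = t"
    and hcomp_id_right: "\<lbrakk>X \<in> hom1 K a b; t \<in> hom2 K X Y\<rbrakk> \<Longrightarrow> t \<star> \<langle>\<one> a\<rangle> = t"
    and hcomp_id2: "\<lbrakk>X \<in> hom1 K b c; Y \<in> hom1 K a b\<rbrakk> \<Longrightarrow> \<langle>X\<rangle> \<star> \<langle>Y\<rangle> = \<langle>X \<cdot> Y\<rangle>"
    and interchange: "\<lbrakk>X \<in> hom1 K b c; Y \<in> hom1 K a b;
          s \<in> hom2 K X X'; s' \<in> hom2 K X' X''; t \<in> hom2 K Y Y'; t' \<in> hom2 K Y' Y''\<rbrakk>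
          \<Longrightarrow> (s' \<bullet> s) \<star> (t' \<bullet> t) = (s' \<star> t') \<bullet> (s \<star> t)"


section \<open>Monads, comonads and bimonads in a 2-category\<close>

context
  fixes K :: "('o, 'h, 'c, 'm) two_cat_scheme" (structure)
begin

definition monad_on :: "'o \<Rightarrow> 'h \<Rightarrow> 'c \<Rightarrow> 'c \<Rightarrow> bool" where
  "monad_on A B \<mu> \<eta> \<longleftrightarrow>
     A \<in> Ob K \<and> B \<in> hom1 K A A \<and> \<mu> \<in> hom2 K (B \<cdot> B) B \<and> \<eta> \<in> hom2 K (\<one> A) B \<and>
     \<mu> \<bullet> (\<mu> \<star> \<langle>B\<rangle>) = \<mu> \<bullet> (\<langle>B\<rangle> \<star> \<mu>) \<and>
     \<mu> \<bullet> (\<eta> \<star> \<langle>B\<rangle>) = \<langle>B\<rangle> \<and> \<mu> \<bullet> (\<langle>B\<rangle> \<star> \<eta>) = \<langle>B\<rangle>"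

definition comonad_on :: "'o \<Rightarrow> 'h \<Rightarrow> 'c \<Rightarrow> 'c \<Rightarrow> bool" where
  "comonad_on A F \<Delta> \<epsilon> \<longleftrightarrow>
     A \<in> Ob K \<and> F \<in> hom1 K A A \<and> \<Delta> \<in> hom2 K F (F \<cdot> F) \<and> \<epsilon> \<in> hom2 K F (\<one> A) \<and>
     (\<Delta> \<star> \<langle>F\<rangle>) \<bullet> \<Delta> = (\<langle>F\<rangle> \<star> \<Delta>) \<bullet> \<Delta> \<and>
     (\<epsilon> \<star> \<langle>F\<rangle>) \<bullet> \<Delta> = \<langle>F\<rangle> \<and> (\<langle>F\<rangle> \<star> \<epsilon>) \<bullet> \<Delta> = \<langle>F\<rangle>"

definition Mnd_obj :: "'o \<Rightarrow> 'h \<Rightarrow> 'c \<Rightarrow> 'c \<Rightarrow> 'h \<Rightarrow> 'c \<Rightarrow> bool" where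
  "Mnd_obj A B \<mu> \<eta> X \<psi> \<longleftrightarrow>
     X \<in> hom1 K A A \<and> \<psi> \<in> hom2 K (B \<cdot> X) (X \<cdot> B) \<and>
     \<psi> \<bullet> (\<mu> \<star> \<langle>X\<rangle>) = (\<langle>X\<rangle> \<star> \<mu>) \<bullet> (\<psi> \<star> \<langle>B\<rangle>) \<bullet> (\<langle>B\<rangle> \<star> \<psi>) \<and>
     \<psi> \<bullet> (\<eta> \<star> \<langle>X\<rangle>) = \<langle>X\<rangle> \<star> \<eta>"

definition Mnd_arr :: "'h \<Rightarrow> 'h \<Rightarrow> 'c \<Rightarrow> 'h \<Rightarrow> 'c \<Rightarrow> 'c \<Rightarrow> bool" where
  "Mnd_arr B X \<psi> Y \<psi>' \<zeta> \<longleftrightarrow>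
     \<zeta> \<in> hom2 K X Y \<and> (\<zeta> \<star> \<langle>B\<rangle>) \<bullet> \<psi> = \<psi>' \<bullet> (\<langle>B\<rangle> \<star> \<zeta>)"

definition Comnd_obj :: "'o \<Rightarrow> 'h \<Rightarrow> 'c \<Rightarrow> 'c \<Rightarrow> 'h \<Rightarrow> 'c \<Rightarrow> bool" where
  "Comnd_obj A F \<Delta> \<epsilon> X \<phi> \<longleftrightarrow>
     X \<in> hom1 K A A \<and> \<phi> \<in> hom2 K (X \<cdot> F) (F \<cdot> X) \<and>
     (\<Delta> \<star> \<langle>X\<rangle>) \<bullet> \<phi> = (\<langle>F\<rangle> \<star> \<phi>) \<bullet> (\<phi> \<star> \<langle>F\<rangle>) \<bullet> (\<langle>X\<rangle> \<star> \<Delta>) \<and>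
     (\<epsilon> \<star> \<langle>X\<rangle>) \<bullet> \<phi> = \<langle>X\<rangle> \<star> \<epsilon>"

definition Comnd_arr :: "'h \<Rightarrow> 'h \<Rightarrow> 'c \<Rightarrow> 'h \<Rightarrow> 'c \<Rightarrow> 'c \<Rightarrow> bool" where
  "Comnd_arr F X \<phi> Y \<phi>' \<zeta> \<longleftrightarrow>
     \<zeta> \<in> hom2 K X Y \<and> (\<langle>F\<rangle> \<star> \<zeta>) \<bullet> \<phi> = \<phi>' \<bullet> (\<zeta> \<star> \<langle>F\<rangle>)"

definition left_monadic :: "'o \<Rightarrow> 'h \<Rightarrow> 'c \<Rightarrow> 'c \<Rightarrow> 'h \<Rightarrow> 'c \<Rightarrow> bool" where
  "left_monadic A F \<mu> \<eta> X \<tau> \<longleftrightarrow> Mnd_obj A F \<mu> \<eta> X \<tau>"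

definition right_comonadic :: "'o \<Rightarrow> 'h \<Rightarrow> 'c \<Rightarrow> 'c \<Rightarrow> 'h \<Rightarrow> 'c \<Rightarrow> bool" where
  "right_comonadic A F \<Delta> \<epsilon> X \<tau> \<longleftrightarrow>
     X \<in> hom1 K A A \<and> \<tau> \<in> hom2 K (F \<cdot> X) (X \<cdot> F) \<and>
     (\<langle>X\<rangle> \<star> \<Delta>) \<bullet> \<tau> = (\<tau> \<star> \<langle>F\<rangle>) \<bullet> (\<langle>F\<rangle> \<star> \<tau>) \<bullet> (\<Delta> \<star> \<langle>X\<rangle>) \<and>
     (\<langle>X\<rangle> \<star> \<epsilon>) \<bullet> \<tau> = \<epsilon> \<star> \<langle>X\<rangle>"

definition left_comonadic :: "'o \<Rightarrow> 'h \<Rightarrow> 'c \<Rightarrow> 'c \<Rightarrow> 'h \<Rightarrow> 'c \<Rightarrow> bool" where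
  "left_comonadic A F \<Delta> \<epsilon> X \<tau> \<longleftrightarrow> Comnd_obj A F \<Delta> \<epsilon> X \<tau>"

definition right_monadic :: "'o \<Rightarrow> 'h \<Rightarrow> 'c \<Rightarrow> 'c \<Rightarrow> 'h \<Rightarrow> 'c \<Rightarrow> bool" where
  "right_monadic A F \<mu> \<eta> X \<tau> \<longleftrightarrow>
     X \<in> hom1 K A A \<and> \<tau> \<in> hom2 K (X \<cdot> F) (F \<cdot> X) \<and>
     \<tau> \<bullet> (\<langle>X\<rangle> \<star> \<mu>) = (\<mu> \<star> \<langle>X\<rangle>) \<bullet> (\<langle>F\<rangle> \<star> \<tau>) \<bullet> (\<tau> \<star> \<langle>F\<rangle>) \<and>
     \<tau> \<bullet> (\<langle>X\<rangle> \<star> \<eta>) = \<eta> \<star> \<langle>X\<rangle>"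

definition left_bimonad :: "'o \<Rightarrow> 'h \<Rightarrow> 'c \<Rightarrow> 'c \<Rightarrow> 'c \<Rightarrow> 'c \<Rightarrow> 'c \<Rightarrow> bool" where
  "left_bimonad A F \<mu> \<eta> \<Delta> \<epsilon> l \<longleftrightarrow>
     monad_on A F \<mu> \<eta> \<and> comonad_on A F \<Delta> \<epsilon> \<and>
     Mnd_obj A F \<mu> \<eta> F l \<and> Comnd_obj A F \<Delta> \<epsilon> F l \<and>
     \<Delta> \<bullet> \<mu> = (\<langle>F\<rangle> \<star> \<mu>) \<bullet> (l \<star> \<langle>F\<rangle>) \<bullet> (\<langle>F\<rangle> \<star> \<Delta>) \<and>
     \<epsilon> \<bullet> \<mu> = \<epsilon> \<star> \<epsilon> \<and> \<Delta> \<bullet> \<eta> = \<eta> \<star> \<eta> \<and> \<epsilon> \<bullet> \<eta> = \<langle>\<one> A\<rangle>"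

definition tau_bimonad :: "'o \<Rightarrow> 'h \<Rightarrow> 'c \<Rightarrow> 'c \<Rightarrow> 'c \<Rightarrow> 'c \<Rightarrow> 'c \<Rightarrow> bool" where
  "tau_bimonad A F \<mu> \<eta> \<Delta> \<epsilon> \<tau> \<longleftrightarrow>
     left_bimonad A F \<mu> \<eta> \<Delta> \<epsilon> ((\<mu> \<star> \<langle>F\<rangle>) \<bullet> (\<langle>F\<rangle> \<star> \<tau>) \<bullet> (\<Delta> \<star> \<langle>F\<rangle>)) \<and>
     left_monadic A F \<mu> \<eta> F \<tau> \<and> right_monadic A F \<mu> \<eta> F \<tau> \<and>
     left_comonadic A F \<Delta> \<epsilon> F \<tau> \<and> right_comonadic A F \<Delta> \<epsilon> F \<tau>"

definition left_module :: "'o \<Rightarrow> 'h \<Rightarrow> 'c \<Rightarrow> 'c \<Rightarrow> 'h \<Rightarrow> 'c \<Rightarrow> bool" where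
  "left_module A B \<mu> \<eta> M \<nu> \<longleftrightarrow>
     M \<in> One K \<and> tgt K M = A \<and> \<nu> \<in> hom2 K (B \<cdot> M) M \<and>
     \<nu> \<bullet> (\<langle>B\<rangle> \<star> \<nu>) = \<nu> \<bullet> (\<mu> \<star> \<langle>M\<rangle>) \<and> \<nu> \<bullet> (\<eta> \<star> \<langle>M\<rangle>) = \<langle>M\<rangle>"

definition left_comodule :: "'o \<Rightarrow> 'h \<Rightarrow> 'c \<Rightarrow> 'c \<Rightarrow> 'h \<Rightarrow> 'c \<Rightarrow> bool" where
  "left_comodule A F \<Delta> \<epsilon> M l \<longleftrightarrow>
     M \<in> One K \<and> tgt K M = A \<and> l \<in> hom2 K M (F \<cdot> M) \<and>
     (\<langle>F\<rangle> \<star> l) \<bullet> l = (\<Delta> \<star> \<langle>M\<rangle>) \<bullet> l \<and> (\<epsilon> \<star> \<langle>M\<rangle>) \<bullet> l = \<langle>M\<rangle>"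


section \<open>Comodule monads\<close>

definition psi_BF :: "'h \<Rightarrow> 'c \<Rightarrow> 'h \<Rightarrow> 'c \<Rightarrow> 'c \<Rightarrow> 'c" where
  "psi_BF F \<mu> B lB \<tau>BF = (\<mu> \<star> \<langle>B\<rangle>) \<bullet> (\<langle>F\<rangle> \<star> \<tau>BF) \<bullet> (lB \<star> \<langle>F\<rangle>)"

definition comodule_monad ::
  "'o \<Rightarrow> 'h \<Rightarrow> 'c \<Rightarrow> 'c \<Rightarrow> 'c \<Rightarrow> 'c \<Rightarrow> 'h \<Rightarrow> 'c \<Rightarrow> 'c \<Rightarrow> 'c \<Rightarrow> 'c \<Rightarrow> bool" where
  "comodule_monad A F \<mu> \<eta> \<Delta> \<epsilon> B \<mu>B \<eta>B lB \<tau>BF \<longleftrightarrow>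
     monad_on A B \<mu>B \<eta>B \<and> Mnd_obj A B \<mu>B \<eta>B F \<tau>BF \<and>
     left_comodule A F \<Delta> \<epsilon> B lB \<and>
     lB = psi_BF F \<mu> B lB \<tau>BF \<bullet> (\<langle>B\<rangle> \<star> \<eta>) \<and>
     (\<langle>F\<rangle> \<star> \<mu>B) \<bullet> (psi_BF F \<mu> B lB \<tau>BF \<star> \<langle>B\<rangle>) \<bullet> (\<langle>B\<rangle> \<star> lB) = lB \<bullet> \<mu>B \<and>
     lB \<bullet> \<eta>B = \<eta> \<star> \<eta>B"

text \<open>
  The structure 2-cells of \<open>F\<close> are morphisms of \<open>Mnd(K)(B)\<close>, that is, \<open>F\<close> is a bimonad in
  \<open>Mnd(K)(B)\<close> and not merely a 1-cell underlying an object of it. The composite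
  \<open>(F, \<tau>BF)(F, \<tau>BF)\<close> in \<open>Mnd(K)(B)\<close> carries \<open>(F \<star> \<tau>BF)(\<tau>BF \<star> F)\<close> and the unit carries \<open>\<langle>B\<rangle>\<close>.
  Without compatibility with \<open>\<mu>\<close> the 1-cell \<open>X M\<close> need not be a relative module; without
  compatibility with \<open>\<epsilon>\<close> and \<open>\<eta>\<close> the identity 1-cell need not be a Yetter-Drinfel'd module.
\<close>

definition bimonad_in_Mnd ::
  "'o \<Rightarrow> 'h \<Rightarrow> 'c \<Rightarrow> 'c \<Rightarrow> 'c \<Rightarrow> 'c \<Rightarrow> 'h \<Rightarrow> 'c \<Rightarrow> bool" where
  "bimonad_in_Mnd A F \<mu> \<eta> \<Delta> \<epsilon> B \<tau>BF \<longleftrightarrow>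
     (let \<tau>BFF = (\<langle>F\<rangle> \<star> \<tau>BF) \<bullet> (\<tau>BF \<star> \<langle>F\<rangle>) in
       Mnd_arr B (F \<cdot> F) \<tau>BFF F \<tau>BF \<mu> \<and> Mnd_arr B (\<one> A) \<langle>B\<rangle> F \<tau>BF \<eta> \<and>
       Mnd_arr B F \<tau>BF (F \<cdot> F) \<tau>BFF \<Delta> \<and> Mnd_arr B F \<tau>BF (\<one> A) \<langle>B\<rangle> \<epsilon>)"

text \<open>
  This condition does not involve the Yetter-Drinfel'd module under consideration, so it is
  imposed once, on \<open>B\<close>; as a condition on objects it would leave no objects at all if it failed.
\<close>

definition coaction_slides_F :: "'h \<Rightarrow> 'c \<Rightarrow> 'h \<Rightarrow> 'c \<Rightarrow> 'c \<Rightarrow> bool" where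
  "coaction_slides_F F \<tau> B lB \<tau>BF \<longleftrightarrow>
     (\<langle>F\<rangle> \<star> lB) \<bullet> \<tau>BF = (\<tau> \<star> \<langle>B\<rangle>) \<bullet> (\<langle>F\<rangle> \<star> \<tau>BF) \<bullet> (lB \<star> \<langle>F\<rangle>)"

end


section \<open>Classical Yetter-Drinfel'd modules\<close>

record ('h, 'c) yd_cl =
  ycell :: 'h
  tFX :: 'c
  tXF :: 'c
  yact :: 'c
  ycoact :: 'c
  tBX :: 'c

context
  fixes K :: "('o, 'h, 'c, 'm) two_cat_scheme" (structure)
begin

definition classical_yd ::
  "'o \<Rightarrow> 'h \<Rightarrow> 'c \<Rightarrow> 'c \<Rightarrow> 'c \<Rightarrow> 'c \<Rightarrow> 'c \<Rightarrow> 'h \<Rightarrow> 'c \<Rightarrow> 'c \<Rightarrow> 'c \<Rightarrow> 'c \<Rightarrow> bool" where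
  "classical_yd A F \<mu> \<eta> \<Delta> \<epsilon> \<tau> X \<tau>FX \<tau>XF \<nu> l \<longleftrightarrow>
     X \<in> hom1 K A A \<and>
     left_monadic K A F \<mu> \<eta> X \<tau>FX \<and> right_comonadic K A F \<Delta> \<epsilon> X \<tau>FX \<and>
     left_comonadic K A F \<Delta> \<epsilon> X \<tau>XF \<and> right_monadic K A F \<mu> \<eta> X \<tau>XF \<and>
     left_module K A F \<mu> \<eta> X \<nu> \<and> left_comodule K A F \<Delta> \<epsilon> X l \<and>
     \<tau>FX \<bullet> (\<langle>F\<rangle> \<star> \<nu>) = (\<nu> \<star> \<langle>F\<rangle>) \<bullet> (\<langle>F\<rangle> \<star> \<tau>FX) \<bullet> (\<tau> \<star> \<langle>X\<rangle>) \<and>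
     (l \<star> \<langle>F\<rangle>) \<bullet> \<tau>FX = (\<langle>F\<rangle> \<star> \<tau>FX) \<bullet> (\<tau> \<star> \<langle>X\<rangle>) \<bullet> (\<langle>F\<rangle> \<star> l) \<and>
     \<tau>XF \<bullet> (\<nu> \<star> \<langle>F\<rangle>) = (\<langle>F\<rangle> \<star> \<nu>) \<bullet> (\<tau> \<star> \<langle>X\<rangle>) \<bullet> (\<langle>F\<rangle> \<star> \<tau>XF) \<and>
     (\<langle>F\<rangle> \<star> l) \<bullet> \<tau>XF = (\<tau> \<star> \<langle>X\<rangle>) \<bullet> (\<langle>F\<rangle> \<star> \<tau>XF) \<bullet> (l \<star> \<langle>F\<rangle>) \<and>
     (\<langle>F\<rangle> \<star> \<tau>FX) \<bullet> (\<tau> \<star> \<langle>X\<rangle>) \<bullet> (\<langle>F\<rangle> \<star> \<tau>XF)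
       = (\<tau>XF \<star> \<langle>F\<rangle>) \<bullet> (\<langle>X\<rangle> \<star> \<tau>) \<bullet> (\<tau>FX \<star> \<langle>F\<rangle>) \<and>
     (\<mu> \<star> \<langle>X\<rangle>) \<bullet> (\<langle>F\<rangle> \<star> \<tau>XF) \<bullet> (l \<star> \<langle>F\<rangle>) \<bullet> (\<nu> \<star> \<langle>F\<rangle>) \<bullet> (\<langle>F\<rangle> \<star> \<tau>FX) \<bullet> (\<Delta> \<star> \<langle>X\<rangle>)
       = (\<mu> \<star> \<nu>) \<bullet> (\<langle>F\<rangle> \<star> \<tau> \<star> \<langle>X\<rangle>) \<bullet> (\<Delta> \<star> l)"

text \<open>
  The last conjunct, naturality of \<open>\<tau>BX\<close> in the coaction of \<open>B\<close>, is the analogue for \<open>X\<close> of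
  \<open>coaction_slides_F\<close>. Without it \<open>X M\<close> need not be a relative module.
\<close>

definition yd_cl_obj ::
  "'o \<Rightarrow> 'h \<Rightarrow> 'c \<Rightarrow> 'c \<Rightarrow> 'c \<Rightarrow> 'c \<Rightarrow> 'c \<Rightarrow> 'h \<Rightarrow> 'c \<Rightarrow> 'c \<Rightarrow> 'c \<Rightarrow> 'c \<Rightarrow> ('h, 'c) yd_cl \<Rightarrow> bool" where
  "yd_cl_obj A F \<mu> \<eta> \<Delta> \<epsilon> \<tau> B \<mu>B \<eta>B lB \<tau>BF U \<longleftrightarrow>
     (let X = ycell U; \<tau>FX = tFX U; \<tau>XF = tXF U; \<nu> = yact U; l = ycoact U; \<tau>BX = tBX U in
       classical_yd A F \<mu> \<eta> \<Delta> \<epsilon> \<tau> X \<tau>FX \<tau>XF \<nu> l \<and>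
       Mnd_obj K A B \<mu>B \<eta>B X \<tau>BX \<and>
       (\<langle>X\<rangle> \<star> \<tau>BF) \<bullet> (\<tau>BX \<star> \<langle>F\<rangle>) \<bullet> (\<langle>B\<rangle> \<star> \<tau>FX)
         = (\<tau>FX \<star> \<langle>B\<rangle>) \<bullet> (\<langle>F\<rangle> \<star> \<tau>BX) \<bullet> (\<tau>BF \<star> \<langle>X\<rangle>) \<and>
       (\<langle>F\<rangle> \<star> \<tau>BX) \<bullet> (\<tau>BF \<star> \<langle>X\<rangle>) \<bullet> (\<langle>B\<rangle> \<star> \<tau>XF)
         = (\<tau>XF \<star> \<langle>B\<rangle>) \<bullet> (\<langle>X\<rangle> \<star> \<tau>BF) \<bullet> (\<tau>BX \<star> \<langle>F\<rangle>) \<and>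
       \<tau>BX \<bullet> (\<langle>B\<rangle> \<star> \<nu>) = (\<nu> \<star> \<langle>B\<rangle>) \<bullet> (\<langle>F\<rangle> \<star> \<tau>BX) \<bullet> (\<tau>BF \<star> \<langle>X\<rangle>) \<and>
       (l \<star> \<langle>B\<rangle>) \<bullet> \<tau>BX = (\<langle>F\<rangle> \<star> \<tau>BX) \<bullet> (\<tau>BF \<star> \<langle>X\<rangle>) \<bullet> (\<langle>B\<rangle> \<star> l) \<and>
       (\<langle>X\<rangle> \<star> lB) \<bullet> \<tau>BX = (\<tau>FX \<star> \<langle>B\<rangle>) \<bullet> (\<langle>F\<rangle> \<star> \<tau>BX) \<bullet> (lB \<star> \<langle>X\<rangle>))"

text \<open>
  The two Yang-Baxter equations on \<open>F F X\<close> and \<open>X F F\<close>. They do not follow from the axioms for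
  Yetter-Drinfel'd modules (only the one on \<open>F X F\<close> is among these), and without
  them the tensor product of two Yetter-Drinfel'd modules need not be one again.
\<close>

definition yang_baxter :: "'h \<Rightarrow> 'c \<Rightarrow> ('h, 'c) yd_cl \<Rightarrow> bool" where
  "yang_baxter F \<tau> U \<longleftrightarrow>
     (let X = ycell U; \<tau>FX = tFX U; \<tau>XF = tXF U in
       (\<langle>X\<rangle> \<star> \<tau>) \<bullet> (\<tau>FX \<star> \<langle>F\<rangle>) \<bullet> (\<langle>F\<rangle> \<star> \<tau>FX)
         = (\<tau>FX \<star> \<langle>F\<rangle>) \<bullet> (\<langle>F\<rangle> \<star> \<tau>FX) \<bullet> (\<tau> \<star> \<langle>X\<rangle>) \<and>
       (\<langle>F\<rangle> \<star> \<tau>XF) \<bullet> (\<tau>XF \<star> \<langle>F\<rangle>) \<bullet> (\<langle>X\<rangle> \<star> \<tau>)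
         = (\<tau> \<star> \<langle>X\<rangle>) \<bullet> (\<langle>F\<rangle> \<star> \<tau>XF) \<bullet> (\<tau>XF \<star> \<langle>F\<rangle>))"

definition psi_F :: "'h \<Rightarrow> 'c \<Rightarrow> ('h, 'c) yd_cl \<Rightarrow> 'c" where
  "psi_F F \<Delta> U = (yact U \<star> \<langle>F\<rangle>) \<bullet> (\<langle>F\<rangle> \<star> tFX U) \<bullet> (\<Delta> \<star> \<langle>ycell U\<rangle>)"

definition phi_F :: "'h \<Rightarrow> 'c \<Rightarrow> ('h, 'c) yd_cl \<Rightarrow> 'c" where
  "phi_F F \<mu> U = (\<mu> \<star> \<langle>ycell U\<rangle>) \<bullet> (\<langle>F\<rangle> \<star> tXF U) \<bullet> (ycoact U \<star> \<langle>F\<rangle>)"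

definition psi_B :: "'h \<Rightarrow> 'h \<Rightarrow> 'c \<Rightarrow> ('h, 'c) yd_cl \<Rightarrow> 'c" where
  "psi_B F B lB U = (yact U \<star> \<langle>B\<rangle>) \<bullet> (\<langle>F\<rangle> \<star> tBX U) \<bullet> (lB \<star> \<langle>ycell U\<rangle>)"

definition tensor_cl ::
  "'h \<Rightarrow> 'c \<Rightarrow> 'c \<Rightarrow> ('h, 'c) yd_cl \<Rightarrow> ('h, 'c) yd_cl \<Rightarrow> ('h, 'c) yd_cl" where
  "tensor_cl F \<mu> \<Delta> V U =
     (let Y = ycell V; X = ycell U in
       \<lparr> ycell = Y \<cdot> X,
         tFX = (\<langle>Y\<rangle> \<star> tFX U) \<bullet> (tFX V \<star> \<langle>X\<rangle>),
         tXF = (tXF V \<star> \<langle>X\<rangle>) \<bullet> (\<langle>Y\<rangle> \<star> tXF U),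
         yact = (yact V \<star> yact U) \<bullet> (\<langle>F\<rangle> \<star> tFX V \<star> \<langle>X\<rangle>) \<bullet> (\<Delta> \<star> \<langle>Y \<cdot> X\<rangle>),
         ycoact = (\<mu> \<star> \<langle>Y \<cdot> X\<rangle>) \<bullet> (\<langle>F\<rangle> \<star> tXF V \<star> \<langle>X\<rangle>) \<bullet> (ycoact V \<star> ycoact U),
         tBX = (\<langle>Y\<rangle> \<star> tBX U) \<bullet> (tBX V \<star> \<langle>X\<rangle>) \<rparr>)"

end


section \<open>Categories, functors and actions of monoidal categories\<close>

text \<open>
  Hom-sets need not be disjoint: a morphism is an element of a hom-set together with the two
  objects of that hom-set.
\<close>

record ('a, 'b) cat =
  Obj :: "'a set"
  Hom :: "'a \<Rightarrow> 'a \<Rightarrow> 'b set"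
  Idn :: "'a \<Rightarrow> 'b"
  Cmp :: "'b \<Rightarrow> 'b \<Rightarrow> 'b"

definition category :: "('a, 'b) cat \<Rightarrow> bool" where
  "category C \<longleftrightarrow>
     (\<forall>X\<in>Obj C. Idn C X \<in> Hom C X X) \<and>
     (\<forall>X\<in>Obj C. \<forall>Y\<in>Obj C. \<forall>Z\<in>Obj C. \<forall>f\<in>Hom C X Y. \<forall>g\<in>Hom C Y Z. Cmp C g f \<in> Hom C X Z) \<and>
     (\<forall>X\<in>Obj C. \<forall>Y\<in>Obj C. \<forall>f\<in>Hom C X Y. Cmp C (Idn C Y) f = f \<and> Cmp C f (Idn C X) = f) \<and>
     (\<forall>W\<in>Obj C. \<forall>X\<in>Obj C. \<forall>Y\<in>Obj C. \<forall>Z\<in>Obj C.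
        \<forall>f\<in>Hom C W X. \<forall>g\<in>Hom C X Y. \<forall>h\<in>Hom C Y Z. Cmp C h (Cmp C g f) = Cmp C (Cmp C h g) f)"

definition prod_cat :: "('a, 'b) cat \<Rightarrow> ('d, 'e) cat \<Rightarrow> ('a \<times> 'd, 'b \<times> 'e) cat" where
  "prod_cat C D =
     \<lparr> Obj = Obj C \<times> Obj D,
       Hom = (\<lambda>P Q. Hom C (fst P) (fst Q) \<times> Hom D (snd P) (snd Q)),
       Idn = (\<lambda>P. (Idn C (fst P), Idn D (snd P))),
       Cmp = (\<lambda>g f. (Cmp C (fst g) (fst f), Cmp D (snd g) (snd f))) \<rparr>"

definition is_functor ::
  "('a, 'b) cat \<Rightarrow> ('d, 'e) cat \<Rightarrow> ('a \<Rightarrow> 'd) \<Rightarrow> ('b \<Rightarrow> 'e) \<Rightarrow> bool" where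
  "is_functor C D Fo Fa \<longleftrightarrow>
     category C \<and> category D \<and>
     (\<forall>X\<in>Obj C. Fo X \<in> Obj D) \<and>
     (\<forall>X\<in>Obj C. \<forall>Y\<in>Obj C. \<forall>f\<in>Hom C X Y. Fa f \<in> Hom D (Fo X) (Fo Y)) \<and>
     (\<forall>X\<in>Obj C. Fa (Idn C X) = Idn D (Fo X)) \<and>
     (\<forall>X\<in>Obj C. \<forall>Y\<in>Obj C. \<forall>Z\<in>Obj C. \<forall>f\<in>Hom C X Y. \<forall>g\<in>Hom C Y Z.
        Fa (Cmp C g f) = Cmp D (Fa g) (Fa f))"

definition strict_monoidal ::
  "('a, 'b) cat \<Rightarrow> ('a \<Rightarrow> 'a \<Rightarrow> 'a) \<Rightarrow> ('b \<Rightarrow> 'b \<Rightarrow> 'b) \<Rightarrow> 'a \<Rightarrow> bool" where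
  "strict_monoidal C To Ta I \<longleftrightarrow>
     is_functor (prod_cat C C) C (\<lambda>(Y, X). To Y X) (\<lambda>(g, f). Ta g f) \<and> I \<in> Obj C \<and>
     (\<forall>X\<in>Obj C. To I X = X \<and> To X I = X) \<and>
     (\<forall>X\<in>Obj C. \<forall>Y\<in>Obj C. \<forall>Z\<in>Obj C. To (To Z Y) X = To Z (To Y X)) \<and>
     (\<forall>X\<in>Obj C. \<forall>Y\<in>Obj C. \<forall>f\<in>Hom C X Y. Ta (Idn C I) f = f \<and> Ta f (Idn C I) = f) \<and>
     (\<forall>X\<in>Obj C. \<forall>X'\<in>Obj C. \<forall>Y\<in>Obj C. \<forall>Y'\<in>Obj C. \<forall>Z\<in>Obj C. \<forall>Z'\<in>Obj C.
        \<forall>f\<in>Hom C X X'. \<forall>g\<in>Hom C Y Y'. \<forall>h\<in>Hom C Z Z'. Ta (Ta h g) f = Ta h (Ta g f))"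

text \<open>
  An action, with identities as coherence cells, of \<open>C\<close> with tensor product \<open>To\<close>, \<open>Ta\<close> and
  unit \<open>I\<close> on \<open>D\<close>. It is not part of this predicate that \<open>C\<close> is closed under \<open>To\<close>: the
  associativity law is meaningful and is demanded for all pairs of objects of \<open>C\<close>.
\<close>

definition strict_action ::
  "('a, 'b) cat \<Rightarrow> ('a \<Rightarrow> 'a \<Rightarrow> 'a) \<Rightarrow> ('b \<Rightarrow> 'b \<Rightarrow> 'b) \<Rightarrow> 'a \<Rightarrow> ('d, 'e) cat \<Rightarrow>
   ('a \<Rightarrow> 'd \<Rightarrow> 'd) \<Rightarrow> ('b \<Rightarrow> 'e \<Rightarrow> 'e) \<Rightarrow> bool" where
  "strict_action C To Ta I D Ao Aa \<longleftrightarrow>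
     is_functor (prod_cat C D) D (\<lambda>(X, M). Ao X M) (\<lambda>(f, g). Aa f g) \<and> I \<in> Obj C \<and>
     (\<forall>M\<in>Obj D. Ao I M = M) \<and>
     (\<forall>X\<in>Obj C. \<forall>Y\<in>Obj C. \<forall>M\<in>Obj D. Ao (To Y X) M = Ao Y (Ao X M)) \<and>
     (\<forall>M\<in>Obj D. \<forall>N\<in>Obj D. \<forall>f\<in>Hom D M N. Aa (Idn C I) f = f) \<and>
     (\<forall>X\<in>Obj C. \<forall>X'\<in>Obj C. \<forall>Y\<in>Obj C. \<forall>Y'\<in>Obj C. \<forall>M\<in>Obj D. \<forall>N\<in>Obj D.
        \<forall>x\<in>Hom C X X'. \<forall>y\<in>Hom C Y Y'. \<forall>f\<in>Hom D M N. Aa (Ta y x) f = Aa y (Aa x f))"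


section \<open>The categories in question\<close>

record ('h, 'c) yd_s =
  scell :: 'h
  psiF :: 'c
  phiF :: 'c
  psiB :: 'c

record ('h, 'c) rel_mod =
  mcell :: 'h
  mcoact :: 'c
  mact :: 'c

context
  fixes K :: "('o, 'h, 'c, 'm) two_cat_scheme" (structure)
begin

definition YDcl ::
  "'o \<Rightarrow> 'h \<Rightarrow> 'c \<Rightarrow> 'c \<Rightarrow> 'c \<Rightarrow> 'c \<Rightarrow> 'c \<Rightarrow> 'h \<Rightarrow> 'c \<Rightarrow> 'c \<Rightarrow> 'c \<Rightarrow> 'c \<Rightarrow> (('h, 'c) yd_cl, 'c) cat" where
  "YDcl A F \<mu> \<eta> \<Delta> \<epsilon> \<tau> B \<mu>B \<eta>B lB \<tau>BF =
     \<lparr> Obj = {U. yd_cl_obj K A F \<mu> \<eta> \<Delta> \<epsilon> \<tau> B \<mu>B \<eta>B lB \<tau>BF U},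
       Hom = (\<lambda>U V. {\<zeta>. Mnd_arr K F (ycell U) (psi_F K F \<Delta> U) (ycell V) (psi_F K F \<Delta> V) \<zeta> \<and>
                        Comnd_arr K F (ycell U) (phi_F K F \<mu> U) (ycell V) (phi_F K F \<mu> V) \<zeta> \<and>
                        Mnd_arr K B (ycell U) (tBX U) (ycell V) (tBX V) \<zeta>}),
       Idn = (\<lambda>U. \<langle>ycell U\<rangle>),
       Cmp = vcomp K \<rparr>"

definition assign ::
  "'h \<Rightarrow> 'c \<Rightarrow> 'c \<Rightarrow> 'h \<Rightarrow> 'c \<Rightarrow> ('h, 'c) yd_cl \<Rightarrow> ('h, 'c) yd_s" where
  "assign F \<mu> \<Delta> B lB U =
     \<lparr> scell = ycell U, psiF = psi_F K F \<Delta> U, phiF = phi_F K F \<mu> U, psiB = psi_B K F B lB U \<rparr>"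

text \<open>
  The image under \<open>assign\<close> of the full subcategory of \<open>YDcl\<close> on the objects satisfying \<open>Q\<close>.
  Since \<open>assign\<close> forgets \<open>\<tau>FX\<close>, \<open>\<tau>XF\<close> and \<open>\<tau>BX\<close>, images of morphisms of \<open>YDcl\<close> need not
  be closed under composition; the morphisms here are the 2-cells compatible with the
  structure \<open>\<psi>FX\<close>, \<open>\<phi>XF\<close>, \<open>\<psi>BX\<close> that is retained, among which are the images.
\<close>

definition YDs ::
  "'o \<Rightarrow> 'h \<Rightarrow> 'c \<Rightarrow> 'c \<Rightarrow> 'c \<Rightarrow> 'c \<Rightarrow> 'c \<Rightarrow> 'h \<Rightarrow> 'c \<Rightarrow> 'c \<Rightarrow> 'c \<Rightarrow> 'c \<Rightarrow> (('h, 'c) yd_cl \<Rightarrow> bool) \<Rightarrow>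
   (('h, 'c) yd_s, 'c) cat" where
  "YDs A F \<mu> \<eta> \<Delta> \<epsilon> \<tau> B \<mu>B \<eta>B lB \<tau>BF Q =
     \<lparr> Obj = assign F \<mu> \<Delta> B lB ` {U \<in> Obj (YDcl A F \<mu> \<eta> \<Delta> \<epsilon> \<tau> B \<mu>B \<eta>B lB \<tau>BF). Q U},
       Hom = (\<lambda>S T. {\<zeta>. Mnd_arr K F (scell S) (psiF S) (scell T) (psiF T) \<zeta> \<and>
                        Comnd_arr K F (scell S) (phiF S) (scell T) (phiF T) \<zeta> \<and>
                        Mnd_arr K B (scell S) (psiB S) (scell T) (psiB T) \<zeta>}),
       Idn = (\<lambda>S. \<langle>scell S\<rangle>),
       Cmp = vcomp K \<rparr>"

definition tensor_s :: "('h, 'c) yd_s \<Rightarrow> ('h, 'c) yd_s \<Rightarrow> ('h, 'c) yd_s" where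
  "tensor_s T S =
     (let Y = scell T; X = scell S in
       \<lparr> scell = Y \<cdot> X,
         psiF = (\<langle>Y\<rangle> \<star> psiF S) \<bullet> (psiF T \<star> \<langle>X\<rangle>),
         phiF = (phiF T \<star> \<langle>X\<rangle>) \<bullet> (\<langle>Y\<rangle> \<star> phiF S),
         psiB = (\<langle>Y\<rangle> \<star> psiB S) \<bullet> (psiB T \<star> \<langle>X\<rangle>) \<rparr>)"

definition unit_s :: "'o \<Rightarrow> 'h \<Rightarrow> 'h \<Rightarrow> ('h, 'c) yd_s" where
  "unit_s A F B = \<lparr> scell = \<one> A, psiF = \<langle>F\<rangle>, phiF = \<langle>F\<rangle>, psiB = \<langle>B\<rangle> \<rparr>"

definition RelMod ::
  "'o \<Rightarrow> 'h \<Rightarrow> 'c \<Rightarrow> 'c \<Rightarrow> 'c \<Rightarrow> 'h \<Rightarrow> 'c \<Rightarrow> 'c \<Rightarrow> 'c \<Rightarrow> 'c \<Rightarrow> (('h, 'c) rel_mod, 'c) cat" where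
  "RelMod A F \<mu> \<Delta> \<epsilon> B \<mu>B \<eta>B lB \<tau>BF =
     \<lparr> Obj = {M. left_comodule K A F \<Delta> \<epsilon> (mcell M) (mcoact M) \<and>
                 left_module K A B \<mu>B \<eta>B (mcell M) (mact M) \<and>
                 mcoact M \<bullet> mact M
                   = (\<langle>F\<rangle> \<star> mact M) \<bullet> (psi_BF K F \<mu> B lB \<tau>BF \<star> \<langle>mcell M\<rangle>) \<bullet> (\<langle>B\<rangle> \<star> mcoact M)},
       Hom = (\<lambda>M N. {f \<in> hom2 K (mcell M) (mcell N).
                 mcoact N \<bullet> f = (\<langle>F\<rangle> \<star> f) \<bullet> mcoact M \<and>
                 f \<bullet> mact M = mact N \<bullet> (\<langle>B\<rangle> \<star> f)}),
       Idn = (\<lambda>M. \<langle>mcell M\<rangle>),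
       Cmp = vcomp K \<rparr>"

definition act_obj :: "('h, 'c) yd_s \<Rightarrow> ('h, 'c) rel_mod \<Rightarrow> ('h, 'c) rel_mod" where
  "act_obj S M =
     \<lparr> mcell = scell S \<cdot> mcell M,
       mcoact = (phiF S \<star> \<langle>mcell M\<rangle>) \<bullet> (\<langle>scell S\<rangle> \<star> mcoact M),
       mact = (\<langle>scell S\<rangle> \<star> mact M) \<bullet> (psiB S \<star> \<langle>mcell M\<rangle>) \<rparr>"

end

end

theory Submission
  imports Defs
begin

text \<open>
  Every axiom and every identity needed below is an equation between pasted 2-cells, that is,
  between string diagrams, which in a strict 2-category are determined up to interchange. An
  identity therefore amounts to a finite list of interchanges and applications of axioms;
  \<open>eqn_by_rewriting\<close> turns such a list into a proof, which the simplifier replays on the diagrams.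

  The mathematical core is the hexagon \<open>phi_psiB_hexagon\<close>, which says that \<open>\<phi>\<^sub>X\<^sub>F\<close> and \<open>\<psi>\<^sub>B\<^sub>X\<close>
  are compatible via \<open>\<psi>\<^sub>B\<^sub>F\<close>; with it, the compatibility of coaction and action passes from \<open>M\<close> to
  \<open>X M\<close>. It results from the Yetter-Drinfel'd condition for \<open>X\<close>, after the coaction of \<open>B\<close> has been
  slid past \<open>\<tau>\<^sub>B\<^sub>X\<close> and \<open>\<tau>\<^sub>B\<^sub>F\<close> so that \<open>B\<close> acts through its coaction only. In the same way the
  Yetter-Drinfel'd condition for a tensor product \<open>Y X\<close> results from that for \<open>X\<close>, applied inside,
  followed by that for \<open>Y\<close>.
\<close>

section \<open>String diagrams in a strict 2-category\<close>

text \<open>Every law of \<open>two_category\<close> carries membership premises, and strictness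
  still leaves associativity and unit laws to be inserted by hand; a calculation with these laws
  directly would drown in typing goals. Lists of wires absorb associativity and units of 1-cells,
  and lists of layers absorb those of vertical composition and of whiskering. Interchange is the one
  structural law that stays explicit, as \<open>SwapR\<close> and \<open>SwapL\<close>. Typing is
  checked for the two diagrams at the ends of an identity and is preserved by each successful step.
  A list of steps is a certificate: a step that does not fit yields \<open>None\<close> and the
  proof fails, so nothing about the origin of the list has to be trusted. The Yang-Baxter equations
  enter in one place only, closure under tensor products. The categories are therefore treated with
  a predicate \<open>Q\<close> on Yetter-Drinfel'd modules, and the action law is proved without
  knowing that the tensor product of two objects is again an object.\<close>

type_synonym ('h, 'c) layer = "'h list \<times> ('c \<times> 'h list \<times> 'h list) \<times> 'h list"

datatype ('h, 'c) diagram =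
    Wires "'h list"
  | Cell 'c "'h list" "'h list"
  | Vert "('h, 'c) diagram" "('h, 'c) diagram"  (infixl "\<odot>" 70)
  | Horiz "('h, 'c) diagram" "('h, 'c) diagram"  (infixl "\<otimes>" 75)

abbreviation wire :: "'h \<Rightarrow> ('h, 'c) diagram" ("\<lceil>_\<rceil>") where "\<lceil>X\<rceil> \<equiv> Wires [X]"

fun inputs :: "('h, 'c) diagram \<Rightarrow> 'h list" where
  "inputs (Wires w) = w"
| "inputs (Cell c d e) = d"
| "inputs (s \<odot> t) = inputs t"
| "inputs (s \<otimes> t) = inputs s @ inputs t"

fun outputs :: "('h, 'c) diagram \<Rightarrow> 'h list" where
  "outputs (Wires w) = w"
| "outputs (Cell c d e) = e"
| "outputs (s \<odot> t) = outputs s"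
| "outputs (s \<otimes> t) = outputs s @ outputs t"

fun whisker :: "'h list \<Rightarrow> 'h list \<Rightarrow> ('h, 'c) layer \<Rightarrow> ('h, 'c) layer" where
  "whisker p q (u, g, v) = (p @ u, g, v @ q)"

text \<open>
  A layer is a single cell between identity wires; a diagram is cut into layers from its inputs
  to its outputs.
\<close>

fun layers :: "('h, 'c) diagram \<Rightarrow> ('h, 'c) layer list" where
  "layers (Wires w) = []"
| "layers (Cell c d e) = [([], (c, d, e), [])]"
| "layers (s \<odot> t) = layers t @ layers s"
| "layers (s \<otimes> t)
    = map (whisker (inputs s) []) (layers t) @ map (whisker [] (outputs t)) (layers s)"

fun layer_inputs :: "('h, 'c) layer \<Rightarrow> 'h list" where
  "layer_inputs (u, (c, d, e), v) = u @ d @ v"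

fun layer_outputs :: "('h, 'c) layer \<Rightarrow> 'h list" where
  "layer_outputs (u, (c, d, e), v) = u @ e @ v"

fun stack_outputs :: "'h list \<Rightarrow> ('h, 'c) layer list \<Rightarrow> 'h list" where
  "stack_outputs w [] = w"
| "stack_outputs w (l # ls) = stack_outputs (layer_outputs l) ls"

text \<open>\<open>m\<close> is the word that runs between the two cells. It is guessed from the
  left context of the upper layer, and the test on whole words then rejects cells that are connected
  or that stand in the other order.\<close>

fun swapR :: "('h, 'c) layer list \<Rightarrow> ('h, 'c) layer list option" where
  "swapR ((u, (c, d, e), v) # (u', (c', d', e'), v') # ls) =
     (let m = drop (length u + length e) u' in
       if u' = u @ e @ m \<and> v = m @ d' @ v'
       then Some ((u @ d @ m, (c', d', e'), v') # (u, (c, d, e), m @ e' @ v') # ls) else None)"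
| "swapR _ = None"

fun swapL :: "('h, 'c) layer list \<Rightarrow> ('h, 'c) layer list option" where
  "swapL ((u, (c, d, e), v) # (u', (c', d', e'), v') # ls) =
     (let m = drop (length u' + length d') u in
       if u = u' @ d' @ m \<and> v' = m @ e @ v
       then Some ((u', (c', d', e'), m @ d @ v) # (u' @ e' @ m, (c, d, e), v) # ls) else None)"
| "swapL _ = None"

text \<open>
  \<open>SwapR n\<close> and \<open>SwapL n\<close> exchange the layers \<open>n\<close> and \<open>n + 1\<close> when the upper one
  lies to the right, respectively to the left, of the lower one. \<open>Fwd i n k\<close> applies the
  \<open>i\<close>-th equation from left to right to the layers starting at \<open>n\<close>, with \<open>k\<close> wires to
  their left; \<open>Bwd i n k\<close> applies it from right to left.
\<close>

datatype step = SwapR nat | SwapL nat | Fwd nat nat nat | Bwd nat nat nat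

type_synonym ('o, 'h, 'c) equation = "'o \<times> ('h, 'c) diagram \<times> ('h, 'c) diagram"

text \<open>
  All diagrams have target \<open>A\<close>. Their source varies, to allow for modules
  \<open>M : A' \<rightarrow> A\<close>; it is the first argument of the functions below. An equation comes
  with the source over which it is stated.
\<close>

locale two_category_over = two_category K
  for K :: "('o, 'h, 'c, 'm) two_cat_scheme" (structure) +
  fixes A :: 'o
begin

fun path :: "'o \<Rightarrow> 'o \<Rightarrow> 'h list \<Rightarrow> bool" where
  "path a b [] \<longleftrightarrow> a = b \<and> a \<in> Ob K"
| "path a b (x # w) \<longleftrightarrow> x \<in> hom1 K (src K x) b \<and> path a (src K x) w"

fun word :: "'o \<Rightarrow> 'h list \<Rightarrow> 'h" where
  "word a [] = \<one> a"
| "word a (x # w) = x \<cdot> word a w"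

text \<open>The left factor of a horizontal composite is evaluated over \<open>A\<close>: whatever
  stands to its right has target \<open>A\<close>. Only the rightmost factor can start at another
  0-cell \<open>a\<close>.\<close>

fun sem :: "'o \<Rightarrow> ('h, 'c) diagram \<Rightarrow> 'c" where
  "sem a (Wires w) = \<langle>word a w\<rangle>"
| "sem a (Cell c d e) = c"
| "sem a (s \<odot> t) = sem a s \<bullet> sem a t"
| "sem a (s \<otimes> t) = sem A s \<star> sem a t"

fun wt :: "'o \<Rightarrow> ('h, 'c) diagram \<Rightarrow> bool" where
  "wt a (Wires w) \<longleftrightarrow> path a A w"
| "wt a (Cell c d e) \<longleftrightarrow> path a A d \<and> path a A e \<and> c \<in> hom2 K (word a d) (word a e)"
| "wt a (s \<odot> t) \<longleftrightarrow> wt a s \<and> wt a t \<and> inputs s = outputs t"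
| "wt a (s \<otimes> t) \<longleftrightarrow> wt A s \<and> wt a t"

definition eqn :: "'o \<Rightarrow> ('h, 'c) diagram \<Rightarrow> ('h, 'c) diagram \<Rightarrow> bool" where
  "eqn a l r \<longleftrightarrow> wt a l \<and> wt a r \<and> inputs l = inputs r \<and> outputs l = outputs r \<and> sem a l = sem a r"

fun layer_sem :: "'o \<Rightarrow> ('h, 'c) layer \<Rightarrow> 'c" where
  "layer_sem a (u, (c, d, e), v) = \<langle>word A u\<rangle> \<star> c \<star> \<langle>word a v\<rangle>"

text \<open>The source \<open>s\<close> of the cell is left open so that cells with an
  \<open>M\<close> strand are covered as well: there \<open>v\<close> is empty and \<open>s\<close>
  is the source of \<open>M\<close>.\<close>

fun layer_wt :: "'o \<Rightarrow> ('h, 'c) layer \<Rightarrow> bool" where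
  "layer_wt a (u, (c, d, e), v) \<longleftrightarrow> path A A u \<and>
     (\<exists>s. path s A d \<and> path s A e \<and> path a s v \<and> c \<in> hom2 K (word s d) (word s e))"

fun stack :: "'o \<Rightarrow> 'h list \<Rightarrow> ('h, 'c) layer list \<Rightarrow> 'c" where
  "stack a w [] = \<langle>word a w\<rangle>"
| "stack a w (l # ls) = stack a (layer_outputs l) ls \<bullet> layer_sem a l"

fun stack_wt :: "'o \<Rightarrow> 'h list \<Rightarrow> ('h, 'c) layer list \<Rightarrow> bool" where
  "stack_wt a w [] \<longleftrightarrow> path a A w"
| "stack_wt a w (l # ls) \<longleftrightarrow> w = layer_inputs l \<and> layer_wt a l \<and> stack_wt a (layer_outputs l) ls"

section \<open>Typing of words, layers and stacks\<close>

lemma hom1_One: "X \<in> hom1 K a b \<Longrightarrow> X \<in> One K"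
  by (simp add: hom1_def)

lemma hom1_src: "X \<in> hom1 K a b \<Longrightarrow> src K X = a"
  by (simp add: hom1_def)

lemma path_append: "path a b (u @ v) \<longleftrightarrow> (\<exists>c. path c b u \<and> path a c v)"
proof (induction u arbitrary: b)
  case Nil
  have "b \<in> Ob K" if "path a b v"
    using that by (cases v) (auto simp: hom1_def tgt_Ob)
  then show ?case by auto
qed auto

lemma word_hom: "path a b w \<Longrightarrow> word a w \<in> hom1 K a b"
  by (induction w arbitrary: b) (auto intro: id1_hom comp1_hom)

lemma word_append:
  assumes "path c b u" "path a c v"
  shows "word a (u @ v) = word c u \<cdot> word a v"
  using assms
proof (induction u arbitrary: b)
  case Nil
  then show ?case using comp1_id_left[OF word_hom] by auto
next
  case (Cons x u)
  then show ?case
    using comp1_assoc[of x "src K x" b "word c u" c "word a v" a] word_hom by auto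
qed

lemma path_source_unique: "path a c v \<Longrightarrow> path a' c v \<Longrightarrow> a = a'"
  by (induction v arbitrary: c) auto

lemma id2_comp:
  assumes "X \<in> hom1 K b c" "Y \<in> hom1 K a b"
  shows "\<langle>X \<cdot> Y\<rangle> = \<langle>X\<rangle> \<star> \<langle>Y\<rangle>"
  using hcomp_id2[OF assms] by simp

lemma id2_word: "path a b w \<Longrightarrow> \<langle>word a w\<rangle> \<in> hom2 K (word a w) (word a w)"
  using hom1_One id2_hom word_hom by blast

lemma layer_typing:
  assumes "layer_wt a l"
  shows "path a A (layer_inputs l)" "path a A (layer_outputs l)"
    "layer_sem a l \<in> hom2 K (word a (layer_inputs l)) (word a (layer_outputs l))"
proof -
  obtain u c d e v where l: "l = (u, (c, d, e), v)" by (cases l) auto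
  then obtain s where s: "path A A u" "path s A d" "path s A e" "path a s v"
      "c \<in> hom2 K (word s d) (word s e)"
    using assms by auto
  show "path a A (layer_inputs l)" "path a A (layer_outputs l)"
    using s l by (auto simp: path_append)
  have uc: "\<langle>word A u\<rangle> \<star> c \<in> hom2 K (word A u \<cdot> word s d) (word A u \<cdot> word s e)"
    using hcomp_hom[OF word_hom word_hom id2_word] s by blast
  have "word A u \<cdot> word s d \<in> hom1 K s A"
    using comp1_hom[OF word_hom word_hom] s by blast
  then have "layer_sem a l
      \<in> hom2 K (word A u \<cdot> word s d \<cdot> word a v) (word A u \<cdot> word s e \<cdot> word a v)"
    using hcomp_hom[OF _ word_hom uc id2_word] s l by auto
  moreover have "word a (u @ x @ v) = word A u \<cdot> word s x \<cdot> word a v" if "path s A x" for x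
    using s that word_append[of s A "u @ x" a v] word_append[of A A u s x] path_append
    by auto
  ultimately show "layer_sem a l \<in> hom2 K (word a (layer_inputs l)) (word a (layer_outputs l))"
    using s l by simp
qed

lemma stack_typing:
  "stack_wt a w ls \<Longrightarrow> path a A w \<and> path a A (stack_outputs w ls) \<and>
     stack a w ls \<in> hom2 K (word a w) (word a (stack_outputs w ls))"
  by (induction ls arbitrary: w) (auto intro: id2_word layer_typing vcomp_hom)

lemma stack_wt_append:
  "stack_wt a w (ls @ ls') \<longleftrightarrow> stack_wt a w ls \<and> stack_wt a (stack_outputs w ls) ls'"
proof (induction ls arbitrary: w)
  case Nil
  then show ?case using stack_typing by auto
qed auto

lemma stack_outputs_append: "stack_outputs w (ls @ ls') = stack_outputs (stack_outputs w ls) ls'"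
  by (induction ls arbitrary: w) auto

lemma stack_append:
  assumes "stack_wt a w (ls @ ls')"
  shows "stack a w (ls @ ls') = stack a (stack_outputs w ls) ls' \<bullet> stack a w ls"
  using assms
proof (induction ls arbitrary: w)
  case Nil
  then show ?case using stack_typing vcomp_id_right by force
next
  case (Cons l ls)
  have "stack_wt a (layer_outputs l) ls" "stack_wt a (stack_outputs (layer_outputs l) ls) ls'"
    using Cons.prems by (auto simp: stack_wt_append)
  then show ?case
    using Cons by (auto intro!: vcomp_assoc dest!: stack_typing layer_typing(3))
qed

section \<open>Whiskering, and the meaning of a diagram in terms of its layers\<close>

text \<open>Since the identity of \<open>p\<close> is idempotent under vertical composition,
  interchange distributes whiskering over a stack, one layer at a time.\<close>

lemma whisker_left:
  assumes p: "path A A p" and ls: "stack_wt a w ls"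
  shows "stack_wt a (p @ w) (map (whisker p []) ls)
    \<and> stack_outputs (p @ w) (map (whisker p []) ls) = p @ stack_outputs w ls
    \<and> stack a (p @ w) (map (whisker p []) ls) = \<langle>word A p\<rangle> \<star> stack a w ls"
  using ls
proof (induction ls arbitrary: w)
  case Nil
  then show ?case
    using p by (auto simp: path_append word_append intro: id2_comp word_hom)
next
  case (Cons l ls)
  obtain u c d e v where l: "l = (u, (c, d, e), v)" by (cases l) auto
  then obtain s where s: "path A A u" "path s A d" "path s A e" "path a s v"
      "c \<in> hom2 K (word s d) (word s e)"
    using Cons.prems by auto
  have lw: "layer_wt a l" and lsw: "stack_wt a (layer_outputs l) ls" using Cons.prems by auto
  have wl: "layer_wt a (whisker p [] l)"
    using l s p by (auto simp: path_append)
  have tw: "layer_outputs (whisker p [] l) = p @ layer_outputs l"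
      and bw: "layer_inputs (whisker p [] l) = p @ layer_inputs l"
    using l by auto
  have cv: "\<langle>word A u\<rangle> \<star> c \<in> hom2 K (word A u \<cdot> word s d) (word A u \<cdot> word s e)"
    using hcomp_hom[OF word_hom word_hom id2_word] s by blast
  have ud: "word A u \<cdot> word s d \<in> hom1 K s A"
    using comp1_hom[OF word_hom word_hom] s by blast
  have "layer_sem a (whisker p [] l) = \<langle>word A p\<rangle> \<star> \<langle>word A u\<rangle> \<star> c \<star> \<langle>word a v\<rangle>"
    using l s p word_append[OF p s(1)] id2_comp[OF word_hom word_hom] by auto
  also have "\<langle>word A p\<rangle> \<star> \<langle>word A u\<rangle> \<star> c = \<langle>word A p\<rangle> \<star> (\<langle>word A u\<rangle> \<star> c)"
    by (rule hcomp_assoc[OF word_hom word_hom word_hom id2_word id2_word s(5)])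
      (use p s in auto)
  also have "\<langle>word A p\<rangle> \<star> (\<langle>word A u\<rangle> \<star> c) \<star> \<langle>word a v\<rangle>
      = \<langle>word A p\<rangle> \<star> (\<langle>word A u\<rangle> \<star> c \<star> \<langle>word a v\<rangle>)"
    by (rule hcomp_assoc[OF word_hom ud word_hom id2_word cv id2_word]) (use p s in auto)
  finally have sl: "layer_sem a (whisker p [] l) = \<langle>word A p\<rangle> \<star> layer_sem a l"
    using l by simp
  have "stack a (p @ w) (map (whisker p []) (l # ls))
      = (\<langle>word A p\<rangle> \<star> stack a (layer_outputs l) ls) \<bullet> (\<langle>word A p\<rangle> \<star> layer_sem a l)"
    using Cons.IH[OF lsw] by (simp add: tw sl)
  also have "\<dots> = (\<langle>word A p\<rangle> \<bullet> \<langle>word A p\<rangle>) \<star> (stack a (layer_outputs l) ls \<bullet> layer_sem a l)"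
    by (rule interchange[OF word_hom word_hom id2_word id2_word, symmetric])
      (use p layer_typing[OF lw] stack_typing[OF lsw] in auto)
  also have "\<langle>word A p\<rangle> \<bullet> \<langle>word A p\<rangle> = \<langle>word A p\<rangle>"
    using p id2_word vcomp_id_left by blast
  finally show ?case
    using Cons.IH[OF lsw] Cons.prems wl tw bw by auto
qed

lemma whisker_right:
  assumes q: "path a s q" and ls: "stack_wt s w ls"
  shows "stack_wt a (w @ q) (map (whisker [] q) ls)
    \<and> stack_outputs (w @ q) (map (whisker [] q) ls) = stack_outputs w ls @ q
    \<and> stack a (w @ q) (map (whisker [] q) ls) = stack s w ls \<star> \<langle>word a q\<rangle>"
  using ls
proof (induction ls arbitrary: w)
  case Nil
  then show ?case
    using q word_append[of s A w a q] by (auto simp: path_append intro: id2_comp word_hom)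
next
  case (Cons l ls)
  obtain u c d e v where l: "l = (u, (c, d, e), v)" by (cases l) auto
  then obtain r where r: "path A A u" "path r A d" "path r A e" "path s r v"
      "c \<in> hom2 K (word r d) (word r e)"
    using Cons.prems by auto
  have lw: "layer_wt s l" and lsw: "stack_wt s (layer_outputs l) ls" using Cons.prems by auto
  have wl: "layer_wt a (whisker [] q l)"
    using l r q by (auto simp: path_append)
  have tw: "layer_outputs (whisker [] q l) = layer_outputs l @ q"
      and bw: "layer_inputs (whisker [] q l) = layer_inputs l @ q"
    using l by auto
  have cv: "\<langle>word A u\<rangle> \<star> c \<in> hom2 K (word A u \<cdot> word r d) (word A u \<cdot> word r e)"
    using hcomp_hom[OF word_hom word_hom id2_word] r by blast
  have ud: "word A u \<cdot> word r d \<in> hom1 K r A"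
    using comp1_hom[OF word_hom word_hom] r by blast
  have "layer_sem a (whisker [] q l) = \<langle>word A u\<rangle> \<star> c \<star> (\<langle>word s v\<rangle> \<star> \<langle>word a q\<rangle>)"
    using l r q word_append[OF r(4) q] id2_comp[OF word_hom word_hom] by auto
  also have "\<dots> = \<langle>word A u\<rangle> \<star> c \<star> \<langle>word s v\<rangle> \<star> \<langle>word a q\<rangle>"
    by (rule hcomp_assoc[OF ud word_hom word_hom cv id2_word id2_word, symmetric])
      (use q r in auto)
  finally have sl: "layer_sem a (whisker [] q l) = layer_sem s l \<star> \<langle>word a q\<rangle>"
    using l by simp
  have "stack a (w @ q) (map (whisker [] q) (l # ls))
      = (stack s (layer_outputs l) ls \<star> \<langle>word a q\<rangle>) \<bullet> (layer_sem s l \<star> \<langle>word a q\<rangle>)"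
    using Cons.IH[OF lsw] by (simp add: tw sl)
  also have "\<dots> = (stack s (layer_outputs l) ls \<bullet> layer_sem s l) \<star> (\<langle>word a q\<rangle> \<bullet> \<langle>word a q\<rangle>)"
    by (rule interchange[OF word_hom word_hom _ _ id2_word id2_word, symmetric])
      (use q layer_typing[OF lw] stack_typing[OF lsw] in auto)
  also have "\<langle>word a q\<rangle> \<bullet> \<langle>word a q\<rangle> = \<langle>word a q\<rangle>"
    using q id2_word vcomp_id_left by blast
  finally show ?case
    using Cons.IH[OF lsw] Cons.prems wl tw bw by auto
qed

text \<open>Interchange is used in the horizontal case only: \<open>s \<star> t\<close> factors as
  \<open>t\<close> whiskered by the inputs of \<open>s\<close>, followed by \<open>s\<close>
  whiskered by the outputs of \<open>t\<close>. This is the order fixed by \<open>layers\<close>,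
  with the right-hand factor below.\<close>

lemma layers_sound:
  "wt a t \<Longrightarrow> stack_wt a (inputs t) (layers t) \<and> stack_outputs (inputs t) (layers t) = outputs t
     \<and> stack a (inputs t) (layers t) = sem a t"
proof (induction t arbitrary: a)
  case (Wires w)
  then show ?case by simp
next
  case (Cell c d e)
  have "\<langle>\<one> A\<rangle> \<star> c \<star> \<langle>\<one> a\<rangle> = c"
    using Cell hcomp_id_left[OF word_hom] hcomp_id_right[OF word_hom] by auto
  moreover have "\<langle>word a e\<rangle> \<bullet> c = c"
    using Cell vcomp_id_left by auto
  moreover have "A \<in> Ob K" "a \<in> Ob K"
    using Cell word_hom[of a A d] src_Ob tgt_Ob by (fastforce simp: hom1_def)+
  ultimately show ?case
    using Cell by auto
next
  case (Vert s t)
  then show ?case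
    by (auto simp: stack_wt_append stack_outputs_append stack_append)
next
  case (Horiz s t)
  have IHs: "stack_wt A (inputs s) (layers s)" "stack_outputs (inputs s) (layers s) = outputs s"
      "stack A (inputs s) (layers s) = sem A s"
    and IHt: "stack_wt a (inputs t) (layers t)" "stack_outputs (inputs t) (layers t) = outputs t"
      "stack a (inputs t) (layers t) = sem a t"
    using Horiz by auto
  have s: "path A A (inputs s)" "path A A (outputs s)"
      "sem A s \<in> hom2 K (word A (inputs s)) (word A (outputs s))"
    and t: "path a A (inputs t)" "path a A (outputs t)"
      "sem a t \<in> hom2 K (word a (inputs t)) (word a (outputs t))"
    using stack_typing[OF IHs(1)] stack_typing[OF IHt(1)] IHs IHt by auto
  have "(sem A s \<star> \<langle>word a (outputs t)\<rangle>) \<bullet> (\<langle>word A (inputs s)\<rangle> \<star> sem a t)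
      = (sem A s \<bullet> \<langle>word A (inputs s)\<rangle>) \<star> (\<langle>word a (outputs t)\<rangle> \<bullet> sem a t)"
    by (rule interchange[OF word_hom word_hom id2_word _ _ id2_word, symmetric])
      (use s t in auto)
  then have "(sem A s \<star> \<langle>word a (outputs t)\<rangle>) \<bullet> (\<langle>word A (inputs s)\<rangle> \<star> sem a t) = sem a (s \<otimes> t)"
    using s t vcomp_id_left vcomp_id_right by auto
  then show ?case
    using whisker_left[OF s(1) IHt(1)] whisker_right[OF t(2) IHs(1)] IHs IHt
    by (auto simp: stack_wt_append stack_outputs_append stack_append)
qed

section \<open>Interchange of neighbouring layers\<close>

definition same_stack :: "'o \<Rightarrow> 'h list \<Rightarrow> ('h, 'c) layer list \<Rightarrow> ('h, 'c) layer list \<Rightarrow> bool" where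
  "same_stack a w ls ls' \<longleftrightarrow>
     stack_wt a w ls' \<and> stack_outputs w ls' = stack_outputs w ls \<and> stack a w ls' = stack a w ls"

lemma same_stack_context:
  assumes "stack_wt a w (pre @ mid @ post)" and "same_stack a (stack_outputs w pre) mid mid'"
  shows "same_stack a w (pre @ mid @ post) (pre @ mid' @ post)"
proof -
  have "stack_wt a w (pre @ mid' @ post)"
    using assms by (auto simp: stack_wt_append same_stack_def)
  then show ?thesis
    using assms
    by (auto simp: stack_wt_append same_stack_def stack_outputs_append stack_append)
qed

text \<open>Both sides equal \<open>s \<star> t\<close>.\<close>

lemma exchange:
  assumes "X \<in> hom1 K b c" "Y \<in> hom1 K a b" "X' \<in> hom1 K b c" "Y' \<in> hom1 K a b"
    and s: "s \<in> hom2 K X X'" and t: "t \<in> hom2 K Y Y'"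
  shows "(\<langle>X'\<rangle> \<star> t) \<bullet> (s \<star> \<langle>Y\<rangle>) = (s \<star> \<langle>Y'\<rangle>) \<bullet> (\<langle>X\<rangle> \<star> t)"
proof -
  have ids: "\<langle>Z\<rangle> \<in> hom2 K Z Z" if "Z \<in> {X, X', Y, Y'}" for Z
    using assms that id2_hom hom1_One by blast
  have "(\<langle>X'\<rangle> \<star> t) \<bullet> (s \<star> \<langle>Y\<rangle>) = (\<langle>X'\<rangle> \<bullet> s) \<star> (t \<bullet> \<langle>Y\<rangle>)"
    by (rule interchange[OF assms(1,2) s ids ids t, symmetric]) auto
  also have "\<dots> = (s \<bullet> \<langle>X\<rangle>) \<star> (\<langle>Y'\<rangle> \<bullet> t)"
    using s t vcomp_id_left vcomp_id_right by simp
  also have "\<dots> = (s \<star> \<langle>Y'\<rangle>) \<bullet> (\<langle>X\<rangle> \<star> t)"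
    by (rule interchange[OF assms(1,2) ids s t ids]) auto
  finally show ?thesis .
qed

lemma swapR_cases:
  assumes "swapR ls = Some ls'"
  obtains u c d e m c' d' e' v rest where
    "ls = (u, (c, d, e), m @ d' @ v) # (u @ e @ m, (c', d', e'), v) # rest"
    "ls' = (u @ d @ m, (c', d', e'), v) # (u, (c, d, e), m @ e' @ v) # rest"
proof (cases ls rule: swapR.cases)
  case (1 u c d e v u' c' d' e' v' rest)
  define m where "m = drop (length u + length e) u'"
  have "u' = u @ e @ m \<and> v = m @ d' @ v' \<and>
      Some ((u @ d @ m, (c', d', e'), v') # (u, (c, d, e), m @ e' @ v') # rest) = Some ls'"
    using assms unfolding 1 swapR.simps Let_def m_def[symmetric] by (simp split: if_splits)
  then show ?thesis
    using that 1 by blast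
qed (use assms in auto)

lemma swapL_cases:
  assumes "swapL ls = Some ls'"
  obtains u c d e m c' d' e' v rest where
    "ls = (u @ d @ m, (c', d', e'), v) # (u, (c, d, e), m @ e' @ v) # rest"
    "ls' = (u, (c, d, e), m @ d' @ v) # (u @ e @ m, (c', d', e'), v) # rest"
proof (cases ls rule: swapL.cases)
  case (1 u c d e v u' c' d' e' v' rest)
  define m where "m = drop (length u' + length d') u"
  have "u = u' @ d' @ m \<and> v' = m @ e @ v \<and>
      Some ((u', (c', d', e'), m @ d @ v) # (u' @ e' @ m, (c, d, e), v) # rest) = Some ls'"
    using assms unfolding 1 swapL.simps Let_def m_def[symmetric] by (simp split: if_splits)
  then show ?thesis
    using that 1 by blast
qed (use assms in auto)

text \<open>Sources of paths are unique, so \<open>m\<close> has to end where \<open>d\<close>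
  begins. This recovers the typing of the wires between two cells from that of the upper
  layer.\<close>

lemma path_middle:
  assumes "path A b u" "path s A d" "path A b (u @ d @ m)"
  shows "path A s m"
proof -
  obtain c c' where "path c' b u" "path c c' d" "path A c m"
    using assms(3) by (auto simp: path_append)
  then show ?thesis
    using assms(1,2) path_source_unique by blast
qed

text \<open>The diagram is cut between the first cell and \<open>m\<close>. With \<open>?P\<close>
  to the left and \<open>?Q\<close> to the right of the cut, the two layers are \<open>?P\<close>
  and \<open>?Q\<close> whiskered by identities, so \<open>exchange\<close> applies; the rest is
  reassociation.\<close>

lemma layer_exchange:
  assumes u: "path A A u" and d: "path s A d" "path s A e" and m: "path A s m"
    and d': "path s' A d'" "path s' A e'" and v: "path a s' v"
    and c: "c \<in> hom2 K (word s d) (word s e)" and c': "c' \<in> hom2 K (word s' d') (word s' e')"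
  shows "stack_wt a (u @ d @ m @ d' @ v) [(u, (c, d, e), m @ d' @ v), (u @ e @ m,
      (c', d', e'), v)]"
    and "stack_wt a (u @ d @ m @ d' @ v) [(u @ d @ m, (c', d', e'), v), (u,
        (c, d, e), m @ e' @ v)]"
    and "layer_sem a (u @ e @ m, (c', d', e'), v) \<bullet> layer_sem a (u, (c, d, e), m @ d' @ v)
      = layer_sem a (u, (c, d, e), m @ e' @ v) \<bullet> layer_sem a (u @ d @ m, (c', d', e'), v)"
proof -
  have x: "path s A (u @ x)" "path A A (u @ x @ m)"
      "word A (u @ x @ m) = word s (u @ x) \<cdot> word A m"
    "word s (u @ x) = word A u \<cdot> word s x"
    if "path s A x" for x
    using that u m word_append[of s A "u @ x" A m] word_append[of A A u s x]
    by (auto simp: path_append)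
  have y: "path a s (m @ y @ v)" "word a (m @ y @ v) = word A m \<cdot> word s' y \<cdot> word a v"
    "path s' s (m @ y)" "word s' (m @ y) = word A m \<cdot> word s' y"
    if "path s' A y" for y
    using that v m word_append[of s' s "m @ y" a v] word_append[of A s m s' y]
    by (auto simp: path_append)
  show "stack_wt a (u @ d @ m @ d' @ v) [(u, (c, d, e), m @ d' @ v), (u @ e @ m,
      (c', d', e'), v)]"
    "stack_wt a (u @ d @ m @ d' @ v) [(u @ d @ m, (c', d', e'), v), (u, (c, d, e), m @ e' @ v)]"
    using u d m d' v c c' x y by (auto simp: path_append)
  let ?P = "\<langle>word A u\<rangle> \<star> c" and ?Q = "\<langle>word A m\<rangle> \<star> c' \<star> \<langle>word a v\<rangle>"
  have P: "?P \<in> hom2 K (word s (u @ d)) (word s (u @ e))"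
    using hcomp_hom[OF word_hom word_hom id2_word c] u d by (simp add: x)
  have mc: "\<langle>word A m\<rangle> \<star> c' \<in> hom2 K (word s' (m @ d')) (word s' (m @ e'))"
    using hcomp_hom[OF word_hom word_hom id2_word c'] m d' by (simp add: y)
  have Q: "?Q \<in> hom2 K (word a (m @ d' @ v)) (word a (m @ e' @ v))"
    using hcomp_hom[OF word_hom word_hom mc id2_word, OF y(3)[OF d'(1)] v v] y d' by simp
  have L: "layer_sem a (u @ x @ m, (c', d', e'), v) = \<langle>word s (u @ x)\<rangle> \<star> ?Q"
    if "path s A x" for x
  proof -
    have "layer_sem a (u @ x @ m, (c', d', e'), v)
        = \<langle>word s (u @ x)\<rangle> \<star> \<langle>word A m\<rangle> \<star> c' \<star> \<langle>word a v\<rangle>"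
      using x[OF that] id2_comp[OF word_hom[OF x(1)[OF that]] word_hom[OF m]] by simp
    also have "\<langle>word s (u @ x)\<rangle> \<star> \<langle>word A m\<rangle> \<star> c' = \<langle>word s (u @ x)\<rangle> \<star> (\<langle>word A m\<rangle> \<star> c')"
      by (rule hcomp_assoc[OF word_hom word_hom word_hom id2_word id2_word c'])
        (use x[OF that] m d' in auto)
    also have "\<dots> \<star> \<langle>word a v\<rangle> = \<langle>word s (u @ x)\<rangle> \<star> ?Q"
      by (rule hcomp_assoc[OF word_hom word_hom word_hom id2_word mc id2_word])
        (use x[OF that] y d' v in auto)
    finally show ?thesis .
  qed
  have "(\<langle>word s (u @ e)\<rangle> \<star> ?Q) \<bullet> (?P \<star> \<langle>word a (m @ d' @ v)\<rangle>)
      = (?P \<star> \<langle>word a (m @ e' @ v)\<rangle>) \<bullet> (\<langle>word s (u @ d)\<rangle> \<star> ?Q)"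
    by (rule exchange[OF word_hom word_hom word_hom word_hom P Q]) (use x y d d' in auto)
  then show "layer_sem a (u @ e @ m, (c', d', e'), v) \<bullet> layer_sem a (u, (c, d, e), m @ d' @ v)
      = layer_sem a (u, (c, d, e), m @ e' @ v) \<bullet> layer_sem a (u @ d @ m, (c', d', e'), v)"
    using L d by simp
qed

lemma same_stack_two:
  assumes "stack_wt a w (l1 # l2 # ls)" "stack_wt a w [k1, k2]"
    and "layer_outputs k2 = layer_outputs l2"
        "layer_sem a k2 \<bullet> layer_sem a k1 = layer_sem a l2 \<bullet> layer_sem a l1"
  shows "same_stack a w (l1 # l2 # ls) (k1 # k2 # ls)"
proof -
  have assoc: "stack a w (x # y # ls)
      = stack a (layer_outputs y) ls \<bullet> (layer_sem a y \<bullet> layer_sem a x)"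
    if "stack_wt a w (x # y # ls)" for x y
  proof -
    have "layer_wt a x" "layer_wt a y" "stack_wt a (layer_outputs y) ls"
        "layer_outputs x = layer_inputs y"
      using that by auto
    then show ?thesis
      using vcomp_assoc[of "stack a (layer_outputs y) ls"
        "word a (layer_outputs y)" _ "layer_sem a y" "word a (layer_outputs x)"
          "layer_sem a x"
            "word a (layer_inputs x)"] stack_typing[of a "layer_outputs y" ls]
              layer_typing(3)[of a x] layer_typing(3)[of a y]
      by auto
  qed
  have "stack_wt a w (k1 # k2 # ls)"
    using assms by auto
  then show ?thesis
    using assms assoc[of l1 l2] assoc[of k1 k2] by (simp add: same_stack_def)
qed

lemma swapR_sound:
  assumes "stack_wt a w ls" "swapR ls = Some ls'"
  shows "same_stack a w ls ls'"
proof -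
  obtain u c d e m c' d' e' v rest where
    ls: "ls = (u, (c, d, e), m @ d' @ v) # (u @ e @ m, (c', d', e'), v) # rest" and
    ls': "ls' = (u @ d @ m, (c', d', e'), v) # (u, (c, d, e), m @ e' @ v) # rest"
    using assms(2) by (rule swapR_cases)
  obtain s where s: "path A A u" "path s A d" "path s A e" "c \<in> hom2 K (word s d) (word s e)"
    using assms(1) ls by auto
  obtain s' where s': "path A A (u @ e @ m)" "path s' A d'" "path s' A e'" "path a s' v"
      "c' \<in> hom2 K (word s' d') (word s' e')"
    using assms(1) ls by auto
  note ex = layer_exchange[OF s(1-3) path_middle[OF s(1,3) s'(1)] s'(2-4) s(4) s'(5)]
  have w: "w = u @ d @ m @ d' @ v" using assms(1) ls by simp
  show ?thesis
    unfolding ls ls'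
    by (rule same_stack_two) (use assms(1) ls ex w in auto)
qed

lemma swapL_sound:
  assumes "stack_wt a w ls" "swapL ls = Some ls'"
  shows "same_stack a w ls ls'"
proof -
  obtain u c d e m c' d' e' v rest where
    ls: "ls = (u @ d @ m, (c', d', e'), v) # (u, (c, d, e), m @ e' @ v) # rest" and
    ls': "ls' = (u, (c, d, e), m @ d' @ v) # (u @ e @ m, (c', d', e'), v) # rest"
    using assms(2) by (rule swapL_cases)
  obtain s where s: "path A A u" "path s A d" "path s A e" "c \<in> hom2 K (word s d) (word s e)"
    using assms(1) ls by auto
  obtain s' where s': "path A A (u @ d @ m)" "path s' A d'" "path s' A e'" "path a s' v"
      "c' \<in> hom2 K (word s' d') (word s' e')"
    using assms(1) ls by auto
  note ex = layer_exchange[OF s(1-3) path_middle[OF s(1,2) s'(1)] s'(2-4) s(4) s'(5)]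
  have w: "w = u @ d @ m @ d' @ v" using assms(1) ls by simp
  show ?thesis
    unfolding ls ls'
    by (rule same_stack_two) (use assms(1) ls ex w in auto)
qed

section \<open>Rewriting by a list of steps, and its soundness\<close>

text \<open>At height \<open>n\<close> the word \<open>w'\<close> is split into \<open>p\<close>,
  the inputs of the equation, and \<open>q\<close>; the layers have to agree literally with the
  whiskered left-hand side. The typing of \<open>p\<close> and \<open>q\<close> is tested because an
  identity diagram on the empty word has neither layers nor inputs and would match everywhere, also
  over a 0-cell other than \<open>A\<close>.\<close>

fun rewrite_at ::
  "'o \<Rightarrow> 'h list \<Rightarrow> nat \<Rightarrow> nat \<Rightarrow> ('o, 'h, 'c) equation \<Rightarrow> ('h, 'c) layer list
      \<Rightarrow> ('h, 'c) layer list option"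
where
  "rewrite_at a w n k (s, l, r) ls =
     (let w' = stack_outputs w (take n ls); p = take k w'; q = drop (k + length (inputs l)) w';
          ml = map (whisker p q) (layers l)
      in if take (length ml) (drop n ls) = ml \<and> w' = p @ inputs l @ q \<and> path A A p \<and> path a s q
         then Some (take n ls @ map (whisker p q) (layers r) @ drop
           (n + length ml) ls) else None)"

fun run_step ::
  "('o, 'h, 'c) equation list \<Rightarrow> 'o \<Rightarrow> 'h list \<Rightarrow> step \<Rightarrow> ('h, 'c) layer list
      \<Rightarrow> ('h, 'c) layer list option"
where
  "run_step es a w (SwapR n) ls = map_option ((@) (take n ls)) (swapR (drop n ls))"
| "run_step es a w (SwapL n) ls = map_option ((@) (take n ls)) (swapL (drop n ls))"
| "run_step es a w (Fwd i n k) ls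
    = (if i < length es then rewrite_at a w n k (es ! i) ls else None)"
| "run_step es a w (Bwd i n k) ls =
     (if i < length es then case es ! i of (s, l, r) \<Rightarrow> rewrite_at a w n k (s, r, l) ls else None)"

fun run ::
  "('o, 'h, 'c) equation list \<Rightarrow> 'o \<Rightarrow> 'h list \<Rightarrow> step list \<Rightarrow> ('h, 'c) layer list
      \<Rightarrow> ('h, 'c) layer list option"
where
  "run es a w [] ls = Some ls"
| "run es a w (x # xs) ls =
     (case run_step es a w x ls of None \<Rightarrow> None | Some ls' \<Rightarrow> run es a w xs ls')"

lemma rewrite_at_sound:
  assumes e: "eqn s l r" and ls: "stack_wt a w ls"
      and rw: "rewrite_at a w n k (s, l, r) ls = Some ls'"
  shows "same_stack a w ls ls'"
proof -
  define w' p q where "w' = stack_outputs w (take n ls)" and "p = take k w'"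
    and "q = drop (k + length (inputs l)) w'"
  define wh :: "('h, 'c) diagram \<Rightarrow> ('h, 'c) layer list"
    where "wh t = map (whisker p q) (layers t)" for t
  have *: "take (length (wh l)) (drop n ls) = wh l \<and> w'
      = p @ inputs l @ q \<and> path A A p \<and> path a s q \<and>
      Some (take n ls @ wh r @ drop (n + length (wh l)) ls) = Some ls'"
    using rw unfolding rewrite_at.simps Let_def w'_def[symmetric] p_def[symmetric]
        q_def[symmetric]
      wh_def[symmetric] by (simp split: if_splits)
  then have mid: "take (length (wh l)) (drop n ls) = wh l" "w' = p @ inputs l @ q" "path A A p"
      "path a s q"
    and ls': "ls' = take n ls @ wh r @ drop (n + length (wh l)) ls"
    by auto
  have "ls = take n ls @ take (length (wh l)) (drop n ls) @ drop (n + length (wh l)) ls"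
    using append_take_drop_id[of n ls] append_take_drop_id[of "length (wh l)" "drop n ls"]
    by (simp add: add.commute)
  then have split: "ls = take n ls @ wh l @ drop (n + length (wh l)) ls"
    using mid by simp
  have wh: "stack_wt a (p @ inputs t @ q) (wh t)
      \<and> stack_outputs (p @ inputs t @ q) (wh t) = p @ outputs t @ q
      \<and> stack a (p @ inputs t @ q) (wh t) = \<langle>word A p\<rangle> \<star> (sem s t \<star> \<langle>word a q\<rangle>)"
    if "wt s t" for t
  proof -
    \<comment> \<open>The right context comes first: it moves the source from \<open>s\<close> to
      \<open>a\<close>, after which \<open>p\<close> is added over \<open>a\<close>.\<close>
    have eq: "wh t = map (whisker p []) (map (whisker [] q) (layers t))"
      by (auto simp: wh_def)
    show ?thesis
      unfolding eq
      using whisker_left[OF mid(3), of a "inputs t @ q" "map (whisker [] q) (layers t)"]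
        whisker_right[OF mid(4), of "inputs t" "layers t"] layers_sound[OF that]
      by auto
  qed
  have "same_stack a (stack_outputs w (take n ls)) (wh l) (wh r)"
    using wh[of l] wh[of r] e mid(2) by (auto simp: eqn_def same_stack_def w'_def)
  from same_stack_context[OF _ this, of "drop (n + length (wh l)) ls"] show ?thesis
    using ls split ls' by simp
qed

definition eqns :: "('o, 'h, 'c) equation list \<Rightarrow> bool" where
  "eqns es \<longleftrightarrow> (\<forall>(s, l, r)\<in>set es. eqn s l r)"

lemma eqns_Nil: "eqns []"
  by (simp add: eqns_def)

lemma eqns_Cons: "eqn s l r \<Longrightarrow> eqns es \<Longrightarrow> eqns ((s, l, r) # es)"
  by (simp add: eqns_def)

lemma eqn_sym: "eqn s l r \<Longrightarrow> eqn s r l"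
  by (simp add: eqn_def)

lemma same_stack_trans:
  "same_stack a w ls ls' \<Longrightarrow> same_stack a w ls' ls'' \<Longrightarrow> same_stack a w ls ls''"
  by (simp add: same_stack_def)

lemma run_step_sound:
  assumes es: "eqns es" and ls: "stack_wt a w ls" and st: "run_step es a w x ls = Some ls'"
  shows "same_stack a w ls ls'"
proof -
  have context_suffix: "same_stack a w ls (take n ls @ mid)"
    if "\<And>v. stack_wt a v (drop n ls) \<Longrightarrow> same_stack a v (drop n ls) mid" for n mid
    using same_stack_context[of a w "take n ls" "drop n ls" "[]" mid] ls that
      stack_wt_append[of a w "take n ls" "drop n ls"] by simp
  have in_eqns: "eqn s l r" if "es ! i = (s, l, r)" "i < length es" for i s l r
    using es that nth_mem unfolding eqns_def by fastforce
  show ?thesis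
  proof (cases x)
    case (SwapR n)
    then obtain mid where "swapR (drop n ls) = Some mid" "ls' = take n ls @ mid"
      using st by auto
    then show ?thesis using context_suffix swapR_sound by blast
  next
    case (SwapL n)
    then obtain mid where "swapL (drop n ls) = Some mid" "ls' = take n ls @ mid"
      using st by auto
    then show ?thesis using context_suffix swapL_sound by blast
  next
    case (Fwd i n k)
    obtain s l r where e: "es ! i = (s, l, r)" by (cases "es ! i")
    then have "eqn s l r" "rewrite_at a w n k (s, l, r) ls = Some ls'"
      using st Fwd in_eqns[OF e] by (auto simp del: rewrite_at.simps split: if_splits)
    then show ?thesis using rewrite_at_sound ls by blast
  next
    case (Bwd i n k)
    obtain s l r where e: "es ! i = (s, l, r)" by (cases "es ! i")
    then have "eqn s r l" "rewrite_at a w n k (s, r, l) ls = Some ls'"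
      using st Bwd in_eqns[OF e] eqn_sym by (auto simp del: rewrite_at.simps split: if_splits)
    then show ?thesis using rewrite_at_sound ls by blast
  qed
qed

lemma run_sound:
  "eqns es \<Longrightarrow> stack_wt a w ls \<Longrightarrow> run es a w xs ls = Some ls' \<Longrightarrow> same_stack a w ls ls'"
proof (induction xs arbitrary: ls)
  case Nil
  then show ?case by (simp add: same_stack_def)
next
  case (Cons x xs)
  then obtain mid where "run_step es a w x ls = Some mid" "run es a w xs mid = Some ls'"
    by (auto split: option.splits)
  then show ?case
    using Cons run_step_sound same_stack_trans same_stack_def by metis
qed

text \<open>The two lists of steps meet in a common stack, which never has to be written down: the
  result of \<open>xs\<close> on the left is compared literally with that of \<open>ys\<close> on
  the right. All premises can be evaluated once the words and cells are concrete, which is what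
  makes them goals for the simplifier.\<close>

theorem eqn_by_rewriting:
  assumes "eqns es" and "wt a l" "wt a r" and "inputs l = inputs r" "outputs l = outputs r"
    and "case run es a (inputs l) xs (layers l) of None \<Rightarrow> False
      | Some ls \<Rightarrow> run es a (inputs r) ys (layers r) = Some ls"
  shows "eqn a l r"
proof -
  obtain ls where ls: "run es a (inputs l) xs (layers l) = Some ls"
      "run es a (inputs r) ys (layers r) = Some ls"
    using assms(6) by (auto split: option.splits)
  show ?thesis
    using layers_sound[OF assms(2)] layers_sound[OF assms(3)] run_sound[OF assms(1) _ ls(1)]
      run_sound[OF assms(1) _ ls(2)] assms(2-5)
    by (auto simp: eqn_def same_stack_def)
qed

section \<open>Actions of monad and comonad morphisms on modules and comodules\<close>

lemma wt_hom2: "wt a t \<Longrightarrow> sem a t \<in> hom2 K (word a (inputs t)) (word a (outputs t))"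
  using layers_sound stack_typing by metis

text \<open>A one-letter word evaluates to \<open>X \<cdot> \<one> a\<close>, because words are
  closed off by an identity 1-cell. The fourth clause removes it, so that the value of a diagram
  becomes the formula that the definitions use.\<close>

lemma hom1_typing:
  assumes "X \<in> hom1 K a A"
  shows "src K X = a" "tgt K X = A" "X \<in> One K" "X \<cdot> \<one> a = X" "a \<in> Ob K"
  using assms comp1_id_right src_Ob by (auto simp: hom1_def)

text \<open>Comultiplying the \<open>F\<close> that has passed through \<open>\<phi>\<close> amounts
  to comultiplying it before and passing both copies through \<open>\<phi>\<close>; below
  \<open>\<phi>\<close>, coassociativity of \<open>l\<close> applies. The axioms for
  \<open>\<phi>\<close> are equations over \<open>A\<close>, those for \<open>l\<close> equations
  over the source of \<open>M\<close>.\<close>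

lemma comodule_act:
  assumes "F \<in> hom1 K A A" "\<Delta> \<in> hom2 K F (F \<cdot> F)" "\<epsilon> \<in> hom2 K F (\<one> A)"
    and "Comnd_obj K A F \<Delta> \<epsilon> X \<phi>" and "left_comodule K A F \<Delta> \<epsilon> M l"
  shows "left_comodule K A F \<Delta> \<epsilon> (X \<cdot> M) ((\<phi> \<star> \<langle>M\<rangle>) \<bullet> (\<langle>X\<rangle> \<star> l))"
proof -
  let ?a = "src K M"
  have hom: "X \<in> hom1 K A A" "M \<in> hom1 K ?a A" "\<phi> \<in> hom2 K (X \<cdot> F) (F \<cdot> X)" "l \<in> hom2 K M (F \<cdot> M)"
    using assms by (auto simp: Comnd_obj_def left_comodule_def hom1_def)
  note [simp] = assms(1-3) hom assms(1)[THEN hom1_typing(1)] hom(1,2)[THEN hom1_typing(4)]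
    hom(1)[THEN hom1_typing(1)] assms(1)[THEN hom1_typing(4)] hom(2)[THEN hom1_typing(5)]
        assms(1)[THEN hom1_typing(5)]
  let ?\<Delta> = "Cell \<Delta> [F] [F, F]" and ?\<epsilon> = "Cell \<epsilon> [F] []" and ?\<phi> = "Cell \<phi> [X, F] [F, X]"
      and ?l = "Cell l [M] [F, M]"
  let ?coact = "?\<phi> \<otimes> \<lceil>M\<rceil> \<odot> \<lceil>X\<rceil> \<otimes> ?l"
  have phi_comult: "eqn A
        (?\<Delta> \<otimes> \<lceil>X\<rceil> \<odot> ?\<phi>)
        (\<lceil>F\<rceil> \<otimes> ?\<phi> \<odot> ?\<phi> \<otimes> \<lceil>F\<rceil> \<odot> \<lceil>X\<rceil> \<otimes> ?\<Delta>)"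
    using assms by (simp add: eqn_def Comnd_obj_def)
  have phi_counit: "eqn A
        (?\<epsilon> \<otimes> \<lceil>X\<rceil> \<odot> ?\<phi>)
        (\<lceil>X\<rceil> \<otimes> ?\<epsilon>)"
    using assms by (simp add: eqn_def Comnd_obj_def)
  have l_coassoc: "eqn ?a
        (\<lceil>F\<rceil> \<otimes> ?l \<odot> ?l)
        (?\<Delta> \<otimes> \<lceil>M\<rceil> \<odot> ?l)"
    using assms by (simp add: eqn_def left_comodule_def)
  have l_counit: "eqn ?a (?\<epsilon> \<otimes> \<lceil>M\<rceil> \<odot> ?l) \<lceil>M\<rceil>"
    using assms by (simp add: eqn_def left_comodule_def)
  have coassoc: "eqn ?a
        (\<lceil>F\<rceil> \<otimes> ?coact \<odot> ?coact)
        (?\<Delta> \<otimes> Wires [X, M] \<odot> ?coact)"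
    by (rule eqn_by_rewriting[OF eqns_Cons[OF l_coassoc eqns_Cons[OF phi_comult eqns_Nil]],
        where xs = "[SwapR 1, Fwd 0 0 1]"
        and ys = "[Fwd 1 1 0]"]) (simp_all add: Let_def)
  have counit: "eqn ?a (?\<epsilon> \<otimes> Wires [X, M] \<odot> ?coact) (Wires [X, M])"
    by (rule eqn_by_rewriting[OF eqns_Cons[OF phi_counit eqns_Cons[OF l_counit eqns_Nil]],
        where xs = "[Fwd 0 1 0, Fwd 1 0 1]"
        and ys = "[]"]) (simp_all add: Let_def)
  have "X \<cdot> M \<in> hom1 K ?a A"
    by (rule comp1_hom[OF hom(1,2)])
  then show ?thesis
    using coassoc counit wt_hom2[of ?a ?coact] by (simp add: eqn_def left_comodule_def hom1_def)
qed

lemma module_act: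
  assumes "B \<in> hom1 K A A" "\<mu> \<in> hom2 K (B \<cdot> B) B" "\<eta> \<in> hom2 K (\<one> A) B"
    and "Mnd_obj K A B \<mu> \<eta> X \<psi>" and "left_module K A B \<mu> \<eta> M \<nu>"
  shows "left_module K A B \<mu> \<eta> (X \<cdot> M) ((\<langle>X\<rangle> \<star> \<nu>) \<bullet> (\<psi> \<star> \<langle>M\<rangle>))"
proof -
  let ?a = "src K M"
  have hom: "X \<in> hom1 K A A" "M \<in> hom1 K ?a A" "\<psi> \<in> hom2 K (B \<cdot> X) (X \<cdot> B)" "\<nu> \<in> hom2 K (B \<cdot> M) M"
    using assms by (auto simp: Mnd_obj_def left_module_def hom1_def)
  note [simp] = assms(1-3) hom assms(1)[THEN hom1_typing(1)] hom(1,2)[THEN hom1_typing(4)]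
    hom(1)[THEN hom1_typing(1)] assms(1)[THEN hom1_typing(4)] hom(2)[THEN hom1_typing(5)]
        assms(1)[THEN hom1_typing(5)]
  let ?\<mu> = "Cell \<mu> [B, B] [B]" and ?\<eta> = "Cell \<eta> [] [B]" and ?\<psi> = "Cell \<psi> [B, X] [X, B]"
      and ?\<nu> = "Cell \<nu> [B, M] [M]"
  let ?act = "\<lceil>X\<rceil> \<otimes> ?\<nu> \<odot> ?\<psi> \<otimes> \<lceil>M\<rceil>"
  have psi_mult: "eqn A
        (?\<psi> \<odot> ?\<mu> \<otimes> \<lceil>X\<rceil>)
        (\<lceil>X\<rceil> \<otimes> ?\<mu> \<odot> ?\<psi> \<otimes> \<lceil>B\<rceil> \<odot> \<lceil>B\<rceil> \<otimes> ?\<psi>)"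
    using assms by (simp add: eqn_def Mnd_obj_def)
  have psi_unit: "eqn A
        (?\<psi> \<odot> ?\<eta> \<otimes> \<lceil>X\<rceil>)
        (\<lceil>X\<rceil> \<otimes> ?\<eta>)"
    using assms by (simp add: eqn_def Mnd_obj_def)
  have nu_assoc: "eqn ?a
        (?\<nu> \<odot> \<lceil>B\<rceil> \<otimes> ?\<nu>)
        (?\<nu> \<odot> ?\<mu> \<otimes> \<lceil>M\<rceil>)"
    using assms by (simp add: eqn_def left_module_def)
  have nu_unit: "eqn ?a (?\<nu> \<odot> ?\<eta> \<otimes> \<lceil>M\<rceil>) \<lceil>M\<rceil>"
    using assms by (simp add: eqn_def left_module_def)
  have assoc: "eqn ?a
        (?act \<odot> \<lceil>B\<rceil> \<otimes> ?act)
        (?act \<odot> ?\<mu> \<otimes> Wires [X, M])"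
    by (rule eqn_by_rewriting[OF eqns_Cons[OF nu_assoc eqns_Cons[OF psi_mult eqns_Nil]],
        where xs = "[SwapL 1, Fwd 0 2 1]"
        and ys = "[Fwd 1 0 0]"]) (simp_all add: Let_def)
  have unit: "eqn ?a (?act \<odot> ?\<eta> \<otimes> Wires [X, M]) (Wires [X, M])"
    by (rule eqn_by_rewriting[OF eqns_Cons[OF psi_unit eqns_Cons[OF nu_unit eqns_Nil]],
        where xs = "[Fwd 0 0 0, Fwd 1 0 1]"
        and ys = "[]"]) (simp_all add: Let_def)
  have "X \<cdot> M \<in> hom1 K ?a A"
    by (rule comp1_hom[OF hom(1,2)])
  then show ?thesis
    using assoc unit wt_hom2[of ?a ?act] by (simp add: eqn_def left_module_def hom1_def)
qed

text \<open>On the left, the compatibility for \<open>M\<close>, applied to the right of the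
  \<open>X\<close> strand, turns action followed by coaction into coaction, \<open>\<beta>\<close>,
  action. The cells \<open>\<psi>\<close>, \<open>\<beta>\<close>, \<open>\<phi>\<close> then meet
  in the order of one side of the hexagon, and the hexagon leads to the right-hand side.\<close>

lemma relative_act:
  assumes "F \<in> hom1 K A A" "B \<in> hom1 K A A" "X \<in> hom1 K A A" "M \<in> hom1 K a A"
    and "\<phi> \<in> hom2 K (X \<cdot> F) (F \<cdot> X)" "\<psi> \<in> hom2 K (B \<cdot> X) (X \<cdot> B)" "\<beta> \<in> hom2 K (B \<cdot> F) (F \<cdot> B)"
    and "l \<in> hom2 K M (F \<cdot> M)" "\<nu> \<in> hom2 K (B \<cdot> M) M"
    and "(\<phi> \<star> \<langle>B\<rangle>) \<bullet> (\<langle>X\<rangle> \<star> \<beta>) \<bullet> (\<psi> \<star> \<langle>F\<rangle>) = (\<langle>F\<rangle> \<star> \<psi>) \<bullet> (\<beta> \<star> \<langle>X\<rangle>) \<bullet> (\<langle>B\<rangle> \<star> \<phi>)"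
    and "l \<bullet> \<nu> = (\<langle>F\<rangle> \<star> \<nu>) \<bullet> (\<beta> \<star> \<langle>M\<rangle>) \<bullet> (\<langle>B\<rangle> \<star> l)"
  shows "((\<phi> \<star> \<langle>M\<rangle>) \<bullet> (\<langle>X\<rangle> \<star> l)) \<bullet> ((\<langle>X\<rangle> \<star> \<nu>) \<bullet> (\<psi> \<star> \<langle>M\<rangle>)) =
    (\<langle>F\<rangle> \<star> ((\<langle>X\<rangle> \<star> \<nu>) \<bullet> (\<psi> \<star> \<langle>M\<rangle>))) \<bullet> (\<beta> \<star> \<langle>X \<cdot> M\<rangle>) \<bullet> (\<langle>B\<rangle> \<star> ((\<phi> \<star> \<langle>M\<rangle>) \<bullet> (\<langle>X\<rangle> \<star> l)))"
proof -
  note [simp]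
      = assms(1-9) assms(1-4)[THEN hom1_typing(1)] assms(1-4)[THEN hom1_typing(4)]
        assms(1-4)[THEN hom1_typing(5)]
  let ?\<phi> = "Cell \<phi> [X, F] [F, X]" and ?\<psi> = "Cell \<psi> [B, X] [X, B]" and ?\<beta> = "Cell \<beta> [B, F] [F, B]"
      and ?l = "Cell l [M] [F, M]" and ?\<nu> = "Cell \<nu> [B, M] [M]"
  let ?a = a and ?coact = "?\<phi> \<otimes> \<lceil>M\<rceil> \<odot> \<lceil>X\<rceil> \<otimes> ?l" and ?act = "\<lceil>X\<rceil> \<otimes> ?\<nu> \<odot> ?\<psi> \<otimes> \<lceil>M\<rceil>"
  have hexagon: "eqn A
        (?\<phi> \<otimes> \<lceil>B\<rceil> \<odot> \<lceil>X\<rceil> \<otimes> ?\<beta> \<odot> ?\<psi> \<otimes> \<lceil>F\<rceil>)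
        (\<lceil>F\<rceil> \<otimes> ?\<psi> \<odot> ?\<beta> \<otimes> \<lceil>X\<rceil> \<odot> \<lceil>B\<rceil> \<otimes> ?\<phi>)"
    using assms by (simp add: eqn_def)
  have relative: "eqn ?a
        (?l \<odot> ?\<nu>)
        (\<lceil>F\<rceil> \<otimes> ?\<nu> \<odot> ?\<beta> \<otimes> \<lceil>M\<rceil> \<odot> \<lceil>B\<rceil> \<otimes> ?l)"
    using assms by (simp add: eqn_def)
  have *: "eqn ?a
        (?coact \<odot> ?act)
        (\<lceil>F\<rceil> \<otimes> ?act \<odot> ?\<beta> \<otimes> Wires [X, M] \<odot> \<lceil>B\<rceil> \<otimes> ?coact)"
    by (rule eqn_by_rewriting[OF eqns_Cons[OF relative eqns_Cons[OF hexagon eqns_Nil]],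
        where xs = "[Fwd 0 1 1, SwapR 0, SwapL 3]"
        and ys = "[Bwd 1 1 0]"]) (simp_all add: Let_def)
  then show ?thesis by (simp add: eqn_def)
qed

text \<open>The two components act on disjoint strands: \<open>f\<close> slides past
  \<open>l\<close> and \<open>\<zeta>\<close> past \<open>\<phi>\<close>, each by its own axiom.
  \<open>M\<close> and \<open>N\<close> share the source \<open>a\<close> because a 2-cell joins
  them.\<close>

lemma colinear_act:
  assumes "F \<in> hom1 K A A" "X \<in> hom1 K A A" "X' \<in> hom1 K A A" "M \<in> hom1 K a A" "N \<in> hom1 K a A"
    and "\<phi> \<in> hom2 K (X \<cdot> F) (F \<cdot> X)" "\<phi>' \<in> hom2 K (X' \<cdot> F) (F \<cdot> X')" "l \<in> hom2 K M (F \<cdot> M)"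
        "l' \<in> hom2 K N (F \<cdot> N)" "\<zeta> \<in> hom2 K X X'" "f \<in> hom2 K M N"
    and "(\<langle>F\<rangle> \<star> \<zeta>) \<bullet> \<phi> = \<phi>' \<bullet> (\<zeta> \<star> \<langle>F\<rangle>)"
    and "l' \<bullet> f = (\<langle>F\<rangle> \<star> f) \<bullet> l"
  shows "(\<phi>' \<star> \<langle>N\<rangle>) \<bullet> (\<langle>X'\<rangle> \<star> l') \<bullet> (\<zeta> \<star> f) =
    (\<langle>F\<rangle> \<star> (\<zeta> \<star> f)) \<bullet> ((\<phi> \<star> \<langle>M\<rangle>) \<bullet> (\<langle>X\<rangle> \<star> l))"
proof -
  note [simp] = assms(1-11) assms(1-5)[THEN hom1_typing(1)] assms(1-5)[THEN hom1_typing(4)]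
    assms(1-5)[THEN hom1_typing(5)]
  let ?\<phi> = "Cell \<phi> [X, F] [F, X]" and ?\<phi>' = "Cell \<phi>' [X', F] [F, X']" and ?l = "Cell l [M] [F, M]"
      and ?l' = "Cell l' [N] [F, N]" and ?\<zeta> = "Cell \<zeta> [X] [X']" and ?f = "Cell f [M] [N]"
  let ?a = a and ?coact = "?\<phi> \<otimes> \<lceil>M\<rceil> \<odot> \<lceil>X\<rceil> \<otimes> ?l" and ?coact' = "?\<phi>' \<otimes> \<lceil>N\<rceil>
      \<odot> \<lceil>X'\<rceil> \<otimes> ?l'" and ?h = "?\<zeta> \<otimes> ?f"
  have zeta_comonad: "eqn A
        (\<lceil>F\<rceil> \<otimes> ?\<zeta> \<odot> ?\<phi>)
        (?\<phi>' \<odot> ?\<zeta> \<otimes> \<lceil>F\<rceil>)"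
    using assms by (simp add: eqn_def)
  have f_colinear: "eqn ?a (?l' \<odot> ?f) (\<lceil>F\<rceil> \<otimes> ?f \<odot> ?l)"
    using assms by (simp add: eqn_def)
  have *: "eqn ?a (?coact' \<odot> ?h) (\<lceil>F\<rceil> \<otimes> ?h \<odot> ?coact)"
    by (rule eqn_by_rewriting[OF eqns_Cons[OF f_colinear eqns_Cons[OF zeta_comonad eqns_Nil]],
        where xs = "[SwapR 1, Fwd 0 0 1, SwapL 1, SwapL 2]"
        and ys = "[SwapL 2, Fwd 1 1 0]"]) (simp_all add: Let_def)
  then show ?thesis by (simp add: eqn_def)
qed

lemma linear_act:
  assumes "B \<in> hom1 K A A" "X \<in> hom1 K A A" "X' \<in> hom1 K A A" "M \<in> hom1 K a A" "N \<in> hom1 K a A"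
    and "\<psi> \<in> hom2 K (B \<cdot> X) (X \<cdot> B)" "\<psi>' \<in> hom2 K (B \<cdot> X') (X' \<cdot> B)" "\<nu> \<in> hom2 K (B \<cdot> M) M"
        "\<nu>' \<in> hom2 K (B \<cdot> N) N" "\<zeta> \<in> hom2 K X X'" "f \<in> hom2 K M N"
    and "(\<zeta> \<star> \<langle>B\<rangle>) \<bullet> \<psi> = \<psi>' \<bullet> (\<langle>B\<rangle> \<star> \<zeta>)"
    and "f \<bullet> \<nu> = \<nu>' \<bullet> (\<langle>B\<rangle> \<star> f)"
  shows "(\<zeta> \<star> f) \<bullet> ((\<langle>X\<rangle> \<star> \<nu>) \<bullet> (\<psi> \<star> \<langle>M\<rangle>)) =
    (\<langle>X'\<rangle> \<star> \<nu>') \<bullet> (\<psi>' \<star> \<langle>N\<rangle>) \<bullet> (\<langle>B\<rangle> \<star> (\<zeta> \<star> f))"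
proof -
  note [simp] = assms(1-11) assms(1-5)[THEN hom1_typing(1)] assms(1-5)[THEN hom1_typing(4)]
    assms(1-5)[THEN hom1_typing(5)]
  let ?\<psi> = "Cell \<psi> [B, X] [X, B]" and ?\<psi>' = "Cell \<psi>' [B, X'] [X', B]" and ?\<nu> = "Cell \<nu> [B, M] [M]"
      and ?\<nu>' = "Cell \<nu>' [B, N] [N]" and ?\<zeta> = "Cell \<zeta> [X] [X']" and ?f = "Cell f [M] [N]"
  let ?a = a and ?act = "\<lceil>X\<rceil> \<otimes> ?\<nu> \<odot> ?\<psi> \<otimes> \<lceil>M\<rceil>" and ?act' = "\<lceil>X'\<rceil> \<otimes> ?\<nu>'
      \<odot> ?\<psi>' \<otimes> \<lceil>N\<rceil>" and ?h = "?\<zeta> \<otimes> ?f"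
  have zeta_monad: "eqn A
        (?\<zeta> \<otimes> \<lceil>B\<rceil> \<odot> ?\<psi>)
        (?\<psi>' \<odot> \<lceil>B\<rceil> \<otimes> ?\<zeta>)"
    using assms by (simp add: eqn_def)
  have f_linear: "eqn ?a (?f \<odot> ?\<nu>) (?\<nu>' \<odot> \<lceil>B\<rceil> \<otimes> ?f)"
    using assms by (simp add: eqn_def)
  have *: "eqn ?a (?h \<odot> ?act) (?act' \<odot> \<lceil>B\<rceil> \<otimes> ?h)"
    by (rule eqn_by_rewriting[OF eqns_Cons[OF f_linear eqns_Cons[OF zeta_monad eqns_Nil]],
        where xs = "[Fwd 0 1 1, SwapL 2, SwapL 1]"
        and ys = "[SwapL 0, SwapL 1, Bwd 1 0 0]"]) (simp_all add: Let_def)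
  then show ?thesis by (simp add: eqn_def)
qed

section \<open>Tensor products and composites of arrows\<close>

lemma comonad_arrow_tensor:
  assumes "F \<in> hom1 K A A" "X \<in> hom1 K A A" "X' \<in> hom1 K A A" "Y \<in> hom1 K A A" "Y' \<in> hom1 K A A"
    and "\<phi> \<in> hom2 K (X \<cdot> F) (F \<cdot> X)" "\<phi>' \<in> hom2 K (X' \<cdot> F) (F \<cdot> X')" "\<kappa> \<in> hom2 K (Y \<cdot> F) (F \<cdot> Y)"
        "\<kappa>' \<in> hom2 K (Y' \<cdot> F) (F \<cdot> Y')" "\<zeta> \<in> hom2 K X X'" "\<xi> \<in> hom2 K Y Y'"
    and "(\<langle>F\<rangle> \<star> \<zeta>) \<bullet> \<phi> = \<phi>' \<bullet> (\<zeta> \<star> \<langle>F\<rangle>)"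
    and "(\<langle>F\<rangle> \<star> \<xi>) \<bullet> \<kappa> = \<kappa>' \<bullet> (\<xi> \<star> \<langle>F\<rangle>)"
  shows "(\<langle>F\<rangle> \<star> (\<xi> \<star> \<zeta>)) \<bullet> ((\<kappa> \<star> \<langle>X\<rangle>) \<bullet> (\<langle>Y\<rangle> \<star> \<phi>)) =
    (\<kappa>' \<star> \<langle>X'\<rangle>) \<bullet> (\<langle>Y'\<rangle> \<star> \<phi>') \<bullet> (\<xi> \<star> \<zeta> \<star> \<langle>F\<rangle>)"
proof -
  note [simp] = assms(1-11) assms(1-5)[THEN hom1_typing(1)] assms(1-5)[THEN hom1_typing(4)]
    assms(1-5)[THEN hom1_typing(5)]
  let ?\<phi> = "Cell \<phi> [X, F] [F, X]" and ?\<phi>' = "Cell \<phi>' [X', F] [F, X']"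
      and ?\<kappa> = "Cell \<kappa> [Y, F] [F, Y]" and ?\<kappa>' = "Cell \<kappa>' [Y', F] [F, Y']"
        and ?\<zeta> = "Cell \<zeta> [X] [X']" and ?\<xi> = "Cell \<xi> [Y] [Y']"
  let ?l = "?\<kappa> \<otimes> \<lceil>X\<rceil> \<odot> \<lceil>Y\<rceil> \<otimes> ?\<phi>" and ?l' = "?\<kappa>' \<otimes> \<lceil>X'\<rceil> \<odot> \<lceil>Y'\<rceil> \<otimes> ?\<phi>'" and ?h = "?\<xi> \<otimes> ?\<zeta>"
  have zeta_comonad: "eqn A
        (\<lceil>F\<rceil> \<otimes> ?\<zeta> \<odot> ?\<phi>)
        (?\<phi>' \<odot> ?\<zeta> \<otimes> \<lceil>F\<rceil>)"
    using assms by (simp add: eqn_def)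
  have xi_comonad: "eqn A
        (\<lceil>F\<rceil> \<otimes> ?\<xi> \<odot> ?\<kappa>)
        (?\<kappa>' \<odot> ?\<xi> \<otimes> \<lceil>F\<rceil>)"
    using assms by (simp add: eqn_def)
  have *: "eqn A
        (\<lceil>F\<rceil> \<otimes> ?h \<odot> ?l)
        (?l' \<odot> ?h \<otimes> \<lceil>F\<rceil>)"
    by (rule eqn_by_rewriting[OF eqns_Cons[OF xi_comonad eqns_Cons[OF zeta_comonad eqns_Nil]],
        where xs = "[SwapL 2, Fwd 0 1 0, SwapR 2, SwapR 1]"
        and ys = "[SwapR 1, Bwd 1 0 1]"]) (simp_all add: Let_def)
  then show ?thesis by (simp add: eqn_def)
qed

lemma monad_arrow_tensor:
  assumes "B \<in> hom1 K A A" "X \<in> hom1 K A A" "X' \<in> hom1 K A A" "Y \<in> hom1 K A A" "Y' \<in> hom1 K A A"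
    and "\<psi> \<in> hom2 K (B \<cdot> X) (X \<cdot> B)" "\<psi>' \<in> hom2 K (B \<cdot> X') (X' \<cdot> B)" "\<theta> \<in> hom2 K (B \<cdot> Y) (Y \<cdot> B)"
        "\<theta>' \<in> hom2 K (B \<cdot> Y') (Y' \<cdot> B)" "\<zeta> \<in> hom2 K X X'" "\<xi> \<in> hom2 K Y Y'"
    and "(\<zeta> \<star> \<langle>B\<rangle>) \<bullet> \<psi> = \<psi>' \<bullet> (\<langle>B\<rangle> \<star> \<zeta>)"
    and "(\<xi> \<star> \<langle>B\<rangle>) \<bullet> \<theta> = \<theta>' \<bullet> (\<langle>B\<rangle> \<star> \<xi>)"
  shows "(\<xi> \<star> \<zeta> \<star> \<langle>B\<rangle>) \<bullet> ((\<langle>Y\<rangle> \<star> \<psi>) \<bullet> (\<theta> \<star> \<langle>X\<rangle>)) =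
    (\<langle>Y'\<rangle> \<star> \<psi>') \<bullet> (\<theta>' \<star> \<langle>X'\<rangle>) \<bullet> (\<langle>B\<rangle> \<star> (\<xi> \<star> \<zeta>))"
proof -
  note [simp] = assms(1-11) assms(1-5)[THEN hom1_typing(1)] assms(1-5)[THEN hom1_typing(4)]
    assms(1-5)[THEN hom1_typing(5)]
  let ?\<psi> = "Cell \<psi> [B, X] [X, B]" and ?\<psi>' = "Cell \<psi>' [B, X'] [X', B]"
      and ?\<theta> = "Cell \<theta> [B, Y] [Y, B]" and ?\<theta>' = "Cell \<theta>' [B, Y'] [Y', B]"
        and ?\<zeta> = "Cell \<zeta> [X] [X']" and ?\<xi> = "Cell \<xi> [Y] [Y']"
  let ?n = "\<lceil>Y\<rceil> \<otimes> ?\<psi> \<odot> ?\<theta> \<otimes> \<lceil>X\<rceil>" and ?n' = "\<lceil>Y'\<rceil> \<otimes> ?\<psi>' \<odot> ?\<theta>' \<otimes> \<lceil>X'\<rceil>" and ?h = "?\<xi> \<otimes> ?\<zeta>"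
  have zeta_monad: "eqn A
        (?\<zeta> \<otimes> \<lceil>B\<rceil> \<odot> ?\<psi>)
        (?\<psi>' \<odot> \<lceil>B\<rceil> \<otimes> ?\<zeta>)"
    using assms by (simp add: eqn_def)
  have xi_monad: "eqn A
        (?\<xi> \<otimes> \<lceil>B\<rceil> \<odot> ?\<theta>)
        (?\<theta>' \<odot> \<lceil>B\<rceil> \<otimes> ?\<xi>)"
    using assms by (simp add: eqn_def)
  have *: "eqn A
        (?h \<otimes> \<lceil>B\<rceil> \<odot> ?n)
        (?n' \<odot> \<lceil>B\<rceil> \<otimes> ?h)"
    by (rule eqn_by_rewriting[OF eqns_Cons[OF xi_monad eqns_Cons[OF zeta_monad eqns_Nil]],
        where xs = "[SwapL 2, SwapL 1, Fwd 0 0 0]"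
        and ys = "[SwapL 0, SwapL 1, Bwd 1 2 1]"]) (simp_all add: Let_def)
  then show ?thesis by (simp add: eqn_def)
qed

lemma monad_arrow_comp:
  assumes "B \<in> hom1 K A A" "X \<in> hom1 K A A" "X' \<in> hom1 K A A" "X'' \<in> hom1 K A A"
    and "\<psi> \<in> hom2 K (B \<cdot> X) (X \<cdot> B)" "\<psi>' \<in> hom2 K (B \<cdot> X') (X' \<cdot> B)"
        "\<psi>'' \<in> hom2 K (B \<cdot> X'') (X'' \<cdot> B)" "\<zeta> \<in> hom2 K X X'" "\<zeta>' \<in> hom2 K X' X''"
    and "(\<zeta> \<star> \<langle>B\<rangle>) \<bullet> \<psi> = \<psi>' \<bullet> (\<langle>B\<rangle> \<star> \<zeta>)"
    and "(\<zeta>' \<star> \<langle>B\<rangle>) \<bullet> \<psi>' = \<psi>'' \<bullet> (\<langle>B\<rangle> \<star> \<zeta>')"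
  shows "((\<zeta>' \<bullet> \<zeta>) \<star> \<langle>B\<rangle>) \<bullet> \<psi> =
    \<psi>'' \<bullet> (\<langle>B\<rangle> \<star> (\<zeta>' \<bullet> \<zeta>))"
proof -
  note [simp] = assms(1-9) assms(1-4)[THEN hom1_typing(1)] assms(1-4)[THEN hom1_typing(4)]
    assms(1-4)[THEN hom1_typing(5)]
  let ?\<psi> = "Cell \<psi> [B, X] [X, B]" and ?\<psi>' = "Cell \<psi>' [B, X'] [X', B]"
      and ?\<psi>'' = "Cell \<psi>'' [B, X''] [X'', B]" and ?\<zeta> = "Cell \<zeta> [X] [X']"
        and ?\<zeta>' = "Cell \<zeta>' [X'] [X'']"
  let ?h = "?\<zeta>' \<odot> ?\<zeta>"
  have zeta_monad: "eqn A
        (?\<zeta> \<otimes> \<lceil>B\<rceil> \<odot> ?\<psi>)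
        (?\<psi>' \<odot> \<lceil>B\<rceil> \<otimes> ?\<zeta>)"
    using assms by (simp add: eqn_def)
  have zeta'_monad: "eqn A
        (?\<zeta>' \<otimes> \<lceil>B\<rceil> \<odot> ?\<psi>')
        (?\<psi>'' \<odot> \<lceil>B\<rceil> \<otimes> ?\<zeta>')"
    using assms by (simp add: eqn_def)
  have *: "eqn A
        (?h \<otimes> \<lceil>B\<rceil> \<odot> ?\<psi>)
        (?\<psi>'' \<odot> \<lceil>B\<rceil> \<otimes> ?h)"
    by (rule eqn_by_rewriting[OF eqns_Cons[OF zeta_monad eqns_Cons[OF zeta'_monad eqns_Nil]],
        where xs = "[Fwd 0 0 0]"
        and ys = "[Bwd 1 1 0]"]) (simp_all add: Let_def)
  then show ?thesis by (simp add: eqn_def)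
qed

lemma comonad_arrow_comp:
  assumes "F \<in> hom1 K A A" "X \<in> hom1 K A A" "X' \<in> hom1 K A A" "X'' \<in> hom1 K A A"
    and "\<phi> \<in> hom2 K (X \<cdot> F) (F \<cdot> X)" "\<phi>' \<in> hom2 K (X' \<cdot> F) (F \<cdot> X')"
        "\<phi>'' \<in> hom2 K (X'' \<cdot> F) (F \<cdot> X'')" "\<zeta> \<in> hom2 K X X'" "\<zeta>' \<in> hom2 K X' X''"
    and "(\<langle>F\<rangle> \<star> \<zeta>) \<bullet> \<phi> = \<phi>' \<bullet> (\<zeta> \<star> \<langle>F\<rangle>)"
    and "(\<langle>F\<rangle> \<star> \<zeta>') \<bullet> \<phi>' = \<phi>'' \<bullet> (\<zeta>' \<star> \<langle>F\<rangle>)"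
  shows "(\<langle>F\<rangle> \<star> (\<zeta>' \<bullet> \<zeta>)) \<bullet> \<phi> =
    \<phi>'' \<bullet> ((\<zeta>' \<bullet> \<zeta>) \<star> \<langle>F\<rangle>)"
proof -
  note [simp] = assms(1-9) assms(1-4)[THEN hom1_typing(1)] assms(1-4)[THEN hom1_typing(4)]
    assms(1-4)[THEN hom1_typing(5)]
  let ?\<phi> = "Cell \<phi> [X, F] [F, X]" and ?\<phi>' = "Cell \<phi>' [X', F] [F, X']"
      and ?\<phi>'' = "Cell \<phi>'' [X'', F] [F, X'']" and ?\<zeta> = "Cell \<zeta> [X] [X']"
        and ?\<zeta>' = "Cell \<zeta>' [X'] [X'']"
  let ?h = "?\<zeta>' \<odot> ?\<zeta>"
  have zeta_comonad: "eqn A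
        (\<lceil>F\<rceil> \<otimes> ?\<zeta> \<odot> ?\<phi>)
        (?\<phi>' \<odot> ?\<zeta> \<otimes> \<lceil>F\<rceil>)"
    using assms by (simp add: eqn_def)
  have zeta'_comonad: "eqn A
        (\<lceil>F\<rceil> \<otimes> ?\<zeta>' \<odot> ?\<phi>')
        (?\<phi>'' \<odot> ?\<zeta>' \<otimes> \<lceil>F\<rceil>)"
    using assms by (simp add: eqn_def)
  have *: "eqn A
        (\<lceil>F\<rceil> \<otimes> ?h \<odot> ?\<phi>)
        (?\<phi>'' \<odot> ?h \<otimes> \<lceil>F\<rceil>)"
    by (rule eqn_by_rewriting[OF eqns_Cons[OF zeta_comonad eqns_Cons[OF zeta'_comonad eqns_Nil]],
        where xs = "[Fwd 0 0 0]"
        and ys = "[Bwd 1 1 0]"]) (simp_all add: Let_def)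
  then show ?thesis by (simp add: eqn_def)
qed

lemma colinear_comp:
  assumes "F \<in> hom1 K A A" "M \<in> hom1 K a A" "M' \<in> hom1 K a A" "M'' \<in> hom1 K a A"
    and "l \<in> hom2 K M (F \<cdot> M)" "l' \<in> hom2 K M' (F \<cdot> M')" "l'' \<in> hom2 K M'' (F \<cdot> M'')"
        "f \<in> hom2 K M M'" "g \<in> hom2 K M' M''"
    and "l' \<bullet> f = (\<langle>F\<rangle> \<star> f) \<bullet> l"
    and "l'' \<bullet> g = (\<langle>F\<rangle> \<star> g) \<bullet> l'"
  shows "l'' \<bullet> (g \<bullet> f) =
    (\<langle>F\<rangle> \<star> (g \<bullet> f)) \<bullet> l"
proof -
  note [simp] = assms(1-9) assms(1-4)[THEN hom1_typing(1)] assms(1-4)[THEN hom1_typing(4)]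
    assms(1-4)[THEN hom1_typing(5)]
  let ?l = "Cell l [M] [F, M]" and ?l' = "Cell l' [M'] [F, M']"
      and ?l'' = "Cell l'' [M''] [F, M'']" and ?f = "Cell f [M] [M']" and ?g = "Cell g [M'] [M'']"
  let ?a = a and ?h = "?g \<odot> ?f"
  have f_colinear: "eqn ?a (?l' \<odot> ?f) (\<lceil>F\<rceil> \<otimes> ?f \<odot> ?l)"
    using assms by (simp add: eqn_def)
  have g_colinear: "eqn ?a (?l'' \<odot> ?g) (\<lceil>F\<rceil> \<otimes> ?g \<odot> ?l')"
    using assms by (simp add: eqn_def)
  have *: "eqn ?a (?l'' \<odot> ?h) (\<lceil>F\<rceil> \<otimes> ?h \<odot> ?l)"
    by (rule eqn_by_rewriting[OF eqns_Cons[OF g_colinear eqns_Cons[OF f_colinear eqns_Nil]],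
        where xs = "[Fwd 0 1 0]"
        and ys = "[Bwd 1 0 0]"]) (simp_all add: Let_def)
  then show ?thesis by (simp add: eqn_def)
qed

lemma linear_comp:
  assumes "B \<in> hom1 K A A" "M \<in> hom1 K a A" "M' \<in> hom1 K a A" "M'' \<in> hom1 K a A"
    and "\<nu> \<in> hom2 K (B \<cdot> M) M" "\<nu>' \<in> hom2 K (B \<cdot> M') M'" "\<nu>'' \<in> hom2 K (B \<cdot> M'') M''"
        "f \<in> hom2 K M M'" "g \<in> hom2 K M' M''"
    and "f \<bullet> \<nu> = \<nu>' \<bullet> (\<langle>B\<rangle> \<star> f)"
    and "g \<bullet> \<nu>' = \<nu>'' \<bullet> (\<langle>B\<rangle> \<star> g)"
  shows "g \<bullet> f \<bullet> \<nu> =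
    \<nu>'' \<bullet> (\<langle>B\<rangle> \<star> (g \<bullet> f))"
proof -
  note [simp] = assms(1-9) assms(1-4)[THEN hom1_typing(1)] assms(1-4)[THEN hom1_typing(4)]
    assms(1-4)[THEN hom1_typing(5)]
  let ?\<nu> = "Cell \<nu> [B, M] [M]" and ?\<nu>' = "Cell \<nu>' [B, M'] [M']"
      and ?\<nu>'' = "Cell \<nu>'' [B, M''] [M'']" and ?f = "Cell f [M] [M']" and ?g = "Cell g [M'] [M'']"
  let ?a = a and ?h = "?g \<odot> ?f"
  have f_linear: "eqn ?a (?f \<odot> ?\<nu>) (?\<nu>' \<odot> \<lceil>B\<rceil> \<otimes> ?f)"
    using assms by (simp add: eqn_def)
  have g_linear: "eqn ?a (?g \<odot> ?\<nu>') (?\<nu>'' \<odot> \<lceil>B\<rceil> \<otimes> ?g)"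
    using assms by (simp add: eqn_def)
  have *: "eqn ?a (?h \<odot> ?\<nu>) (?\<nu>'' \<odot> \<lceil>B\<rceil> \<otimes> ?h)"
    by (rule eqn_by_rewriting[OF eqns_Cons[OF f_linear eqns_Cons[OF g_linear eqns_Nil]],
        where xs = "[Fwd 0 0 0]"
        and ys = "[Bwd 1 1 0]"]) (simp_all add: Let_def)
  then show ?thesis by (simp add: eqn_def)
qed

section \<open>Identities that need no axiom beyond those of a 2-category\<close>

text \<open>Diagrams that differ only in bracketing and in identity wires are cut into the same
  layers. This yields the strict associativity laws and the compatibility of identity arrows without
  any rewriting.\<close>

lemma sem_eqI:
  assumes "wt a l" "wt a r" "inputs l = inputs r" "outputs l = outputs r" "layers l = layers r"
  shows "sem a l = sem a r"
  using layers_sound[OF assms(1)] layers_sound[OF assms(2)] assms(3,5) by metis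

lemma sem_eq: "eqn a l r \<Longrightarrow> sem a l = sem a r"
  by (simp add: eqn_def)

lemma Mnd_arr_id:
  assumes "B \<in> hom1 K A A" "X \<in> hom1 K A A" "\<psi> \<in> hom2 K (B \<cdot> X) (X \<cdot> B)"
  shows "Mnd_arr K B X \<psi> X \<psi> \<langle>X\<rangle>"
proof -
  note [simp] = assms assms(1,2)[THEN hom1_typing(1)] assms(1,2)[THEN hom1_typing(4)]
    assms(1)[THEN hom1_typing(5)]
  have "sem A (Wires [X] \<otimes> \<lceil>B\<rceil> \<odot> Cell \<psi> [B, X] [X, B]) = sem A (Cell \<psi> [B, X] [X, B]
      \<odot> \<lceil>B\<rceil> \<otimes> Wires [X])"
    by (rule sem_eqI) simp_all
  then show ?thesis
    using id2_hom hom1_One[OF assms(2)] by (simp add: Mnd_arr_def)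
qed

lemma Comnd_arr_id:
  assumes "F \<in> hom1 K A A" "X \<in> hom1 K A A" "\<phi> \<in> hom2 K (X \<cdot> F) (F \<cdot> X)"
  shows "Comnd_arr K F X \<phi> X \<phi> \<langle>X\<rangle>"
proof -
  note [simp] = assms assms(1,2)[THEN hom1_typing(1)] assms(1,2)[THEN hom1_typing(4)]
    assms(1)[THEN hom1_typing(5)]
  have "sem A (\<lceil>F\<rceil> \<otimes> Wires [X] \<odot> Cell \<phi> [X, F] [F, X]) = sem A (Cell \<phi> [X, F] [F, X]
      \<odot> Wires [X] \<otimes> \<lceil>F\<rceil>)"
    by (rule sem_eqI) simp_all
  then show ?thesis
    using id2_hom hom1_One[OF assms(2)] by (simp add: Comnd_arr_def)
qed

lemma Mnd_arr_comp:
  assumes "B \<in> hom1 K A A" "X \<in> hom1 K A A" "X' \<in> hom1 K A A" "X'' \<in> hom1 K A A"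
    and "\<psi> \<in> hom2 K (B \<cdot> X) (X \<cdot> B)" "\<psi>' \<in> hom2 K (B \<cdot> X') (X' \<cdot> B)"
        "\<psi>'' \<in> hom2 K (B \<cdot> X'') (X'' \<cdot> B)"
    and "Mnd_arr K B X \<psi> X' \<psi>' \<zeta>" "Mnd_arr K B X' \<psi>' X'' \<psi>'' \<zeta>'"
  shows "Mnd_arr K B X \<psi> X'' \<psi>'' (\<zeta>' \<bullet> \<zeta>)"
  using monad_arrow_comp[OF assms(1-7)] assms(8,9) vcomp_hom by (auto simp: Mnd_arr_def)

lemma Comnd_arr_comp:
  assumes "F \<in> hom1 K A A" "X \<in> hom1 K A A" "X' \<in> hom1 K A A" "X'' \<in> hom1 K A A"
    and "\<phi> \<in> hom2 K (X \<cdot> F) (F \<cdot> X)" "\<phi>' \<in> hom2 K (X' \<cdot> F) (F \<cdot> X')"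
        "\<phi>'' \<in> hom2 K (X'' \<cdot> F) (F \<cdot> X'')"
    and "Comnd_arr K F X \<phi> X' \<phi>' \<zeta>" "Comnd_arr K F X' \<phi>' X'' \<phi>'' \<zeta>'"
  shows "Comnd_arr K F X \<phi> X'' \<phi>'' (\<zeta>' \<bullet> \<zeta>)"
  using comonad_arrow_comp[OF assms(1-7)] assms(8,9) vcomp_hom by (auto simp: Comnd_arr_def)

lemma Mnd_arr_tensor:
  assumes "B \<in> hom1 K A A" "X \<in> hom1 K A A" "X' \<in> hom1 K A A" "Y \<in> hom1 K A A" "Y' \<in> hom1 K A A"
    and "\<psi> \<in> hom2 K (B \<cdot> X) (X \<cdot> B)" "\<psi>' \<in> hom2 K (B \<cdot> X') (X' \<cdot> B)"
      "\<theta> \<in> hom2 K (B \<cdot> Y) (Y \<cdot> B)" "\<theta>' \<in> hom2 K (B \<cdot> Y') (Y' \<cdot> B)"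
    and \<zeta>: "Mnd_arr K B X \<psi> X' \<psi>' \<zeta>" and \<xi>: "Mnd_arr K B Y \<theta> Y' \<theta>' \<xi>"
  shows "Mnd_arr K B (Y \<cdot> X) ((\<langle>Y\<rangle> \<star> \<psi>) \<bullet> (\<theta> \<star> \<langle>X\<rangle>)) (Y' \<cdot> X') ((\<langle>Y'\<rangle> \<star> \<psi>')
      \<bullet> (\<theta>' \<star> \<langle>X'\<rangle>)) (\<xi> \<star> \<zeta>)"
  using monad_arrow_tensor[OF assms(1-9)] \<zeta> \<xi> hcomp_hom[OF assms(4,2)] by (auto simp: Mnd_arr_def)

lemma Comnd_arr_tensor:
  assumes "F \<in> hom1 K A A" "X \<in> hom1 K A A" "X' \<in> hom1 K A A" "Y \<in> hom1 K A A" "Y' \<in> hom1 K A A"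
    and "\<phi> \<in> hom2 K (X \<cdot> F) (F \<cdot> X)" "\<phi>' \<in> hom2 K (X' \<cdot> F) (F \<cdot> X')"
      "\<kappa> \<in> hom2 K (Y \<cdot> F) (F \<cdot> Y)" "\<kappa>' \<in> hom2 K (Y' \<cdot> F) (F \<cdot> Y')"
    and \<zeta>: "Comnd_arr K F X \<phi> X' \<phi>' \<zeta>" and \<xi>: "Comnd_arr K F Y \<kappa> Y' \<kappa>' \<xi>"
  shows "Comnd_arr K F (Y \<cdot> X) ((\<kappa> \<star> \<langle>X\<rangle>) \<bullet> (\<langle>Y\<rangle> \<star> \<phi>)) (Y' \<cdot> X') ((\<kappa>' \<star> \<langle>X'\<rangle>)
      \<bullet> (\<langle>Y'\<rangle> \<star> \<phi>')) (\<xi> \<star> \<zeta>)"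
  using comonad_arrow_tensor[OF assms(1-9)] \<zeta> \<xi> hcomp_hom[OF assms(4,2)]
      by (auto simp: Comnd_arr_def)

end

lemma category_prod_cat:
  assumes "category C" "category D"
  shows "category (prod_cat C D)"
  using assms unfolding category_def prod_cat_def by (auto 0 4)

section \<open>The axioms as equations of diagrams\<close>

locale comodule_monad_setting = two_category_over K A
  for K :: "('o, 'h, 'c, 'm) two_cat_scheme" (structure) and A +
  fixes F B :: 'h and \<mu> \<eta> \<Delta> \<epsilon> \<tau> \<mu>B \<eta>B lB \<tau>BF :: 'c
  assumes tau_bimonad: "tau_bimonad K A F \<mu> \<eta> \<Delta> \<epsilon> \<tau>"
    and comodule_monad: "comodule_monad K A F \<mu> \<eta> \<Delta> \<epsilon> B \<mu>B \<eta>B lB \<tau>BF"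
    and bimonad_in_Mnd: "bimonad_in_Mnd K A F \<mu> \<eta> \<Delta> \<epsilon> B \<tau>BF"
    and coaction_slides: "coaction_slides_F K F \<tau> B lB \<tau>BF"
begin

text \<open>A primed symbol denotes the diagram of the 2-cell of that name.\<close>

abbreviation "\<mu>' \<equiv> Cell \<mu> [F, F] [F]"
abbreviation "\<eta>' \<equiv> Cell \<eta> [] [F]"
abbreviation "\<Delta>' \<equiv> Cell \<Delta> [F] [F, F]"
abbreviation "\<epsilon>' \<equiv> Cell \<epsilon> [F] []"
abbreviation "\<tau>' \<equiv> Cell \<tau> [F, F] [F, F]"
abbreviation "\<mu>B' \<equiv> Cell \<mu>B [B, B] [B]"
abbreviation "\<eta>B' \<equiv> Cell \<eta>B [] [B]"
abbreviation "lB' \<equiv> Cell lB [B] [F, B]"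
abbreviation "\<tau>BF' \<equiv> Cell \<tau>BF [B, F] [F, B]"
abbreviation "\<tau>BFF' \<equiv> \<lceil>F\<rceil> \<otimes> \<tau>BF' \<odot> \<tau>BF' \<otimes> \<lceil>F\<rceil>"
abbreviation "\<psi>BF' \<equiv> \<mu>' \<otimes> \<lceil>B\<rceil> \<odot> \<lceil>F\<rceil> \<otimes> \<tau>BF' \<odot> lB' \<otimes> \<lceil>F\<rceil>"
abbreviation "twist' \<equiv> \<mu>' \<otimes> \<lceil>F\<rceil> \<odot> \<lceil>F\<rceil> \<otimes> \<tau>' \<odot> \<Delta>' \<otimes> \<lceil>F\<rceil>"

abbreviation yd :: "('h, 'c) yd_cl \<Rightarrow> bool" where
  "yd \<equiv> yd_cl_obj K A F \<mu> \<eta> \<Delta> \<epsilon> \<tau> B \<mu>B \<eta>B lB \<tau>BF"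

abbreviation "tFX' U \<equiv> Cell (tFX U) [F, ycell U] [ycell U, F]"
abbreviation "tXF' U \<equiv> Cell (tXF U) [ycell U, F] [F, ycell U]"
abbreviation "yact' U \<equiv> Cell (yact U) [F, ycell U] [ycell U]"
abbreviation "ycoact' U \<equiv> Cell (ycoact U) [ycell U] [F, ycell U]"
abbreviation "tBX' U \<equiv> Cell (tBX U) [B, ycell U] [ycell U, B]"

lemma objA [simp]: "A \<in> Ob K"
  using tau_bimonad by (simp add: tau_bimonad_def left_bimonad_def monad_on_def)

lemma F_typing [simp]:
  "F \<in> hom1 K A A" "src K F = A" "F \<cdot> \<one> A = F"
  "\<mu> \<in> hom2 K (F \<cdot> F) F" "\<eta> \<in> hom2 K (\<one> A) F" "\<Delta> \<in> hom2 K F (F \<cdot> F)" "\<epsilon> \<in> hom2 K F (\<one> A)"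
  "\<tau> \<in> hom2 K (F \<cdot> F) (F \<cdot> F)"
  using tau_bimonad
  by (auto simp: tau_bimonad_def left_bimonad_def monad_on_def comonad_on_def left_monadic_def
      Mnd_obj_def intro: hom1_src comp1_id_right)

lemma B_typing [simp]:
  "B \<in> hom1 K A A" "src K B = A" "B \<cdot> \<one> A = B"
  "\<mu>B \<in> hom2 K (B \<cdot> B) B" "\<eta>B \<in> hom2 K (\<one> A) B" "lB \<in> hom2 K B (F \<cdot> B)"
  "\<tau>BF \<in> hom2 K (B \<cdot> F) (F \<cdot> B)"
  using comodule_monad
  by (auto simp: comodule_monad_def monad_on_def Mnd_obj_def left_comodule_def
      intro: hom1_src comp1_id_right)

lemma X_typing [simp]:
  assumes "yd U"
  shows "ycell U \<in> hom1 K A A" "src K (ycell U) = A" "ycell U \<cdot> \<one> A = ycell U"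
  "tFX U \<in> hom2 K (F \<cdot> ycell U) (ycell U \<cdot> F)" "tXF U \<in> hom2 K (ycell U \<cdot> F) (F \<cdot> ycell U)"
  "yact U \<in> hom2 K (F \<cdot> ycell U) (ycell U)" "ycoact U \<in> hom2 K (ycell U) (F \<cdot> ycell U)"
  "tBX U \<in> hom2 K (B \<cdot> ycell U) (ycell U \<cdot> B)"
  using assms
  by (auto simp: yd_cl_obj_def Let_def classical_yd_def left_monadic_def left_comonadic_def
      Mnd_obj_def Comnd_obj_def left_module_def left_comodule_def intro: hom1_src comp1_id_right)

lemma mult_assoc: "eqn A
      (\<mu>' \<odot> \<mu>' \<otimes> \<lceil>F\<rceil>)
      (\<mu>' \<odot> \<lceil>F\<rceil> \<otimes> \<mu>')"
  and mult_unit_left: "eqn A (\<mu>' \<odot> \<eta>' \<otimes> \<lceil>F\<rceil>) \<lceil>F\<rceil>"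
  and mult_unit_right: "eqn A (\<mu>' \<odot> \<lceil>F\<rceil> \<otimes> \<eta>') \<lceil>F\<rceil>"
  and comult_coassoc: "eqn A
      (\<Delta>' \<otimes> \<lceil>F\<rceil> \<odot> \<Delta>')
      (\<lceil>F\<rceil> \<otimes> \<Delta>' \<odot> \<Delta>')"
  and comult_counit_left: "eqn A (\<epsilon>' \<otimes> \<lceil>F\<rceil> \<odot> \<Delta>') \<lceil>F\<rceil>"
  and comult_counit_right: "eqn A (\<lceil>F\<rceil> \<otimes> \<epsilon>' \<odot> \<Delta>') \<lceil>F\<rceil>"
  and comult_mult_lambda: "eqn A
      (\<Delta>' \<odot> \<mu>')
      (\<lceil>F\<rceil> \<otimes> \<mu>' \<odot> twist' \<otimes> \<lceil>F\<rceil> \<odot> \<lceil>F\<rceil> \<otimes> \<Delta>')"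
  and counit_mult: "eqn A (\<epsilon>' \<odot> \<mu>') (\<epsilon>' \<otimes> \<epsilon>')"
  and comult_unit: "eqn A (\<Delta>' \<odot> \<eta>') (\<eta>' \<otimes> \<eta>')"
  and counit_unit: "eqn A (\<epsilon>' \<odot> \<eta>') (Wires [])"
  using tau_bimonad
      by (simp_all add: eqn_def tau_bimonad_def left_bimonad_def monad_on_def comonad_on_def)

lemma tau_mult_left: "eqn A
      (\<tau>' \<odot> \<mu>' \<otimes> \<lceil>F\<rceil>)
      (\<lceil>F\<rceil> \<otimes> \<mu>' \<odot> \<tau>' \<otimes> \<lceil>F\<rceil> \<odot> \<lceil>F\<rceil> \<otimes> \<tau>')"
  and tau_unit_left: "eqn A
      (\<tau>' \<odot> \<eta>' \<otimes> \<lceil>F\<rceil>)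
      (\<lceil>F\<rceil> \<otimes> \<eta>')"
  and tau_mult_right: "eqn A
      (\<tau>' \<odot> \<lceil>F\<rceil> \<otimes> \<mu>')
      (\<mu>' \<otimes> \<lceil>F\<rceil> \<odot> \<lceil>F\<rceil> \<otimes> \<tau>' \<odot> \<tau>' \<otimes> \<lceil>F\<rceil>)"
  and tau_unit_right: "eqn A
      (\<tau>' \<odot> \<lceil>F\<rceil> \<otimes> \<eta>')
      (\<eta>' \<otimes> \<lceil>F\<rceil>)"
  and tau_comult_left: "eqn A
      (\<Delta>' \<otimes> \<lceil>F\<rceil> \<odot> \<tau>')
      (\<lceil>F\<rceil> \<otimes> \<tau>' \<odot> \<tau>' \<otimes> \<lceil>F\<rceil> \<odot> \<lceil>F\<rceil> \<otimes> \<Delta>')"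
  and tau_counit_left: "eqn A
      (\<epsilon>' \<otimes> \<lceil>F\<rceil> \<odot> \<tau>')
      (\<lceil>F\<rceil> \<otimes> \<epsilon>')"
  and tau_comult_right: "eqn A
      (\<lceil>F\<rceil> \<otimes> \<Delta>' \<odot> \<tau>')
      (\<tau>' \<otimes> \<lceil>F\<rceil> \<odot> \<lceil>F\<rceil> \<otimes> \<tau>' \<odot> \<Delta>' \<otimes> \<lceil>F\<rceil>)"
  and tau_counit_right: "eqn A
      (\<lceil>F\<rceil> \<otimes> \<epsilon>' \<odot> \<tau>')
      (\<epsilon>' \<otimes> \<lceil>F\<rceil>)"
  using tau_bimonad
  by (simp_all add: eqn_def tau_bimonad_def left_monadic_def right_monadic_def left_comonadic_def
      right_comonadic_def Mnd_obj_def Comnd_obj_def)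

lemma lB_coassoc: "eqn A
      (\<lceil>F\<rceil> \<otimes> lB' \<odot> lB')
      (\<Delta>' \<otimes> \<lceil>B\<rceil> \<odot> lB')"
  and lB_counit: "eqn A (\<epsilon>' \<otimes> \<lceil>B\<rceil> \<odot> lB') \<lceil>B\<rceil>"
  and lB_multB: "eqn A
      (lB' \<odot> \<mu>B')
      (\<lceil>F\<rceil> \<otimes> \<mu>B' \<odot> \<psi>BF' \<otimes> \<lceil>B\<rceil> \<odot> \<lceil>B\<rceil> \<otimes> lB')"
  and lB_unitB: "eqn A (lB' \<odot> \<eta>B') (\<eta>' \<otimes> \<eta>B')"
  using comodule_monad
  by (simp_all add: eqn_def comodule_monad_def monad_on_def Mnd_obj_def left_comodule_def
      psi_BF_def)

lemma tBF_mult: "eqn A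
      (\<mu>' \<otimes> \<lceil>B\<rceil> \<odot> \<tau>BFF')
      (\<tau>BF' \<odot> \<lceil>B\<rceil> \<otimes> \<mu>')"
  and tBF_unit: "eqn A
      (\<eta>' \<otimes> \<lceil>B\<rceil> \<odot> \<lceil>B\<rceil>)
      (\<tau>BF' \<odot> \<lceil>B\<rceil> \<otimes> \<eta>')"
  and tBF_comult: "eqn A
      (\<Delta>' \<otimes> \<lceil>B\<rceil> \<odot> \<tau>BF')
      (\<tau>BFF' \<odot> \<lceil>B\<rceil> \<otimes> \<Delta>')"
  and tBF_counit: "eqn A
      (\<epsilon>' \<otimes> \<lceil>B\<rceil> \<odot> \<tau>BF')
      (\<lceil>B\<rceil> \<odot> \<lceil>B\<rceil> \<otimes> \<epsilon>')"
  and tBF_lB: "eqn A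
      (\<lceil>F\<rceil> \<otimes> lB' \<odot> \<tau>BF')
      (\<tau>' \<otimes> \<lceil>B\<rceil> \<odot> \<lceil>F\<rceil> \<otimes> \<tau>BF' \<odot> lB' \<otimes> \<lceil>F\<rceil>)"
  using bimonad_in_Mnd coaction_slides
  by (simp_all add: eqn_def bimonad_in_Mnd_def Mnd_arr_def coaction_slides_F_def Let_def)

text \<open>The bialgebra axiom in its familiar form. The bimonad axiom is stated with \<lambda>;
  once \<lambda> is expanded through \<tau>, a single interchange separates the two
  multiplications.\<close>

lemma comult_mult: "eqn A
      (\<Delta>' \<odot> \<mu>')
      (\<mu>' \<otimes> \<mu>' \<odot> \<lceil>F\<rceil> \<otimes> \<tau>' \<otimes> \<lceil>F\<rceil> \<odot> \<Delta>' \<otimes> \<Delta>')"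
  by (rule eqn_by_rewriting[OF eqns_Cons[OF comult_mult_lambda eqns_Nil],
      where xs = "[Fwd 0 0 0, SwapR 3]"
      and ys = "[]"]) (simp_all add: Let_def)

lemma
  assumes U: "yd U"
  shows tFX_mult: "eqn A
      (tFX' U \<odot> \<mu>' \<otimes> \<lceil>ycell U\<rceil>)
      (\<lceil>ycell U\<rceil> \<otimes> \<mu>' \<odot> tFX' U \<otimes> \<lceil>F\<rceil> \<odot> \<lceil>F\<rceil> \<otimes> tFX' U)"
    and tFX_unit: "eqn A
      (tFX' U \<odot> \<eta>' \<otimes> \<lceil>ycell U\<rceil>)
      (\<lceil>ycell U\<rceil> \<otimes> \<eta>')"
    and tFX_comult: "eqn A
      (\<lceil>ycell U\<rceil> \<otimes> \<Delta>' \<odot> tFX' U)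
      (tFX' U \<otimes> \<lceil>F\<rceil> \<odot> \<lceil>F\<rceil> \<otimes> tFX' U \<odot> \<Delta>' \<otimes> \<lceil>ycell U\<rceil>)"
    and tFX_counit: "eqn A
      (\<lceil>ycell U\<rceil> \<otimes> \<epsilon>' \<odot> tFX' U)
      (\<epsilon>' \<otimes> \<lceil>ycell U\<rceil>)"
    and tXF_comult: "eqn A
      (\<Delta>' \<otimes> \<lceil>ycell U\<rceil> \<odot> tXF' U)
      (\<lceil>F\<rceil> \<otimes> tXF' U \<odot> tXF' U \<otimes> \<lceil>F\<rceil> \<odot> \<lceil>ycell U\<rceil> \<otimes> \<Delta>')"
    and tXF_counit: "eqn A
      (\<epsilon>' \<otimes> \<lceil>ycell U\<rceil> \<odot> tXF' U)
      (\<lceil>ycell U\<rceil> \<otimes> \<epsilon>')"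
    and tXF_mult: "eqn A
      (tXF' U \<odot> \<lceil>ycell U\<rceil> \<otimes> \<mu>')
      (\<mu>' \<otimes> \<lceil>ycell U\<rceil> \<odot> \<lceil>F\<rceil> \<otimes> tXF' U \<odot> tXF' U \<otimes> \<lceil>F\<rceil>)"
    and tXF_unit: "eqn A
      (tXF' U \<odot> \<lceil>ycell U\<rceil> \<otimes> \<eta>')
      (\<eta>' \<otimes> \<lceil>ycell U\<rceil>)"
    and act_assoc: "eqn A
      (yact' U \<odot> \<lceil>F\<rceil> \<otimes> yact' U)
      (yact' U \<odot> \<mu>' \<otimes> \<lceil>ycell U\<rceil>)"
    and act_unit: "eqn A (yact' U \<odot> \<eta>' \<otimes> \<lceil>ycell U\<rceil>) \<lceil>ycell U\<rceil>"
    and coact_coassoc: "eqn A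
      (\<lceil>F\<rceil> \<otimes> ycoact' U \<odot> ycoact' U)
      (\<Delta>' \<otimes> \<lceil>ycell U\<rceil> \<odot> ycoact' U)"
    and coact_counit: "eqn A
      (\<epsilon>' \<otimes> \<lceil>ycell U\<rceil> \<odot> ycoact' U)
      \<lceil>ycell U\<rceil>"
    and tFX_act: "eqn A
      (tFX' U \<odot> \<lceil>F\<rceil> \<otimes> yact' U)
      (yact' U \<otimes> \<lceil>F\<rceil> \<odot> \<lceil>F\<rceil> \<otimes> tFX' U \<odot> \<tau>' \<otimes> \<lceil>ycell U\<rceil>)"
    and tFX_coact: "eqn A
      (ycoact' U \<otimes> \<lceil>F\<rceil> \<odot> tFX' U)
      (\<lceil>F\<rceil> \<otimes> tFX' U \<odot> \<tau>' \<otimes> \<lceil>ycell U\<rceil> \<odot> \<lceil>F\<rceil> \<otimes> ycoact' U)"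
    and tXF_act: "eqn A
      (tXF' U \<odot> yact' U \<otimes> \<lceil>F\<rceil>)
      (\<lceil>F\<rceil> \<otimes> yact' U \<odot> \<tau>' \<otimes> \<lceil>ycell U\<rceil> \<odot> \<lceil>F\<rceil> \<otimes> tXF' U)"
    and tXF_coact: "eqn A
      (\<lceil>F\<rceil> \<otimes> ycoact' U \<odot> tXF' U)
      (\<tau>' \<otimes> \<lceil>ycell U\<rceil> \<odot> \<lceil>F\<rceil> \<otimes> tXF' U \<odot> ycoact' U \<otimes> \<lceil>F\<rceil>)"
    and hexagon_FXF: "eqn A
      (\<lceil>F\<rceil> \<otimes> tFX' U \<odot> \<tau>' \<otimes> \<lceil>ycell U\<rceil> \<odot> \<lceil>F\<rceil> \<otimes> tXF' U)
      (tXF' U \<otimes> \<lceil>F\<rceil> \<odot> \<lceil>ycell U\<rceil> \<otimes> \<tau>' \<odot> tFX' U \<otimes> \<lceil>F\<rceil>)"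
    and yetter_drinfeld: "eqn A
      (\<mu>' \<otimes> \<lceil>ycell U\<rceil> \<odot> \<lceil>F\<rceil> \<otimes> tXF' U \<odot> ycoact' U \<otimes> \<lceil>F\<rceil> \<odot> yact' U \<otimes> \<lceil>F\<rceil> \<odot> \<lceil>F\<rceil> \<otimes> tFX' U
        \<odot> \<Delta>' \<otimes> \<lceil>ycell U\<rceil>)
      (\<mu>' \<otimes> yact' U \<odot> \<lceil>F\<rceil> \<otimes> \<tau>' \<otimes> \<lceil>ycell U\<rceil> \<odot> \<Delta>' \<otimes> ycoact' U)"
    and tBX_multB: "eqn A
      (tBX' U \<odot> \<mu>B' \<otimes> \<lceil>ycell U\<rceil>)
      (\<lceil>ycell U\<rceil> \<otimes> \<mu>B' \<odot> tBX' U \<otimes> \<lceil>B\<rceil> \<odot> \<lceil>B\<rceil> \<otimes> tBX' U)"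
    and tBX_unitB: "eqn A
      (tBX' U \<odot> \<eta>B' \<otimes> \<lceil>ycell U\<rceil>)
      (\<lceil>ycell U\<rceil> \<otimes> \<eta>B')"
    and hexagon_BFX: "eqn A
      (\<lceil>ycell U\<rceil> \<otimes> \<tau>BF' \<odot> tBX' U \<otimes> \<lceil>F\<rceil> \<odot> \<lceil>B\<rceil> \<otimes> tFX' U)
      (tFX' U \<otimes> \<lceil>B\<rceil> \<odot> \<lceil>F\<rceil> \<otimes> tBX' U \<odot> \<tau>BF' \<otimes> \<lceil>ycell U\<rceil>)"
    and hexagon_BXF: "eqn A
      (\<lceil>F\<rceil> \<otimes> tBX' U \<odot> \<tau>BF' \<otimes> \<lceil>ycell U\<rceil> \<odot> \<lceil>B\<rceil> \<otimes> tXF' U)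
      (tXF' U \<otimes> \<lceil>B\<rceil> \<odot> \<lceil>ycell U\<rceil> \<otimes> \<tau>BF' \<odot> tBX' U \<otimes> \<lceil>F\<rceil>)"
    and tBX_act: "eqn A
      (tBX' U \<odot> \<lceil>B\<rceil> \<otimes> yact' U)
      (yact' U \<otimes> \<lceil>B\<rceil> \<odot> \<lceil>F\<rceil> \<otimes> tBX' U \<odot> \<tau>BF' \<otimes> \<lceil>ycell U\<rceil>)"
    and tBX_coact: "eqn A
      (ycoact' U \<otimes> \<lceil>B\<rceil> \<odot> tBX' U)
      (\<lceil>F\<rceil> \<otimes> tBX' U \<odot> \<tau>BF' \<otimes> \<lceil>ycell U\<rceil> \<odot> \<lceil>B\<rceil> \<otimes> ycoact' U)"
    and tBX_lB: "eqn A
      (\<lceil>ycell U\<rceil> \<otimes> lB' \<odot> tBX' U)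
      (tFX' U \<otimes> \<lceil>B\<rceil> \<odot> \<lceil>F\<rceil> \<otimes> tBX' U \<odot> lB' \<otimes> \<lceil>ycell U\<rceil>)"
  using U[unfolded yd_cl_obj_def Let_def classical_yd_def left_monadic_def right_monadic_def
      left_comonadic_def right_comonadic_def Mnd_obj_def Comnd_obj_def left_module_def
      left_comodule_def]
  by (simp_all add: eqn_def X_typing[OF U] del: X_typing)

section \<open>Identities for one and two Yetter-Drinfel'd modules\<close>

abbreviation "\<psi>F' U \<equiv> yact' U \<otimes> \<lceil>F\<rceil> \<odot> \<lceil>F\<rceil> \<otimes> tFX' U \<odot> \<Delta>' \<otimes> \<lceil>ycell U\<rceil>"
abbreviation "\<phi>F' U \<equiv> \<mu>' \<otimes> \<lceil>ycell U\<rceil> \<odot> \<lceil>F\<rceil> \<otimes> tXF' U \<odot> ycoact' U \<otimes> \<lceil>F\<rceil>"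
abbreviation "\<psi>B' U \<equiv> yact' U \<otimes> \<lceil>B\<rceil> \<odot> \<lceil>F\<rceil> \<otimes> tBX' U \<odot> lB' \<otimes> \<lceil>ycell U\<rceil>"
abbreviation "tFX_tensor V U \<equiv> \<lceil>ycell V\<rceil> \<otimes> tFX' U \<odot> tFX' V \<otimes> \<lceil>ycell U\<rceil>"
abbreviation "tXF_tensor V U \<equiv> tXF' V \<otimes> \<lceil>ycell U\<rceil> \<odot> \<lceil>ycell V\<rceil> \<otimes> tXF' U"
abbreviation "yact_tensor V U \<equiv> yact' V \<otimes> yact' U \<odot> \<lceil>F\<rceil> \<otimes> tFX' V \<otimes> \<lceil>ycell U\<rceil>
    \<odot> \<Delta>' \<otimes> Wires [ycell V, ycell U]"
abbreviation "ycoact_tensor V U \<equiv> \<mu>' \<otimes> Wires [ycell V, ycell U] \<odot> \<lceil>F\<rceil> \<otimes> tXF' V \<otimes> \<lceil>ycell U\<rceil>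
    \<odot> ycoact' V \<otimes> ycoact' U"
abbreviation "tBX_tensor V U \<equiv> \<lceil>ycell V\<rceil> \<otimes> tBX' U \<odot> tBX' V \<otimes> \<lceil>ycell U\<rceil>"

lemma
  assumes U: "yd U" and yb: "yang_baxter K F \<tau> U"
  shows hexagon_FFX: "eqn A
      (\<lceil>ycell U\<rceil> \<otimes> \<tau>' \<odot> tFX' U \<otimes> \<lceil>F\<rceil> \<odot> \<lceil>F\<rceil> \<otimes> tFX' U)
      (tFX' U \<otimes> \<lceil>F\<rceil> \<odot> \<lceil>F\<rceil> \<otimes> tFX' U \<odot> \<tau>' \<otimes> \<lceil>ycell U\<rceil>)"
    and hexagon_XFF: "eqn A
      (\<lceil>F\<rceil> \<otimes> tXF' U \<odot> tXF' U \<otimes> \<lceil>F\<rceil> \<odot> \<lceil>ycell U\<rceil> \<otimes> \<tau>')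
      (\<tau>' \<otimes> \<lceil>ycell U\<rceil> \<odot> \<lceil>F\<rceil> \<otimes> tXF' U \<odot> tXF' U \<otimes> \<lceil>F\<rceil>)"
  using U yb by (simp_all add: eqn_def yang_baxter_def Let_def)

section \<open>The cells assigned to a single Yetter-Drinfel'd module\<close>

lemma phi_counit:
  assumes U: "yd U"
  shows "eqn A
      (\<epsilon>' \<otimes> \<lceil>ycell U\<rceil> \<odot> \<phi>F' U)
      (\<lceil>ycell U\<rceil> \<otimes> \<epsilon>')"
  by (rule eqn_by_rewriting[OF eqns_Cons[OF counit_mult eqns_Cons[OF coact_counit[OF U]
      eqns_Cons[OF tXF_counit[OF U] eqns_Nil]]],
      where xs = "[Fwd 0 2 0, SwapL 2, SwapL 1, Fwd 1 0 0]"
      and ys = "[Bwd 2 0 0]"]) (simp_all add: Let_def U)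

text \<open>On the left, \<Delta> passes \<open>\<mu>\<close> by the bialgebra axiom, which creates
  a \<tau>, and then passes \<open>tXF\<close>. On the right, the same \<tau> appears when the
  coaction in the second copy of \<phi> slides past \<open>tXF\<close>; coassociativity of the
  coaction does the rest.\<close>

lemma phi_comult:
  assumes U: "yd U"
  shows "eqn A
      (\<Delta>' \<otimes> \<lceil>ycell U\<rceil> \<odot> \<phi>F' U)
      (\<lceil>F\<rceil> \<otimes> \<phi>F' U \<odot> \<phi>F' U \<otimes> \<lceil>F\<rceil> \<odot> \<lceil>ycell U\<rceil> \<otimes> \<Delta>')"
  by (rule eqn_by_rewriting[OF eqns_Cons[OF comult_mult eqns_Cons[OF tXF_comult[OF U]
      eqns_Cons[OF tXF_coact[OF U] eqns_Cons[OF coact_coassoc[OF U] eqns_Nil]]]],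
      where xs = "[Fwd 0 2 0, Fwd 1 1 1, SwapL 3, SwapL 2, SwapL 1, SwapL 4, SwapL 6, SwapL 5]"
      and ys = "[SwapR 3, Fwd 2 2 1, SwapL 0, SwapL 1, Fwd 3 0 0]"]) (simp_all add: Let_def U)

text \<open>Multiplicativity of the coaction of \<open>B\<close> brings in \<open>\<psi>BF'\<close>,
  hence a \<open>\<tau>BF\<close> and a \<open>\<mu>\<close>. The \<open>\<mu>\<close> is absorbed
  by associativity of the \<open>F\<close>-action, and the \<open>\<tau>BF\<close> is the one that
  arises on the other side when \<open>tBX\<close> passes the action.\<close>

lemma psiB_multB:
  assumes U: "yd U"
  shows "eqn A
      (\<psi>B' U \<odot> \<mu>B' \<otimes> \<lceil>ycell U\<rceil>)
      (\<lceil>ycell U\<rceil> \<otimes> \<mu>B' \<odot> \<psi>B' U \<otimes> \<lceil>B\<rceil> \<odot> \<lceil>B\<rceil> \<otimes> \<psi>B' U)"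
  by (rule eqn_by_rewriting[OF eqns_Cons[OF lB_multB eqns_Cons[OF act_assoc[OF U]
      eqns_Cons[OF tBX_act[OF U] eqns_Cons[OF tBX_multB[OF U] eqns_Nil]]]],
      where xs = "[Fwd 0 0 0, SwapR 3, SwapR 4, Bwd 1 5 0]"
      and ys = "[SwapL 2, Fwd 2 3 1, SwapL 1, SwapL 2, SwapR 6, SwapR 5, Bwd 3 3 2]"])
        (simp_all add: Let_def U)

lemma psiB_unitB:
  assumes U: "yd U"
  shows "eqn A
      (\<psi>B' U \<odot> \<eta>B' \<otimes> \<lceil>ycell U\<rceil>)
      (\<lceil>ycell U\<rceil> \<otimes> \<eta>B')"
  by (rule eqn_by_rewriting[OF eqns_Cons[OF lB_unitB eqns_Cons[OF act_unit[OF U]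
      eqns_Cons[OF tBX_unitB[OF U] eqns_Nil]]],
      where xs = "[Fwd 0 0 0, SwapR 1, Fwd 1 2 0]"
      and ys = "[Bwd 2 0 0]"]) (simp_all add: Let_def U)

text \<open>Since \<open>tFX\<close> is right comonadic, the counit can be pulled back through it
  onto one leg of \<Delta>, where it cancels.\<close>

lemma psiF_counit:
  assumes U: "yd U"
  shows "eqn A (\<lceil>ycell U\<rceil> \<otimes> \<epsilon>' \<odot> \<psi>F' U) (yact' U)"
  by (rule eqn_by_rewriting[OF eqns_Cons[OF tFX_counit[OF U] eqns_Cons[OF comult_counit_right
      eqns_Nil]],
      where xs = "[SwapR 2, Fwd 0 1 1, Fwd 1 0 0]"
      and ys = "[]"]) (simp_all add: Let_def U)

text \<open>The left-hand side contains the coaction of \<open>B\<close> twice, in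
  \<open>\<psi>B'\<close> and in \<open>\<psi>BF'\<close>. Sliding the second one below
  \<open>tBX\<close> makes them adjacent, and coassociativity merges them into one coaction followed
  by \<Delta>. That \<Delta>, together with the \<open>\<mu>\<close> of \<open>\<phi>F'\<close>,
  frames exactly the left-hand side of the Yetter-Drinfel'd condition.\<close>

lemma phi_psiB_hexagon:
  assumes U: "yd U"
  shows "eqn A
      (\<phi>F' U \<otimes> \<lceil>B\<rceil> \<odot> \<lceil>ycell U\<rceil> \<otimes> \<psi>BF' \<odot> \<psi>B' U \<otimes> \<lceil>F\<rceil>)
      (\<lceil>F\<rceil> \<otimes> \<psi>B' U \<odot> \<psi>BF' \<otimes> \<lceil>ycell U\<rceil> \<odot> \<lceil>B\<rceil> \<otimes> \<phi>F' U)"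
  \<comment> \<open>In \<open>xs\<close>, \<open>tXF_mult\<close> and \<open>mult_assoc\<close> move
    the \<open>\<mu>\<close> of \<open>\<psi>BF'\<close> out of the way before
    \<open>yetter_drinfeld\<close> is applied; afterwards \<Delta> is split again into two coactions
    of \<open>B\<close> and \<open>tBX_coact\<close> moves the coaction of \<open>X\<close> down to
    the input. In \<open>ys\<close>, \<open>\<tau>BF\<close> is spread over the two factors of
    \<open>\<mu>\<close>, which is why \<open>tBF_lB\<close> occurs twice;
    \<open>hexagon_BXF\<close> and \<open>tXF_act\<close> then put the \<open>X\<close> strand into
    the same position.\<close>
  by (rule eqn_by_rewriting[OF eqns_Cons[OF tBX_lB[OF U] eqns_Cons[OF lB_coassoc
      eqns_Cons[OF tXF_mult[OF U] eqns_Cons[OF mult_assoc eqns_Cons[OF yetter_drinfeld[OF U]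
      eqns_Cons[OF tBX_coact[OF U] eqns_Cons[OF tBF_mult eqns_Cons[OF tBF_lB
      eqns_Cons[OF hexagon_BXF[OF U] eqns_Cons[OF tXF_act[OF U] eqns_Nil]]]]]]]]]],
      where xs = "[SwapR 2, Fwd 0 1 1, Fwd 1 0 0, SwapL 6, Fwd 2 7 1, Bwd 3 9 0, SwapR 1,
        SwapL 5, SwapL 6, SwapL 8, SwapL 7, Fwd 4 2 0, SwapL 2, SwapL 1, Bwd 1 0 0, Fwd 5 2 2,
        SwapR 7, SwapR 8, Fwd 3 9 0, SwapR 1, SwapR 0, SwapR 6, SwapR 5]"
      and ys = "[SwapL 2, Bwd 6 3 1, SwapR 6, SwapR 5, Fwd 7 4 2, SwapL 1, SwapL 2, SwapL 3,
        Fwd 7 2 1, SwapR 4, SwapR 5, SwapR 9, SwapR 8, SwapR 7, SwapR 6, Fwd 8 4 3, SwapL 6,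
        SwapR 10, SwapR 9, Bwd 9 7 2]"]) (simp_all add: Let_def U)

section \<open>Compatibility of the assigned cells with the tensor product\<close>

text \<open>The diagonal action uses \<Delta> once more, so one side has an iterated
  comultiplication; the other has a \<Delta> that has passed the left factor. Coassociativity and
  comonadicity of \<open>tFX V\<close> identify them. The identities for \<phi> and for
  \<open>psi_B\<close> have the same pattern, with \<open>\<mu>\<close> respectively
  \<open>lB\<close> in place of \<Delta>.\<close>

lemma psiF_tensor:
  assumes U: "yd U" and V: "yd V"
  shows "eqn A
      (yact_tensor V U \<otimes> \<lceil>F\<rceil> \<odot> \<lceil>F\<rceil> \<otimes> tFX_tensor V U \<odot> \<Delta>' \<otimes> Wires [ycell V, ycell U])
      (\<lceil>ycell V\<rceil> \<otimes> \<psi>F' U \<odot> \<psi>F' V \<otimes> \<lceil>ycell U\<rceil>)"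
  by (rule eqn_by_rewriting[OF eqns_Cons[OF comult_coassoc eqns_Cons[OF tFX_comult[OF V]
      eqns_Nil]],
      where xs = "[SwapL 2, SwapL 1, Fwd 0 0 0, SwapL 3, SwapL 5, SwapL 4]"
      and ys = "[SwapR 2, Fwd 1 1 1]"]) (simp_all add: Let_def U V)

lemma phi_tensor:
  assumes U: "yd U" and V: "yd V"
  shows "eqn A
      (\<mu>' \<otimes> Wires [ycell V, ycell U] \<odot> \<lceil>F\<rceil> \<otimes> tXF_tensor V U \<odot> ycoact_tensor V U \<otimes> \<lceil>F\<rceil>)
      (\<phi>F' V \<otimes> \<lceil>ycell U\<rceil> \<odot> \<lceil>ycell V\<rceil> \<otimes> \<phi>F' U)"
  by (rule eqn_by_rewriting[OF eqns_Cons[OF mult_assoc eqns_Cons[OF tXF_mult[OF V] eqns_Nil]],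
      where xs = "[SwapR 3, SwapR 4, Fwd 0 5 0, SwapR 2, SwapR 1]"
      and ys = "[SwapL 2, Fwd 1 3 1]"]) (simp_all add: Let_def U V)

lemma psiB_tensor:
  assumes U: "yd U" and V: "yd V"
  shows "eqn A
      (yact_tensor V U \<otimes> \<lceil>B\<rceil> \<odot> \<lceil>F\<rceil> \<otimes> tBX_tensor V U \<odot> lB' \<otimes> Wires [ycell V, ycell U])
      (\<lceil>ycell V\<rceil> \<otimes> \<psi>B' U \<odot> \<psi>B' V \<otimes> \<lceil>ycell U\<rceil>)"
  by (rule eqn_by_rewriting[OF eqns_Cons[OF lB_coassoc eqns_Cons[OF tBX_lB[OF V] eqns_Nil]],
      where xs = "[SwapL 2, SwapL 1, Bwd 0 0 0, SwapL 3, SwapL 5, SwapL 4]"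
      and ys = "[SwapR 2, Fwd 1 1 1]"]) (simp_all add: Let_def U V)

section \<open>The axioms of a Yetter-Drinfel'd module for a tensor product\<close>

lemma tensor_tFX_mult:
  assumes U: "yd U" and V: "yd V"
  shows "eqn A
      (tFX_tensor V U \<odot> \<mu>' \<otimes> Wires [ycell V, ycell U])
      (Wires [ycell V, ycell U] \<otimes> \<mu>' \<odot> tFX_tensor V U \<otimes> \<lceil>F\<rceil> \<odot> \<lceil>F\<rceil> \<otimes> tFX_tensor V U)"
  by (rule eqn_by_rewriting[OF eqns_Cons[OF tFX_mult[OF V] eqns_Cons[OF tFX_mult[OF U] eqns_Nil]],
      where xs = "[Fwd 0 0 0]"
      and ys = "[SwapL 1, Bwd 1 2 1]"]) (simp_all add: Let_def U V)

lemma tensor_tFX_unit: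
  assumes U: "yd U" and V: "yd V"
  shows "eqn A
      (tFX_tensor V U \<odot> \<eta>' \<otimes> Wires [ycell V, ycell U])
      (Wires [ycell V, ycell U] \<otimes> \<eta>')"
  by (rule eqn_by_rewriting[OF eqns_Cons[OF tFX_unit[OF V] eqns_Cons[OF tFX_unit[OF U] eqns_Nil]],
      where xs = "[Fwd 0 0 0]"
      and ys = "[Bwd 1 0 1]"]) (simp_all add: Let_def U V)

lemma tensor_tFX_comult:
  assumes U: "yd U" and V: "yd V"
  shows "eqn A
      (Wires [ycell V, ycell U] \<otimes> \<Delta>' \<odot> tFX_tensor V U)
      (tFX_tensor V U \<otimes> \<lceil>F\<rceil> \<odot> \<lceil>F\<rceil> \<otimes> tFX_tensor V U \<odot> \<Delta>' \<otimes> Wires [ycell V, ycell U])"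
  by (rule eqn_by_rewriting[OF eqns_Cons[OF tFX_comult[OF U] eqns_Cons[OF tFX_comult[OF V]
      eqns_Nil]],
      where xs = "[Fwd 0 1 1]"
      and ys = "[SwapL 2, Bwd 1 0 0]"]) (simp_all add: Let_def U V)

lemma tensor_tFX_counit:
  assumes U: "yd U" and V: "yd V"
  shows "eqn A
      (Wires [ycell V, ycell U] \<otimes> \<epsilon>' \<odot> tFX_tensor V U)
      (\<epsilon>' \<otimes> Wires [ycell V, ycell U])"
  by (rule eqn_by_rewriting[OF eqns_Cons[OF tFX_counit[OF U] eqns_Cons[OF tFX_counit[OF V]
      eqns_Nil]],
      where xs = "[Fwd 0 1 1]"
      and ys = "[Bwd 1 0 0]"]) (simp_all add: Let_def U V)

lemma tensor_tXF_comult: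
  assumes U: "yd U" and V: "yd V"
  shows "eqn A
      (\<Delta>' \<otimes> Wires [ycell V, ycell U] \<odot> tXF_tensor V U)
      (\<lceil>F\<rceil> \<otimes> tXF_tensor V U \<odot> tXF_tensor V U \<otimes> \<lceil>F\<rceil> \<odot> Wires [ycell V, ycell U] \<otimes> \<Delta>')"
  by (rule eqn_by_rewriting[OF eqns_Cons[OF tXF_comult[OF V] eqns_Cons[OF tXF_comult[OF U]
      eqns_Nil]],
      where xs = "[Fwd 0 1 0]"
      and ys = "[SwapR 2, Bwd 1 0 1]"]) (simp_all add: Let_def U V)

lemma tensor_tXF_counit:
  assumes U: "yd U" and V: "yd V"
  shows "eqn A
      (\<epsilon>' \<otimes> Wires [ycell V, ycell U] \<odot> tXF_tensor V U)
      (Wires [ycell V, ycell U] \<otimes> \<epsilon>')"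
  by (rule eqn_by_rewriting[OF eqns_Cons[OF tXF_counit[OF V] eqns_Cons[OF tXF_counit[OF U]
      eqns_Nil]],
      where xs = "[Fwd 0 1 0]"
      and ys = "[Bwd 1 0 1]"]) (simp_all add: Let_def U V)

lemma tensor_tXF_mult:
  assumes U: "yd U" and V: "yd V"
  shows "eqn A
      (tXF_tensor V U \<odot> Wires [ycell V, ycell U] \<otimes> \<mu>')
      (\<mu>' \<otimes> Wires [ycell V, ycell U] \<odot> \<lceil>F\<rceil> \<otimes> tXF_tensor V U \<odot> tXF_tensor V U \<otimes> \<lceil>F\<rceil>)"
  by (rule eqn_by_rewriting[OF eqns_Cons[OF tXF_mult[OF U] eqns_Cons[OF tXF_mult[OF V] eqns_Nil]],
      where xs = "[Fwd 0 0 1]"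
      and ys = "[SwapR 1, Bwd 1 2 0]"]) (simp_all add: Let_def U V)

lemma tensor_tXF_unit:
  assumes U: "yd U" and V: "yd V"
  shows "eqn A
      (tXF_tensor V U \<odot> Wires [ycell V, ycell U] \<otimes> \<eta>')
      (\<eta>' \<otimes> Wires [ycell V, ycell U])"
  by (rule eqn_by_rewriting[OF eqns_Cons[OF tXF_unit[OF U] eqns_Cons[OF tXF_unit[OF V] eqns_Nil]],
      where xs = "[Fwd 0 0 1]"
      and ys = "[Bwd 1 0 0]"]) (simp_all add: Let_def U V)

text \<open>This is the associativity of a diagonal action: \<Delta> is multiplicative up to \<tau>,
  and that \<tau> comes from letting \<open>tFX V\<close> pass the action of
  \<open>V\<close>.\<close>

lemma tensor_act_assoc:
  assumes U: "yd U" and V: "yd V"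
  shows "eqn A
      (yact_tensor V U \<odot> \<lceil>F\<rceil> \<otimes> yact_tensor V U)
      (yact_tensor V U \<odot> \<mu>' \<otimes> Wires [ycell V, ycell U])"
  by (rule eqn_by_rewriting[OF eqns_Cons[OF act_assoc[OF U] eqns_Cons[OF tFX_act[OF V]
      eqns_Cons[OF comult_mult eqns_Cons[OF act_assoc[OF V] eqns_Cons[OF tFX_mult[OF V]
      eqns_Nil]]]]],
      where xs = "[SwapL 2, SwapL 3, SwapL 4, Fwd 0 5 2, SwapL 2, Fwd 1 3 1, SwapL 1, SwapL 2,
        SwapR 5, SwapL 7]"
      and ys = "[Fwd 2 0 0, SwapR 4, SwapL 6, Bwd 3 5 0, Fwd 4 3 2]"]) (simp_all add: Let_def U V)

lemma tensor_act_unit: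
  assumes U: "yd U" and V: "yd V"
  shows "eqn A (yact_tensor V U \<odot> \<eta>' \<otimes> Wires [ycell V, ycell U]) (Wires [ycell V, ycell U])"
  by (rule eqn_by_rewriting[OF eqns_Cons[OF comult_unit eqns_Cons[OF act_unit[OF V]
      eqns_Cons[OF tFX_unit[OF V] eqns_Cons[OF act_unit[OF U] eqns_Nil]]]],
      where xs = "[Fwd 0 0 0, SwapR 1, SwapL 3, Fwd 1 2 0, Fwd 2 0 0, Fwd 3 0 1]"
      and ys = "[]"]) (simp_all add: Let_def U V)

lemma tensor_coact_coassoc:
  assumes U: "yd U" and V: "yd V"
  shows "eqn A
      (\<lceil>F\<rceil> \<otimes> ycoact_tensor V U \<odot> ycoact_tensor V U)
      (\<Delta>' \<otimes> Wires [ycell V, ycell U] \<odot> ycoact_tensor V U)"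
  by (rule eqn_by_rewriting[OF eqns_Cons[OF coact_coassoc[OF U] eqns_Cons[OF tXF_coact[OF V]
      eqns_Cons[OF comult_mult eqns_Cons[OF coact_coassoc[OF V] eqns_Cons[OF tXF_comult[OF V]
      eqns_Nil]]]]],
      where xs = "[SwapR 3, SwapR 2, SwapR 1, Fwd 0 0 1, SwapR 4, Fwd 1 3 1, SwapL 1, SwapL 0,
        SwapL 2, SwapL 1, SwapR 6, SwapR 5, SwapR 7]"
      and ys = "[Fwd 2 3 0, SwapL 0, SwapL 3, SwapL 2, SwapL 1, Bwd 3 0 0, Fwd 4 3 2]"])
        (simp_all add: Let_def U V)

lemma tensor_coact_counit:
  assumes U: "yd U" and V: "yd V"
  shows "eqn A
      (\<epsilon>' \<otimes> Wires [ycell V, ycell U] \<odot> ycoact_tensor V U)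
      (Wires [ycell V, ycell U])"
  by (rule eqn_by_rewriting[OF eqns_Cons[OF counit_mult eqns_Cons[OF coact_counit[OF V]
      eqns_Cons[OF tXF_counit[OF V] eqns_Cons[OF coact_counit[OF U] eqns_Nil]]]],
      where xs = "[Fwd 0 3 0, SwapL 0, SwapL 3, SwapL 2, SwapL 1, Fwd 1 0 0, Fwd 2 1 0, Fwd 3 0
        1]"
      and ys = "[]"]) (simp_all add: Let_def U V)

text \<open>Two \<open>F\<close> strands cross the left factor \<open>V\<close>, one from the
  diagonal action and one from the braiding, and their directions decide the hexagon. Both run to
  the right here, so the Yang-Baxter equation on \<open>F F X\<close> is required; for
  \<open>tensor_tXF_coact\<close> both run to the left, which requires the one on
  \<open>X F F\<close>.\<close>

lemma tensor_tFX_act: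
  assumes U: "yd U" and V: "yd V" and ybV: "yang_baxter K F \<tau> V"
  shows "eqn A
      (tFX_tensor V U \<odot> \<lceil>F\<rceil> \<otimes> yact_tensor V U)
      (yact_tensor V U \<otimes> \<lceil>F\<rceil> \<odot> \<lceil>F\<rceil> \<otimes> tFX_tensor V U \<odot> \<tau>' \<otimes> Wires [ycell V, ycell U])"
  by (rule eqn_by_rewriting[OF eqns_Cons[OF tFX_act[OF U] eqns_Cons[OF tFX_act[OF V]
      eqns_Cons[OF tau_comult_left eqns_Cons[OF hexagon_FFX[OF V ybV] eqns_Nil]]]],
      where xs = "[SwapL 2, SwapL 3, Fwd 0 4 1, Fwd 1 2 0, SwapL 1, SwapR 4, SwapR 5, SwapR 6]"
      and ys = "[SwapL 2, SwapL 1, Fwd 2 0 0, SwapL 4, Bwd 3 2 1]"]) (simp_all add: Let_def U V)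

text \<open>Here the \<open>F\<close> split off from \<open>U\<close> crosses \<open>V\<close> to
  the left while the other \<open>F\<close> crosses it to the right. Opposite directions lead to the
  hexagon on \<open>F X F\<close>, which is among the axioms; the same happens in
  \<open>tensor_tXF_act\<close>.\<close>

lemma tensor_tFX_coact:
  assumes U: "yd U" and V: "yd V"
  shows "eqn A
      (ycoact_tensor V U \<otimes> \<lceil>F\<rceil> \<odot> tFX_tensor V U)
      (\<lceil>F\<rceil> \<otimes> tFX_tensor V U \<odot> \<tau>' \<otimes> Wires [ycell V, ycell U] \<odot> \<lceil>F\<rceil> \<otimes> ycoact_tensor V U)"
  by (rule eqn_by_rewriting[OF eqns_Cons[OF tFX_coact[OF U] eqns_Cons[OF tFX_coact[OF V]
      eqns_Cons[OF tau_mult_right eqns_Cons[OF hexagon_FXF[OF V] eqns_Nil]]]],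
      where xs = "[Fwd 0 1 1, SwapL 3, SwapL 2, SwapL 1, Fwd 1 0 0, SwapR 2, SwapR 1, SwapR 0,
        SwapL 5, SwapL 6]"
      and ys = "[Fwd 2 3 0, SwapL 2, SwapR 5, Fwd 3 3 1]"]) (simp_all add: Let_def U V)

lemma tensor_tXF_act:
  assumes U: "yd U" and V: "yd V"
  shows "eqn A
      (tXF_tensor V U \<odot> yact_tensor V U \<otimes> \<lceil>F\<rceil>)
      (\<lceil>F\<rceil> \<otimes> yact_tensor V U \<odot> \<tau>' \<otimes> Wires [ycell V, ycell U] \<odot> \<lceil>F\<rceil> \<otimes> tXF_tensor V U)"
  by (rule eqn_by_rewriting[OF eqns_Cons[OF tXF_act[OF U] eqns_Cons[OF tXF_act[OF V]
      eqns_Cons[OF tau_comult_right eqns_Cons[OF hexagon_FXF[OF V] eqns_Nil]]]],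
      where xs = "[SwapR 3, Fwd 0 2 2, SwapL 4, SwapL 5, Fwd 1 4 0, SwapR 1, SwapR 0, SwapR 6]"
      and ys = "[Fwd 2 2 0, SwapL 1, SwapR 4, Fwd 3 2 1]"]) (simp_all add: Let_def U V)

lemma tensor_tXF_coact:
  assumes U: "yd U" and V: "yd V" and ybV: "yang_baxter K F \<tau> V"
  shows "eqn A
      (\<lceil>F\<rceil> \<otimes> ycoact_tensor V U \<odot> tXF_tensor V U)
      (\<tau>' \<otimes> Wires [ycell V, ycell U] \<odot> \<lceil>F\<rceil> \<otimes> tXF_tensor V U \<odot> ycoact_tensor V U \<otimes> \<lceil>F\<rceil>)"
  by (rule eqn_by_rewriting[OF eqns_Cons[OF tXF_coact[OF U] eqns_Cons[OF tXF_coact[OF V]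
      eqns_Cons[OF tau_mult_left eqns_Cons[OF hexagon_XFF[OF V ybV] eqns_Nil]]]],
      where xs = "[SwapR 1, Fwd 0 0 1, Fwd 1 3 0, SwapL 2, SwapL 1, SwapR 5]"
      and ys = "[SwapR 3, SwapR 4, Fwd 2 5 0, SwapR 2, Bwd 3 3 1]"]) (simp_all add: Let_def U V)

lemma tensor_hexagon_FXF:
  assumes U: "yd U" and V: "yd V"
  shows "eqn A
      (\<lceil>F\<rceil> \<otimes> tFX_tensor V U \<odot> \<tau>' \<otimes> Wires [ycell V, ycell U] \<odot> \<lceil>F\<rceil> \<otimes> tXF_tensor V U)
      (tXF_tensor V U \<otimes> \<lceil>F\<rceil> \<odot> Wires [ycell V, ycell U] \<otimes> \<tau>' \<odot> tFX_tensor V U \<otimes> \<lceil>F\<rceil>)"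
  by (rule eqn_by_rewriting[OF eqns_Cons[OF hexagon_FXF[OF V] eqns_Cons[OF hexagon_FXF[OF U]
      eqns_Nil]],
      where xs = "[Fwd 0 1 0, SwapL 0, SwapR 3]"
      and ys = "[Bwd 1 1 1]"]) (simp_all add: Let_def U V)

text \<open>The condition for \<open>U\<close> needs a \<Delta> and a \<open>\<mu>\<close> adjacent
  to its strand. They are produced by fusing: \<open>tFX_comult\<close>, read backwards, turns
  \<Delta> with two crossings of \<open>V\<close> into one crossing followed by \<Delta>, and
  \<open>tXF_mult\<close> does the same for \<open>\<mu>\<close>. After the condition for
  \<open>U\<close> has been applied the fusion is undone, which frees a \<Delta> and a
  \<open>\<mu>\<close> for the condition for \<open>V\<close>.\<close>

lemma tensor_yetter_drinfeld:
  assumes U: "yd U" and V: "yd V"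
  shows "eqn A
      (\<mu>' \<otimes> Wires [ycell V, ycell U] \<odot> \<lceil>F\<rceil> \<otimes> tXF_tensor V U \<odot> ycoact_tensor V U \<otimes> \<lceil>F\<rceil>
        \<odot> yact_tensor V U \<otimes> \<lceil>F\<rceil> \<odot> \<lceil>F\<rceil> \<otimes> tFX_tensor V U \<odot> \<Delta>' \<otimes> Wires [ycell V, ycell U])
      (\<mu>' \<otimes> yact_tensor V U \<odot> \<lceil>F\<rceil> \<otimes> \<tau>' \<otimes> Wires [ycell V, ycell U] \<odot> \<Delta>' \<otimes> ycoact_tensor V U)"
  by (rule eqn_by_rewriting[OF eqns_Cons[OF mult_assoc eqns_Cons[OF comult_coassoc
      eqns_Cons[OF tFX_comult[OF V] eqns_Cons[OF tXF_mult[OF V]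
      eqns_Cons[OF yetter_drinfeld[OF U] eqns_Cons[OF yetter_drinfeld[OF V]
      eqns_Cons[OF tFX_coact[OF V] eqns_Cons[OF tau_mult_right eqns_Cons[OF tau_comult_right
      eqns_Cons[OF hexagon_FXF[OF V] eqns_Cons[OF tXF_act[OF V] eqns_Nil]]]]]]]]]]],
      where xs = "[SwapR 10, SwapR 11, Fwd 0 12 0, SwapL 2, SwapL 1, Fwd 1 0 0, SwapL 3,
        Bwd 2 1 1, SwapR 8, Bwd 3 9 1, SwapR 5, SwapR 7, SwapR 6, SwapR 8, SwapR 7, Fwd 4 2 2,
        SwapL 2, Fwd 2 1 1, Bwd 1 0 0, SwapL 7, SwapL 6, SwapL 8, SwapL 7, SwapL 8, SwapL 9,
        Fwd 3 8 1, SwapL 11, Bwd 0 10 0, SwapR 1, SwapL 5, SwapL 4, SwapL 6, SwapL 5, SwapL 7,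
        SwapL 6, SwapL 9, SwapL 8, SwapL 7, Fwd 5 2 0, SwapL 2, SwapL 1, Fwd 1 0 0, Fwd 6 2 2,
        SwapR 1, SwapR 0, SwapL 4, SwapR 7, SwapR 6, SwapR 5, SwapR 8, SwapR 7, SwapR 9]"
      and ys = "[SwapL 3, Fwd 7 4 1, SwapL 10, SwapL 9, SwapL 8, SwapL 7, Bwd 0 6 0, SwapR 7,
        SwapR 6, Fwd 8 5 2, SwapL 2, SwapL 3, SwapL 4, SwapR 9, SwapR 8, SwapR 7, Fwd 9 5 3,
        SwapL 11, SwapR 10, SwapR 9, Bwd 10 7 2, SwapL 0, SwapL 1, SwapL 2, SwapL 3, Fwd 8 2 1]"])
          (simp_all add: Let_def U V)

lemma tensor_tBX_multB:
  assumes U: "yd U" and V: "yd V"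
  shows "eqn A
      (tBX_tensor V U \<odot> \<mu>B' \<otimes> Wires [ycell V, ycell U])
      (Wires [ycell V, ycell U] \<otimes> \<mu>B' \<odot> tBX_tensor V U \<otimes> \<lceil>B\<rceil> \<odot> \<lceil>B\<rceil> \<otimes> tBX_tensor V U)"
  by (rule eqn_by_rewriting[OF eqns_Cons[OF tBX_multB[OF V] eqns_Cons[OF tBX_multB[OF U]
      eqns_Nil]],
      where xs = "[Fwd 0 0 0]"
      and ys = "[SwapL 1, Bwd 1 2 1]"]) (simp_all add: Let_def U V)

lemma tensor_tBX_unitB:
  assumes U: "yd U" and V: "yd V"
  shows "eqn A
      (tBX_tensor V U \<odot> \<eta>B' \<otimes> Wires [ycell V, ycell U])
      (Wires [ycell V, ycell U] \<otimes> \<eta>B')"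
  by (rule eqn_by_rewriting[OF eqns_Cons[OF tBX_unitB[OF V] eqns_Cons[OF tBX_unitB[OF U]
      eqns_Nil]],
      where xs = "[Fwd 0 0 0]"
      and ys = "[Bwd 1 0 1]"]) (simp_all add: Let_def U V)

lemma tensor_hexagon_BFX:
  assumes U: "yd U" and V: "yd V"
  shows "eqn A
      (Wires [ycell V, ycell U] \<otimes> \<tau>BF' \<odot> tBX_tensor V U \<otimes> \<lceil>F\<rceil> \<odot> \<lceil>B\<rceil> \<otimes> tFX_tensor V U)
      (tFX_tensor V U \<otimes> \<lceil>B\<rceil> \<odot> \<lceil>F\<rceil> \<otimes> tBX_tensor V U \<odot> \<tau>BF' \<otimes> Wires [ycell V, ycell U])"
  by (rule eqn_by_rewriting[OF eqns_Cons[OF hexagon_BFX[OF U] eqns_Cons[OF hexagon_BFX[OF V]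
      eqns_Nil]],
      where xs = "[SwapL 1, Fwd 0 2 1]"
      and ys = "[SwapL 2, Bwd 1 0 0]"]) (simp_all add: Let_def U V)

lemma tensor_hexagon_BXF:
  assumes U: "yd U" and V: "yd V"
  shows "eqn A
      (\<lceil>F\<rceil> \<otimes> tBX_tensor V U \<odot> \<tau>BF' \<otimes> Wires [ycell V, ycell U] \<odot> \<lceil>B\<rceil> \<otimes> tXF_tensor V U)
      (tXF_tensor V U \<otimes> \<lceil>B\<rceil> \<odot> Wires [ycell V, ycell U] \<otimes> \<tau>BF' \<odot> tBX_tensor V U \<otimes> \<lceil>F\<rceil>)"
  by (rule eqn_by_rewriting[OF eqns_Cons[OF hexagon_BXF[OF V] eqns_Cons[OF hexagon_BXF[OF U]
      eqns_Nil]],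
      where xs = "[Fwd 0 1 0, SwapL 0, SwapR 3]"
      and ys = "[Bwd 1 1 1]"]) (simp_all add: Let_def U V)

lemma tensor_tBX_act:
  assumes U: "yd U" and V: "yd V"
  shows "eqn A
      (tBX_tensor V U \<odot> \<lceil>B\<rceil> \<otimes> yact_tensor V U)
      (yact_tensor V U \<otimes> \<lceil>B\<rceil> \<odot> \<lceil>F\<rceil> \<otimes> tBX_tensor V U \<odot> \<tau>BF' \<otimes> Wires [ycell V, ycell U])"
  by (rule eqn_by_rewriting[OF eqns_Cons[OF tBX_act[OF U] eqns_Cons[OF tBX_act[OF V]
      eqns_Cons[OF tBF_comult eqns_Cons[OF hexagon_BFX[OF V] eqns_Nil]]]],
      where xs = "[SwapL 2, SwapL 3, Fwd 0 4 1, Fwd 1 2 0, SwapL 1, SwapR 4, SwapR 5, SwapR 6]"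
      and ys = "[SwapL 2, SwapL 1, Fwd 2 0 0, SwapL 4, Bwd 3 2 1]"]) (simp_all add: Let_def U V)

lemma tensor_tBX_coact:
  assumes U: "yd U" and V: "yd V"
  shows "eqn A
      (ycoact_tensor V U \<otimes> \<lceil>B\<rceil> \<odot> tBX_tensor V U)
      (\<lceil>F\<rceil> \<otimes> tBX_tensor V U \<odot> \<tau>BF' \<otimes> Wires [ycell V, ycell U] \<odot> \<lceil>B\<rceil> \<otimes> ycoact_tensor V U)"
  by (rule eqn_by_rewriting[OF eqns_Cons[OF tBX_coact[OF U] eqns_Cons[OF tBX_coact[OF V]
      eqns_Cons[OF tBF_mult eqns_Cons[OF hexagon_BXF[OF V] eqns_Nil]]]],
      where xs = "[Fwd 0 1 1, SwapL 3, SwapL 2, SwapL 1, Fwd 1 0 0, SwapR 2, SwapR 1, SwapR 0,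
        SwapL 5, SwapL 6]"
      and ys = "[Bwd 2 3 0, SwapL 2, SwapR 5, Fwd 3 3 1]"]) (simp_all add: Let_def U V)

lemma tensor_tBX_lB:
  assumes U: "yd U" and V: "yd V"
  shows "eqn A
      (Wires [ycell V, ycell U] \<otimes> lB' \<odot> tBX_tensor V U)
      (tFX_tensor V U \<otimes> \<lceil>B\<rceil> \<odot> \<lceil>F\<rceil> \<otimes> tBX_tensor V U \<odot> lB' \<otimes> Wires [ycell V, ycell U])"
  by (rule eqn_by_rewriting[OF eqns_Cons[OF tBX_lB[OF U] eqns_Cons[OF tBX_lB[OF V] eqns_Nil]],
      where xs = "[Fwd 0 1 1]"
      and ys = "[SwapL 2, Bwd 1 0 0]"]) (simp_all add: Let_def U V)

text \<open>A crossing of two \<open>F\<close> strands moves past \<open>V U\<close> by moving past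
  one factor after the other. Together with \<open>tensor_hexagon_XFF\<close> this makes the
  Yang-Baxter condition stable under tensor products.\<close>

lemma tensor_hexagon_FFX:
  assumes U: "yd U" and V: "yd V" and ybV: "yang_baxter K F \<tau> V" and ybU: "yang_baxter K F \<tau> U"
  shows "eqn A
      (Wires [ycell V, ycell U] \<otimes> \<tau>' \<odot> tFX_tensor V U \<otimes> \<lceil>F\<rceil> \<odot> \<lceil>F\<rceil> \<otimes> tFX_tensor V U)
      (tFX_tensor V U \<otimes> \<lceil>F\<rceil> \<odot> \<lceil>F\<rceil> \<otimes> tFX_tensor V U \<odot> \<tau>' \<otimes> Wires [ycell V, ycell U])"
  by (rule eqn_by_rewriting[OF eqns_Cons[OF hexagon_FFX[OF U ybU]
      eqns_Cons[OF hexagon_FFX[OF V ybV]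
      eqns_Nil]],
      where xs = "[SwapL 1, Fwd 0 2 1]"
      and ys = "[SwapL 2, Bwd 1 0 0]"]) (simp_all add: Let_def U V)

lemma tensor_hexagon_XFF:
  assumes U: "yd U" and V: "yd V" and ybV: "yang_baxter K F \<tau> V" and ybU: "yang_baxter K F \<tau> U"
  shows "eqn A
      (\<lceil>F\<rceil> \<otimes> tXF_tensor V U \<odot> tXF_tensor V U \<otimes> \<lceil>F\<rceil> \<odot> Wires [ycell V, ycell U] \<otimes> \<tau>')
      (\<tau>' \<otimes> Wires [ycell V, ycell U] \<odot> \<lceil>F\<rceil> \<otimes> tXF_tensor V U \<odot> tXF_tensor V U \<otimes> \<lceil>F\<rceil>)"
  by (rule eqn_by_rewriting[OF eqns_Cons[OF hexagon_XFF[OF U ybU]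
      eqns_Cons[OF hexagon_XFF[OF V ybV]
      eqns_Nil]],
      where xs = "[SwapR 2, Fwd 0 0 1]"
      and ys = "[SwapR 1, Bwd 1 2 0]"]) (simp_all add: Let_def U V)

section \<open>The axioms for the identity 1-cell\<close>

lemma id_left_simps [simp]: "\<one> A \<cdot> F = F" "\<one> A \<cdot> B = B" "\<one> A \<cdot> \<one> A = \<one> A"
  using comp1_id_left F_typing(1) B_typing(1) id1_hom objA by blast+

text \<open>The identity 1-cell is the empty word and its crossings are identities, drawn as
  \<open>Wires [F]\<close> and \<open>Wires [B]\<close>. Axioms about crossings alone therefore have
  equal layers on both sides, and empty lists of steps prove them.\<close>

lemma unit_tFX_mult: "eqn A
      ((Wires [F]) \<odot> \<mu>' \<otimes> Wires [])
      (Wires [] \<otimes> \<mu>' \<odot> (Wires [F]) \<otimes> \<lceil>F\<rceil> \<odot> \<lceil>F\<rceil> \<otimes> (Wires [F]))"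
  by (rule eqn_by_rewriting[OF eqns_Nil,
      where xs = "[]"
      and ys = "[]"]) (simp_all add: Let_def)

lemma unit_tFX_unit: "eqn A ((Wires [F]) \<odot> \<eta>' \<otimes> Wires []) (Wires [] \<otimes> \<eta>')"
  by (rule eqn_by_rewriting[OF eqns_Nil,
      where xs = "[]"
      and ys = "[]"]) (simp_all add: Let_def)

lemma unit_tFX_comult: "eqn A
      (Wires [] \<otimes> \<Delta>' \<odot> (Wires [F]))
      ((Wires [F]) \<otimes> \<lceil>F\<rceil> \<odot> \<lceil>F\<rceil> \<otimes> (Wires [F]) \<odot> \<Delta>' \<otimes> Wires [])"
  by (rule eqn_by_rewriting[OF eqns_Nil,
      where xs = "[]"
      and ys = "[]"]) (simp_all add: Let_def)

lemma unit_tFX_counit: "eqn A (Wires [] \<otimes> \<epsilon>' \<odot> (Wires [F])) (\<epsilon>' \<otimes> Wires [])"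
  by (rule eqn_by_rewriting[OF eqns_Nil,
      where xs = "[]"
      and ys = "[]"]) (simp_all add: Let_def)

lemma unit_tXF_comult: "eqn A
      (\<Delta>' \<otimes> Wires [] \<odot> (Wires [F]))
      (\<lceil>F\<rceil> \<otimes> (Wires [F]) \<odot> (Wires [F]) \<otimes> \<lceil>F\<rceil> \<odot> Wires [] \<otimes> \<Delta>')"
  by (rule eqn_by_rewriting[OF eqns_Nil,
      where xs = "[]"
      and ys = "[]"]) (simp_all add: Let_def)

lemma unit_tXF_counit: "eqn A (\<epsilon>' \<otimes> Wires [] \<odot> (Wires [F])) (Wires [] \<otimes> \<epsilon>')"
  by (rule eqn_by_rewriting[OF eqns_Nil,
      where xs = "[]"
      and ys = "[]"]) (simp_all add: Let_def)

lemma unit_tXF_mult: "eqn A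
      ((Wires [F]) \<odot> Wires [] \<otimes> \<mu>')
      (\<mu>' \<otimes> Wires [] \<odot> \<lceil>F\<rceil> \<otimes> (Wires [F]) \<odot> (Wires [F]) \<otimes> \<lceil>F\<rceil>)"
  by (rule eqn_by_rewriting[OF eqns_Nil,
      where xs = "[]"
      and ys = "[]"]) (simp_all add: Let_def)

lemma unit_tXF_unit: "eqn A ((Wires [F]) \<odot> Wires [] \<otimes> \<eta>') (\<eta>' \<otimes> Wires [])"
  by (rule eqn_by_rewriting[OF eqns_Nil,
      where xs = "[]"
      and ys = "[]"]) (simp_all add: Let_def)

lemma unit_act_assoc: "eqn A
      (\<epsilon>' \<odot> \<lceil>F\<rceil> \<otimes> \<epsilon>')
      (\<epsilon>' \<odot> \<mu>' \<otimes> Wires [])"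
  by (rule eqn_by_rewriting[OF eqns_Cons[OF counit_mult eqns_Nil],
      where xs = "[Bwd 0 0 0]"
      and ys = "[]"]) (simp_all add: Let_def)

lemma unit_act_unit: "eqn A (\<epsilon>' \<odot> \<eta>' \<otimes> Wires []) (Wires [])"
  by (rule eqn_by_rewriting[OF eqns_Cons[OF counit_unit eqns_Nil],
      where xs = "[Fwd 0 0 0]"
      and ys = "[]"]) (simp_all add: Let_def)

lemma unit_coact_coassoc: "eqn A
      (\<lceil>F\<rceil> \<otimes> \<eta>' \<odot> \<eta>')
      (\<Delta>' \<otimes> Wires [] \<odot> \<eta>')"
  by (rule eqn_by_rewriting[OF eqns_Cons[OF comult_unit eqns_Nil],
      where xs = "[SwapR 0, Bwd 0 0 0]"
      and ys = "[]"]) (simp_all add: Let_def)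

lemma unit_coact_counit: "eqn A (\<epsilon>' \<otimes> Wires [] \<odot> \<eta>') (Wires [])"
  by (rule eqn_by_rewriting[OF eqns_Cons[OF counit_unit eqns_Nil],
      where xs = "[Fwd 0 0 0]"
      and ys = "[]"]) (simp_all add: Let_def)

text \<open>With action \<open>\<epsilon>\<close> and coaction \<open>\<eta>\<close>, naturality of
  the trivial crossing becomes the counit or unit law of \<tau>. For \<open>B\<close> the
  corresponding laws of \<open>\<tau>BF\<close> come from \<open>bimonad_in_Mnd\<close>.\<close>

lemma unit_tFX_act: "eqn A
      ((Wires [F]) \<odot> \<lceil>F\<rceil> \<otimes> \<epsilon>')
      (\<epsilon>' \<otimes> \<lceil>F\<rceil> \<odot> \<lceil>F\<rceil> \<otimes> (Wires [F]) \<odot> \<tau>' \<otimes> Wires [])"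
  by (rule eqn_by_rewriting[OF eqns_Cons[OF tau_counit_left eqns_Nil],
      where xs = "[Bwd 0 0 0]"
      and ys = "[]"]) (simp_all add: Let_def)

lemma unit_tFX_coact: "eqn A
      (\<eta>' \<otimes> \<lceil>F\<rceil> \<odot> (Wires [F]))
      (\<lceil>F\<rceil> \<otimes> (Wires [F]) \<odot> \<tau>' \<otimes> Wires [] \<odot> \<lceil>F\<rceil> \<otimes> \<eta>')"
  by (rule eqn_by_rewriting[OF eqns_Cons[OF tau_unit_right eqns_Nil],
      where xs = "[Bwd 0 0 0]"
      and ys = "[]"]) (simp_all add: Let_def)

lemma unit_tXF_act: "eqn A
      ((Wires [F]) \<odot> \<epsilon>' \<otimes> \<lceil>F\<rceil>)
      (\<lceil>F\<rceil> \<otimes> \<epsilon>' \<odot> \<tau>' \<otimes> Wires [] \<odot> \<lceil>F\<rceil> \<otimes> (Wires [F]))"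
  by (rule eqn_by_rewriting[OF eqns_Cons[OF tau_counit_right eqns_Nil],
      where xs = "[Bwd 0 0 0]"
      and ys = "[]"]) (simp_all add: Let_def)

lemma unit_tXF_coact: "eqn A
      (\<lceil>F\<rceil> \<otimes> \<eta>' \<odot> (Wires [F]))
      (\<tau>' \<otimes> Wires [] \<odot> \<lceil>F\<rceil> \<otimes> (Wires [F]) \<odot> \<eta>' \<otimes> \<lceil>F\<rceil>)"
  by (rule eqn_by_rewriting[OF eqns_Cons[OF tau_unit_left eqns_Nil],
      where xs = "[Bwd 0 0 0]"
      and ys = "[]"]) (simp_all add: Let_def)

lemma unit_hexagon_FXF: "eqn A
      (\<lceil>F\<rceil> \<otimes> (Wires [F]) \<odot> \<tau>' \<otimes> Wires [] \<odot> \<lceil>F\<rceil> \<otimes> (Wires [F]))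
      ((Wires [F]) \<otimes> \<lceil>F\<rceil> \<odot> Wires [] \<otimes> \<tau>' \<odot> (Wires [F]) \<otimes> \<lceil>F\<rceil>)"
  by (rule eqn_by_rewriting[OF eqns_Nil,
      where xs = "[]"
      and ys = "[]"]) (simp_all add: Let_def)

text \<open>Both sides collapse to the identity of \<open>F\<close> by unit and counit laws.\<close>

lemma unit_yetter_drinfeld: "eqn A
      (\<mu>' \<otimes> Wires [] \<odot> \<lceil>F\<rceil> \<otimes> (Wires [F]) \<odot> \<eta>' \<otimes> \<lceil>F\<rceil> \<odot> \<epsilon>' \<otimes> \<lceil>F\<rceil> \<odot> \<lceil>F\<rceil> \<otimes> (Wires [F])
        \<odot> \<Delta>' \<otimes> Wires [])
      (\<mu>' \<otimes> \<epsilon>' \<odot> \<lceil>F\<rceil> \<otimes> \<tau>' \<otimes> Wires [] \<odot> \<Delta>' \<otimes> \<eta>')"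
  by (rule eqn_by_rewriting[OF eqns_Cons[OF mult_unit_left eqns_Cons[OF comult_counit_left
      eqns_Cons[OF tau_unit_right eqns_Cons[OF mult_unit_right eqns_Cons[OF comult_counit_right
      eqns_Nil]]]]],
      where xs = "[SwapR 1, SwapR 2, Fwd 0 1 1, Fwd 1 0 0]"
      and ys = "[SwapL 0, Fwd 2 1 1, SwapL 2, Fwd 3 1 0, Fwd 4 0 0]"]) (simp_all add: Let_def)

lemma unit_tBX_multB: "eqn A
      ((Wires [B]) \<odot> \<mu>B' \<otimes> Wires [])
      (Wires [] \<otimes> \<mu>B' \<odot> (Wires [B]) \<otimes> \<lceil>B\<rceil> \<odot> \<lceil>B\<rceil> \<otimes> (Wires [B]))"
  by (rule eqn_by_rewriting[OF eqns_Nil,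
      where xs = "[]"
      and ys = "[]"]) (simp_all add: Let_def)

lemma unit_tBX_unitB: "eqn A ((Wires [B]) \<odot> \<eta>B' \<otimes> Wires []) (Wires [] \<otimes> \<eta>B')"
  by (rule eqn_by_rewriting[OF eqns_Nil,
      where xs = "[]"
      and ys = "[]"]) (simp_all add: Let_def)

lemma unit_hexagon_BFX: "eqn A
      (Wires [] \<otimes> \<tau>BF' \<odot> (Wires [B]) \<otimes> \<lceil>F\<rceil> \<odot> \<lceil>B\<rceil> \<otimes> (Wires [F]))
      ((Wires [F]) \<otimes> \<lceil>B\<rceil> \<odot> \<lceil>F\<rceil> \<otimes> (Wires [B]) \<odot> \<tau>BF' \<otimes> Wires [])"
  by (rule eqn_by_rewriting[OF eqns_Nil,
      where xs = "[]"
      and ys = "[]"]) (simp_all add: Let_def)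

lemma unit_hexagon_BXF: "eqn A
      (\<lceil>F\<rceil> \<otimes> (Wires [B]) \<odot> \<tau>BF' \<otimes> Wires [] \<odot> \<lceil>B\<rceil> \<otimes> (Wires [F]))
      ((Wires [F]) \<otimes> \<lceil>B\<rceil> \<odot> Wires [] \<otimes> \<tau>BF' \<odot> (Wires [B]) \<otimes> \<lceil>F\<rceil>)"
  by (rule eqn_by_rewriting[OF eqns_Nil,
      where xs = "[]"
      and ys = "[]"]) (simp_all add: Let_def)

lemma unit_tBX_act: "eqn A
      ((Wires [B]) \<odot> \<lceil>B\<rceil> \<otimes> \<epsilon>')
      (\<epsilon>' \<otimes> \<lceil>B\<rceil> \<odot> \<lceil>F\<rceil> \<otimes> (Wires [B]) \<odot> \<tau>BF' \<otimes> Wires [])"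
  by (rule eqn_by_rewriting[OF eqns_Cons[OF tBF_counit eqns_Nil],
      where xs = "[Bwd 0 0 0]"
      and ys = "[]"]) (simp_all add: Let_def)

lemma unit_tBX_coact: "eqn A
      (\<eta>' \<otimes> \<lceil>B\<rceil> \<odot> (Wires [B]))
      (\<lceil>F\<rceil> \<otimes> (Wires [B]) \<odot> \<tau>BF' \<otimes> Wires [] \<odot> \<lceil>B\<rceil> \<otimes> \<eta>')"
  by (rule eqn_by_rewriting[OF eqns_Cons[OF tBF_unit eqns_Nil],
      where xs = "[Fwd 0 0 0]"
      and ys = "[]"]) (simp_all add: Let_def)

lemma unit_tBX_lB: "eqn A
      (Wires [] \<otimes> lB' \<odot> (Wires [B]))
      ((Wires [F]) \<otimes> \<lceil>B\<rceil> \<odot> \<lceil>F\<rceil> \<otimes> (Wires [B]) \<odot> lB' \<otimes> Wires [])"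
  by (rule eqn_by_rewriting[OF eqns_Nil,
      where xs = "[]"
      and ys = "[]"]) (simp_all add: Let_def)

lemma unit_hexagon_FFX: "eqn A
      (Wires [] \<otimes> \<tau>' \<odot> (Wires [F]) \<otimes> \<lceil>F\<rceil> \<odot> \<lceil>F\<rceil> \<otimes> (Wires [F]))
      ((Wires [F]) \<otimes> \<lceil>F\<rceil> \<odot> \<lceil>F\<rceil> \<otimes> (Wires [F]) \<odot> \<tau>' \<otimes> Wires [])"
  by (rule eqn_by_rewriting[OF eqns_Nil,
      where xs = "[]"
      and ys = "[]"]) (simp_all add: Let_def)

lemma unit_hexagon_XFF: "eqn A
      (\<lceil>F\<rceil> \<otimes> (Wires [F]) \<odot> (Wires [F]) \<otimes> \<lceil>F\<rceil> \<odot> Wires [] \<otimes> \<tau>')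
      (\<tau>' \<otimes> Wires [] \<odot> \<lceil>F\<rceil> \<otimes> (Wires [F]) \<odot> (Wires [F]) \<otimes> \<lceil>F\<rceil>)"
  by (rule eqn_by_rewriting[OF eqns_Nil,
      where xs = "[]"
      and ys = "[]"]) (simp_all add: Let_def)

lemma psiF_unit: "eqn A
      (\<epsilon>' \<otimes> \<lceil>F\<rceil> \<odot> \<lceil>F\<rceil> \<otimes> (Wires [F]) \<odot> \<Delta>' \<otimes> Wires [])
      \<lceil>F\<rceil>"
  by (rule eqn_by_rewriting[OF eqns_Cons[OF comult_counit_left eqns_Nil],
      where xs = "[Fwd 0 0 0]"
      and ys = "[]"]) (simp_all add: Let_def)

lemma phi_unit: "eqn A
      (\<mu>' \<otimes> Wires [] \<odot> \<lceil>F\<rceil> \<otimes> (Wires [F]) \<odot> \<eta>' \<otimes> \<lceil>F\<rceil>)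
      \<lceil>F\<rceil>"
  by (rule eqn_by_rewriting[OF eqns_Cons[OF mult_unit_left eqns_Nil],
      where xs = "[Fwd 0 0 0]"
      and ys = "[]"]) (simp_all add: Let_def)

lemma psiB_unit: "eqn A
      (\<epsilon>' \<otimes> \<lceil>B\<rceil> \<odot> \<lceil>F\<rceil> \<otimes> (Wires [B]) \<odot> lB' \<otimes> Wires [])
      \<lceil>B\<rceil>"
  by (rule eqn_by_rewriting[OF eqns_Cons[OF lB_counit eqns_Nil],
      where xs = "[Fwd 0 0 0]"
      and ys = "[]"]) (simp_all add: Let_def)

text \<open>
  The action of \<open>F\<close> is recovered from \<open>\<psi>\<^sub>F\<^sub>X\<close> by the counit, so a morphism in
  \<open>Mnd(K)(F)\<close> is \<open>F\<close>-linear.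
\<close>

lemma psiB_arrow:
  assumes U: "yd U" and V: "yd V" and "\<zeta> \<in> hom2 K (ycell U) (ycell V)"
    and psi: "eqn A
      (Cell \<zeta> [ycell U] [ycell V] \<otimes> \<lceil>F\<rceil> \<odot> \<psi>F' U)
      (\<psi>F' V \<odot> \<lceil>F\<rceil> \<otimes> Cell \<zeta> [ycell U] [ycell V])"
    and tB: "eqn A
      (Cell \<zeta> [ycell U] [ycell V] \<otimes> \<lceil>B\<rceil> \<odot> tBX' U)
      (tBX' V \<odot> \<lceil>B\<rceil> \<otimes> Cell \<zeta> [ycell U] [ycell V])"
  shows "eqn A
      (Cell \<zeta> [ycell U] [ycell V] \<otimes> \<lceil>B\<rceil> \<odot> \<psi>B' U)
      (\<psi>B' V \<odot> \<lceil>B\<rceil> \<otimes> Cell \<zeta> [ycell U] [ycell V])"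
proof -
  have linear: "eqn A
      (yact' V \<odot> \<lceil>F\<rceil> \<otimes> Cell \<zeta> [ycell U] [ycell V])
      (Cell \<zeta> [ycell U] [ycell V] \<odot> yact' U)"
    by (rule eqn_by_rewriting[OF eqns_Cons[OF psiF_counit[OF V] eqns_Cons[OF psi
        eqns_Cons[OF psiF_counit[OF U] eqns_Nil]]],
        where xs = "[Bwd 0 1 0, Bwd 1 0 0, SwapR 3]"
        and ys = "[Bwd 2 0 0]"]) (simp_all add: Let_def assms(1-3))
  show ?thesis
    by (rule eqn_by_rewriting[OF eqns_Cons[OF linear eqns_Cons[OF tB eqns_Nil]],
        where xs = "[Bwd 0 2 0]"
        and ys = "[SwapL 0, Bwd 1 1 1]"]) (simp_all add: Let_def assms(1-3))
qed

section \<open>Categories and the action\<close>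

lemmas yd_unfold = yd_cl_obj_def Let_def classical_yd_def left_monadic_def right_monadic_def
  left_comonadic_def right_comonadic_def Mnd_obj_def Comnd_obj_def left_module_def
      left_comodule_def

lemma id1_hom_A [simp]: "\<one> A \<in> hom1 K A A" "src K (\<one> A) = A" "tgt K (\<one> A) = A" "\<one> A \<in> One K"
  using id1_hom[OF objA] by (auto simp: hom1_def)

lemma id2_F [simp]: "\<langle>F\<rangle> \<in> hom2 K F F" and id2_B [simp]: "\<langle>B\<rangle> \<in> hom2 K B B"
  using id2_hom hom1_One F_typing(1) B_typing(1) by blast+

text \<open>The trivial Yetter-Drinfel'd module: the counit makes the identity 1-cell a module and
  the unit makes it a comodule.\<close>

definition unit_cl :: "('h, 'c) yd_cl" where
  "unit_cl = \<lparr> ycell = \<one> A, tFX = \<langle>F\<rangle>, tXF = \<langle>F\<rangle>, yact = \<epsilon>, ycoact = \<eta>, tBX = \<langle>B\<rangle> \<rparr>"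

lemma unit_yd: "yd unit_cl"
  unfolding yd_unfold
  using unit_tFX_mult[THEN sem_eq] unit_tFX_unit[THEN sem_eq] unit_tFX_comult[THEN sem_eq]
    unit_tFX_counit[THEN sem_eq] unit_tXF_comult[THEN sem_eq] unit_tXF_counit[THEN sem_eq]
    unit_tXF_mult[THEN sem_eq] unit_tXF_unit[THEN sem_eq] unit_act_assoc[THEN sem_eq]
    unit_act_unit[THEN sem_eq] unit_coact_coassoc[THEN sem_eq] unit_coact_counit[THEN sem_eq]
    unit_tFX_act[THEN sem_eq] unit_tFX_coact[THEN sem_eq] unit_tXF_act[THEN sem_eq]
    unit_tXF_coact[THEN sem_eq] unit_hexagon_FXF[THEN sem_eq] unit_yetter_drinfeld[THEN sem_eq]
    unit_tBX_multB[THEN sem_eq] unit_tBX_unitB[THEN sem_eq] unit_hexagon_BFX[THEN sem_eq]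
    unit_hexagon_BXF[THEN sem_eq] unit_tBX_act[THEN sem_eq] unit_tBX_coact[THEN sem_eq]
    unit_tBX_lB[THEN sem_eq]
  by (simp add: unit_cl_def)

lemma unit_yang_baxter: "yang_baxter K F \<tau> unit_cl"
  unfolding yang_baxter_def Let_def
  using unit_hexagon_FFX[THEN sem_eq] unit_hexagon_XFF[THEN sem_eq] by (simp add: unit_cl_def)

text \<open>The trivial action cancels against \<Delta> and \<open>lB\<close>, the trivial coaction
  against \<open>\<mu>\<close>. Hence all three assigned cells are identities on the nose, and unit
  laws with identity coherence cells become possible.\<close>

lemma assign_unit: "assign K F \<mu> \<Delta> B lB unit_cl = unit_s K A F B"
  using psiF_unit[THEN sem_eq] phi_unit[THEN sem_eq] psiB_unit[THEN sem_eq]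
  by (simp add: assign_def unit_s_def psi_F_def phi_F_def psi_B_def unit_cl_def)

lemma tensor_yd:
  assumes U: "yd U" and V: "yd V" and ybV: "yang_baxter K F \<tau> V"
  shows "yd (tensor_cl K F \<mu> \<Delta> V U)"
proof -
  have X: "ycell U \<in> hom1 K A A" "F \<in> hom1 K A A" "B \<in> hom1 K A A" "ycell V \<in> hom1 K A A"
    using U V by auto
  then have YX: "ycell V \<cdot> ycell U \<in> hom1 K A A"
    using comp1_hom by blast
  \<comment> \<open>The axioms treat \<open>Y X\<close> as a single 1-cell and bracket accordingly,
    whereas words nest to the right; these equations reconcile the two.\<close>
  have assoc: "ycell V \<cdot> ycell U \<cdot> F = ycell V \<cdot> (ycell U \<cdot> F)"
    "ycell V \<cdot> ycell U \<cdot> B = ycell V \<cdot> (ycell U \<cdot> B)"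
    using comp1_assoc X by blast+
  have typing: "sem A (tFX_tensor V U)
      \<in> hom2 K (F \<cdot> (ycell V \<cdot> ycell U)) (ycell V \<cdot> (ycell U \<cdot> F))"
    "sem A (tXF_tensor V U) \<in> hom2 K (ycell V \<cdot> (ycell U \<cdot> F)) (F \<cdot> (ycell V \<cdot> ycell U))"
    "sem A (yact_tensor V U) \<in> hom2 K (F \<cdot> (ycell V \<cdot> ycell U)) (ycell V \<cdot> ycell U)"
    "sem A (ycoact_tensor V U) \<in> hom2 K (ycell V \<cdot> ycell U) (F \<cdot> (ycell V \<cdot> ycell U))"
    "sem A (tBX_tensor V U) \<in> hom2 K (B \<cdot> (ycell V \<cdot> ycell U)) (ycell V \<cdot> (ycell U \<cdot> B))"
    using wt_hom2[of A "tFX_tensor V U"] wt_hom2[of A "tXF_tensor V U"]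
        wt_hom2[of A "yact_tensor V U"]
      wt_hom2[of A "ycoact_tensor V U"] wt_hom2[of A "tBX_tensor V U"] U V by simp_all
  note eqs = tensor_tFX_mult[OF U V, THEN sem_eq] tensor_tFX_unit[OF U V, THEN sem_eq]
    tensor_tFX_comult[OF U V, THEN sem_eq] tensor_tFX_counit[OF U V, THEN sem_eq]
    tensor_tXF_comult[OF U V, THEN sem_eq] tensor_tXF_counit[OF U V, THEN sem_eq]
    tensor_tXF_mult[OF U V, THEN sem_eq] tensor_tXF_unit[OF U V, THEN sem_eq]
    tensor_act_assoc[OF U V, THEN sem_eq] tensor_act_unit[OF U V, THEN sem_eq]
    tensor_coact_coassoc[OF U V, THEN sem_eq] tensor_coact_counit[OF U V, THEN sem_eq]
    tensor_tFX_act[OF U V ybV, THEN sem_eq] tensor_tFX_coact[OF U V, THEN sem_eq]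
    tensor_tXF_act[OF U V, THEN sem_eq] tensor_tXF_coact[OF U V ybV, THEN sem_eq]
    tensor_hexagon_FXF[OF U V, THEN sem_eq] tensor_yetter_drinfeld[OF U V, THEN sem_eq]
    tensor_tBX_multB[OF U V, THEN sem_eq] tensor_tBX_unitB[OF U V, THEN sem_eq]
    tensor_hexagon_BFX[OF U V, THEN sem_eq] tensor_hexagon_BXF[OF U V, THEN sem_eq]
    tensor_tBX_act[OF U V, THEN sem_eq] tensor_tBX_coact[OF U V, THEN sem_eq]
    tensor_tBX_lB[OF U V, THEN sem_eq]
  show ?thesis
    unfolding yd_unfold tensor_cl_def
    using eqs typing YX[THEN hom1_typing(2)] YX[THEN hom1_typing(3)] YX
    by (simp add: X_typing[OF U] X_typing[OF V] assoc del: X_typing)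
qed

lemma tensor_yang_baxter:
  assumes U: "yd U" and V: "yd V" and yb: "yang_baxter K F \<tau> V" "yang_baxter K F \<tau> U"
  shows "yang_baxter K F \<tau> (tensor_cl K F \<mu> \<Delta> V U)"
  unfolding yang_baxter_def tensor_cl_def Let_def
  using tensor_hexagon_FFX[OF U V yb, THEN sem_eq] tensor_hexagon_XFF[OF U V yb, THEN sem_eq]
  by (simp add: X_typing[OF U] X_typing[OF V] del: X_typing)

text \<open>It carries closure under tensor products from Yetter-Drinfel'd modules to their images:
  \<open>tensor_s\<close> is computed from the assigned cells alone, yet its value is the image of
  the tensor product of any two preimages.\<close>

lemma assign_tensor:
  assumes U: "yd U" and V: "yd V"
  shows "assign K F \<mu> \<Delta> B lB (tensor_cl K F \<mu> \<Delta> V U)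
    = tensor_s K (assign K F \<mu> \<Delta> B lB V) (assign K F \<mu> \<Delta> B lB U)"
  using psiF_tensor[OF U V, THEN sem_eq] phi_tensor[OF U V, THEN sem_eq]
      psiB_tensor[OF U V, THEN sem_eq]
  by (simp add: assign_def tensor_s_def tensor_cl_def psi_F_def phi_F_def psi_B_def Let_def
      X_typing[OF U] X_typing[OF V] del: X_typing)

lemma psi_phi_typing:
  assumes U: "yd U"
  shows "psi_F K F \<Delta> U \<in> hom2 K (F \<cdot> ycell U) (ycell U \<cdot> F)"
    "phi_F K F \<mu> U \<in> hom2 K (ycell U \<cdot> F) (F \<cdot> ycell U)"
    "psi_B K F B lB U \<in> hom2 K (B \<cdot> ycell U) (ycell U \<cdot> B)"
  using wt_hom2[of A "\<psi>F' U"] wt_hom2[of A "\<phi>F' U"] wt_hom2[of A "\<psi>B' U"]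
  by (simp_all add: psi_F_def phi_F_def psi_B_def X_typing[OF U] del: X_typing)

lemma phi_Comnd_obj:
  assumes U: "yd U"
  shows "Comnd_obj K A F \<Delta> \<epsilon> (ycell U) (phi_F K F \<mu> U)"
  using phi_comult[OF U, THEN sem_eq] phi_counit[OF U, THEN sem_eq] psi_phi_typing[OF U]
  by (simp add: Comnd_obj_def phi_F_def X_typing[OF U] del: X_typing)

lemma psiB_Mnd_obj:
  assumes U: "yd U"
  shows "Mnd_obj K A B \<mu>B \<eta>B (ycell U) (psi_B K F B lB U)"
  using psiB_multB[OF U, THEN sem_eq] psiB_unitB[OF U, THEN sem_eq] psi_phi_typing[OF U]
  by (simp add: Mnd_obj_def psi_B_def X_typing[OF U] del: X_typing)

lemma psiBF_typing [simp]: "psi_BF K F \<mu> B lB \<tau>BF \<in> hom2 K (B \<cdot> F) (F \<cdot> B)"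
  using wt_hom2[of A "\<psi>BF'"] by (simp add: psi_BF_def)

abbreviation "\<Y> \<equiv> YDcl K A F \<mu> \<eta> \<Delta> \<epsilon> \<tau> B \<mu>B \<eta>B lB \<tau>BF"
abbreviation "\<S> \<equiv> YDs K A F \<mu> \<eta> \<Delta> \<epsilon> \<tau> B \<mu>B \<eta>B lB \<tau>BF"
abbreviation "\<M> \<equiv> RelMod K A F \<mu> \<Delta> \<epsilon> B \<mu>B \<eta>B lB \<tau>BF"
abbreviation "im \<equiv> assign K F \<mu> \<Delta> B lB"

section \<open>The categories and the functor between them\<close>

lemma YDs_obj: "S \<in> Obj (\<S> Q) \<longleftrightarrow> (\<exists>U. yd U \<and> Q U \<and> S = im U)"
  by (auto simp: YDs_def YDcl_def)

text \<open>Category laws, functoriality on arrows and associativity of the action use no more of an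
  object of the image than this typing, so no preimage has to be chosen there.\<close>

lemma YDs_typing:
  assumes "S \<in> Obj (\<S> Q)"
  shows "scell S \<in> hom1 K A A" "psiF S \<in> hom2 K (F \<cdot> scell S) (scell S \<cdot> F)"
    "phiF S \<in> hom2 K (scell S \<cdot> F) (F \<cdot> scell S)" "psiB S \<in> hom2 K (B \<cdot> scell S) (scell S \<cdot> B)"
proof -
  obtain U where "yd U" "S = im U" using assms YDs_obj by blast
  then show "scell S \<in> hom1 K A A" "psiF S \<in> hom2 K (F \<cdot> scell S) (scell S \<cdot> F)"
    "phiF S \<in> hom2 K (scell S \<cdot> F) (F \<cdot> scell S)" "psiB S \<in> hom2 K (B \<cdot> scell S) (scell S \<cdot> B)"
    using psi_phi_typing by (simp_all add: assign_def)
qed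

text \<open>The axioms for \<open>phiF S\<close> and \<open>psiB S\<close> and the hexagon between
  them are known only through a preimage, so one is chosen here; the value of \<open>act_obj\<close>
  does not depend on the choice.\<close>

lemma act_obj_RelMod:
  assumes S: "S \<in> Obj (\<S> Q)" and M: "M \<in> Obj \<M>"
  shows "act_obj K S M \<in> Obj \<M>"
proof -
  obtain U where U: "yd U" and SU: "S = im U" using S YDs_obj by blast
  have m: "left_comodule K A F \<Delta> \<epsilon> (mcell M) (mcoact M)"
      "left_module K A B \<mu>B \<eta>B (mcell M) (mact M)"
    "mcoact M \<bullet> mact M
      = (\<langle>F\<rangle> \<star> mact M) \<bullet> (psi_BF K F \<mu> B lB \<tau>BF \<star> \<langle>mcell M\<rangle>) \<bullet> (\<langle>B\<rangle> \<star> mcoact M)"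
    using M by (auto simp: RelMod_def)
  have "mcell M \<in> hom1 K (src K (mcell M)) A" "mcoact M \<in> hom2 K (mcell M) (F \<cdot> mcell M)"
      "mact M \<in> hom2 K (B \<cdot> mcell M) (mcell M)"
    using m by (auto simp: left_comodule_def left_module_def hom1_def)
  moreover have "(phi_F K F \<mu> U \<star> \<langle>B\<rangle>) \<bullet> (\<langle>ycell U\<rangle> \<star> psi_BF K F \<mu> B lB \<tau>BF)
      \<bullet> (psi_B K F B lB U \<star> \<langle>F\<rangle>)
      = (\<langle>F\<rangle> \<star> psi_B K F B lB U) \<bullet> (psi_BF K F \<mu> B lB \<tau>BF \<star> \<langle>ycell U\<rangle>) \<bullet> (\<langle>B\<rangle> \<star> phi_F K F \<mu> U)"
    using phi_psiB_hexagon[OF U, THEN sem_eq]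
    by (simp add: phi_F_def psi_B_def psi_BF_def X_typing[OF U] del: X_typing)
  ultimately show ?thesis
    using comodule_act[OF F_typing(1,6,7) phi_Comnd_obj[OF U] m(1)]
      module_act[OF B_typing(1,4,5) psiB_Mnd_obj[OF U] m(2)]
      relative_act[OF F_typing(1) B_typing(1) X_typing(1)[OF U] _ psi_phi_typing(2,3)[OF U]
        psiBF_typing _ _ _ m(3)]
    by (simp add: RelMod_def act_obj_def SU assign_def)
qed

lemma YDs_Hom: "\<zeta> \<in> Hom (\<S> Q) S T \<longleftrightarrow>
    Mnd_arr K F (scell S) (psiF S) (scell T) (psiF T) \<zeta> \<and>
    Comnd_arr K F (scell S) (phiF S) (scell T) (phiF T) \<zeta> \<and>
    Mnd_arr K B (scell S) (psiB S) (scell T) (psiB T) \<zeta>"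
  by (simp add: YDs_def)

lemma YDs_Hom_hom2: "\<zeta> \<in> Hom (\<S> Q) S T \<Longrightarrow> \<zeta> \<in> hom2 K (scell S) (scell T)"
  by (simp add: YDs_Hom Mnd_arr_def)

lemma YDs_simps: "Idn (\<S> Q) S = \<langle>scell S\<rangle>" "Cmp (\<S> Q) = vcomp K"
  by (simp_all add: YDs_def)

lemma YDcl_simps: "Idn \<Y> U = \<langle>ycell U\<rangle>" "Cmp \<Y> = vcomp K" "Obj \<Y> = {U. yd U}"
  by (simp_all add: YDcl_def)

lemma YDcl_Hom: "\<zeta> \<in> Hom \<Y> U V \<longleftrightarrow>
    Mnd_arr K F (ycell U) (psi_F K F \<Delta> U) (ycell V) (psi_F K F \<Delta> V) \<zeta> \<and>
    Comnd_arr K F (ycell U) (phi_F K F \<mu> U) (ycell V) (phi_F K F \<mu> V) \<zeta> \<and>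
    Mnd_arr K B (ycell U) (tBX U) (ycell V) (tBX V) \<zeta>"
  by (simp add: YDcl_def)

lemma category_YDcl: "category \<Y>"
  unfolding category_def YDcl_simps
proof (intro conjI ballI)
  fix X assume "X \<in> {U. yd U}"
  then have X: "yd X" by simp
  show "\<langle>ycell X\<rangle> \<in> Hom \<Y> X X"
    using X psi_phi_typing[OF X] by (simp add: YDcl_Hom Mnd_arr_id Comnd_arr_id)
next
  fix X Y Z f g
  assume "X \<in> {U. yd U}" "Y \<in> {U. yd U}" "Z \<in> {U. yd U}"
  then have X: "yd X" and Y: "yd Y" and Z: "yd Z" by auto
  assume f: "f \<in> Hom \<Y> X Y" and g: "g \<in> Hom \<Y> Y Z"
  show "g \<bullet> f \<in> Hom \<Y> X Z"
    using f g Mnd_arr_comp[OF F_typing(1) X_typing(1)[OF X] X_typing(1)[OF Y] X_typing(1)[OF Z]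
        psi_phi_typing(1)[OF X] psi_phi_typing(1)[OF Y] psi_phi_typing(1)[OF Z]]
      Comnd_arr_comp[OF F_typing(1) X_typing(1)[OF X] X_typing(1)[OF Y] X_typing(1)[OF Z]
        psi_phi_typing(2)[OF X] psi_phi_typing(2)[OF Y] psi_phi_typing(2)[OF Z]]
      Mnd_arr_comp[OF B_typing(1) X_typing(1)[OF X] X_typing(1)[OF Y] X_typing(1)[OF Z]
        X_typing(8)[OF X] X_typing(8)[OF Y] X_typing(8)[OF Z]]
    by (auto simp: YDcl_Hom)
next
  fix X Y f
  assume "f \<in> Hom \<Y> X Y"
  then have "f \<in> hom2 K (ycell X) (ycell Y)" by (simp add: YDcl_Hom Mnd_arr_def)
  then show "\<langle>ycell Y\<rangle> \<bullet> f = f" "f \<bullet> \<langle>ycell X\<rangle> = f"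
    using vcomp_id_left vcomp_id_right by blast+
next
  fix W X Y Z f g h
  assume "f \<in> Hom \<Y> W X" "g \<in> Hom \<Y> X Y" "h \<in> Hom \<Y> Y Z"
  then show "h \<bullet> (g \<bullet> f) = h \<bullet> g \<bullet> f"
    using vcomp_assoc by (metis YDcl_Hom Mnd_arr_def)
qed

lemma category_YDs: "category (\<S> Q)"
  unfolding category_def YDs_simps
proof (intro conjI ballI)
  fix X assume "X \<in> Obj (\<S> Q)"
  note X = YDs_typing[OF this]
  show "\<langle>scell X\<rangle> \<in> Hom (\<S> Q) X X"
    using X by (simp add: YDs_Hom Mnd_arr_id Comnd_arr_id)
next
  fix X Y Z f g
  assume "X \<in> Obj (\<S> Q)" "Y \<in> Obj (\<S> Q)" "Z \<in> Obj (\<S> Q)"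
  note X = YDs_typing[OF this(1)] and Y = YDs_typing[OF this(2)] and Z = YDs_typing[OF this(3)]
  assume f: "f \<in> Hom (\<S> Q) X Y" and g: "g \<in> Hom (\<S> Q) Y Z"
  show "g \<bullet> f \<in> Hom (\<S> Q) X Z"
    using f g Mnd_arr_comp[OF F_typing(1) X(1) Y(1) Z(1) X(2) Y(2) Z(2)]
      Comnd_arr_comp[OF F_typing(1) X(1) Y(1) Z(1) X(3) Y(3) Z(3)]
      Mnd_arr_comp[OF B_typing(1) X(1) Y(1) Z(1) X(4) Y(4) Z(4)]
    by (auto simp: YDs_Hom)
next
  fix X Y f
  assume "f \<in> Hom (\<S> Q) X Y"
  then show "\<langle>scell Y\<rangle> \<bullet> f = f" "f \<bullet> \<langle>scell X\<rangle> = f"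
    using vcomp_id_left vcomp_id_right YDs_Hom_hom2 by blast+
next
  fix W X Y Z f g h
  assume "f \<in> Hom (\<S> Q) W X" "g \<in> Hom (\<S> Q) X Y" "h \<in> Hom (\<S> Q) Y Z"
  then show "h \<bullet> (g \<bullet> f) = h \<bullet> g \<bullet> f"
    using vcomp_assoc YDs_Hom_hom2 by metis
qed

lemma RelMod_Hom: "f \<in> Hom \<M> M N \<longleftrightarrow> f \<in> hom2 K (mcell M) (mcell N) \<and>
    mcoact N \<bullet> f = (\<langle>F\<rangle> \<star> f) \<bullet> mcoact M \<and> f \<bullet> mact M = mact N \<bullet> (\<langle>B\<rangle> \<star> f)"
  by (simp add: RelMod_def)

lemma RelMod_simps: "Idn \<M> M = \<langle>mcell M\<rangle>" "Cmp \<M> = vcomp K"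
  by (simp_all add: RelMod_def)

lemma RelMod_typing:
  assumes "M \<in> Obj \<M>"
  shows "mcell M \<in> hom1 K (src K (mcell M)) A" "mcoact M \<in> hom2 K (mcell M) (F \<cdot> mcell M)"
    "mact M \<in> hom2 K (B \<cdot> mcell M) (mcell M)"
  using assms by (auto simp: RelMod_def left_comodule_def left_module_def hom1_def)

text \<open>The category collects modules with all sources. A morphism is a 2-cell and thus forces
  its two ends to have the same source, as the lemmas with a fixed \<open>a\<close> demand.\<close>

lemma RelMod_Hom_src:
  assumes "f \<in> Hom \<M> M N"
  shows "src K (mcell N) = src K (mcell M)"
  using assms parallel_src[of f] by (auto simp: RelMod_Hom hom2_def)

lemma RelMod_typing_target:
  assumes "f \<in> Hom \<M> M N" "N \<in> Obj \<M>"
  shows "mcell N \<in> hom1 K (src K (mcell M)) A"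
  using RelMod_Hom_src[OF assms(1)] RelMod_typing(1)[OF assms(2)] by simp

lemma category_RelMod: "category \<M>"
  unfolding category_def RelMod_simps
proof (intro conjI ballI)
  fix M assume "M \<in> Obj \<M>"
  note M = RelMod_typing[OF this]
  have "\<langle>mcell M\<rangle> \<in> hom2 K (mcell M) (mcell M)"
    using M(1) hom1_One id2_hom by blast
  moreover have "\<langle>F\<rangle> \<star> \<langle>mcell M\<rangle> = \<langle>F \<cdot> mcell M\<rangle>" "\<langle>B\<rangle> \<star> \<langle>mcell M\<rangle> = \<langle>B \<cdot> mcell M\<rangle>"
    using hcomp_id2[OF F_typing(1) M(1)] hcomp_id2[OF B_typing(1) M(1)] by simp_all
  ultimately show "\<langle>mcell M\<rangle> \<in> Hom \<M> M M"
    using M vcomp_id_left vcomp_id_right by (simp add: RelMod_Hom)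
next
  fix L M N f g
  assume L: "L \<in> Obj \<M>" and M: "M \<in> Obj \<M>" and N: "N \<in> Obj \<M>"
  assume f: "f \<in> Hom \<M> L M" and g: "g \<in> Hom \<M> M N"
  have N1: "mcell N \<in> hom1 K (src K (mcell L)) A"
    using RelMod_typing_target[OF g N] RelMod_Hom_src[OF f] by simp
  show "g \<bullet> f \<in> Hom \<M> L N"
    using f g vcomp_hom
      colinear_comp[OF F_typing(1) RelMod_typing(1)[OF L] RelMod_typing_target[OF f M] N1
        RelMod_typing(2)[OF L] RelMod_typing(2)[OF M] RelMod_typing(2)[OF N], of f g]
      linear_comp[OF B_typing(1) RelMod_typing(1)[OF L] RelMod_typing_target[OF f M] N1
        RelMod_typing(3)[OF L] RelMod_typing(3)[OF M] RelMod_typing(3)[OF N], of f g]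
    by (auto simp: RelMod_Hom)
next
  fix M N f
  assume "f \<in> Hom \<M> M N"
  then show "\<langle>mcell N\<rangle> \<bullet> f = f" "f \<bullet> \<langle>mcell M\<rangle> = f"
    using vcomp_id_left vcomp_id_right RelMod_Hom by blast+
next
  fix L M N P f g h
  assume "f \<in> Hom \<M> L M" "g \<in> Hom \<M> M N" "h \<in> Hom \<M> N P"
  then show "h \<bullet> (g \<bullet> f) = h \<bullet> g \<bullet> f"
    using vcomp_assoc RelMod_Hom by metis
qed

lemma act_Hom_RelMod:
  assumes S: "S \<in> Obj (\<S> Q)" and T: "T \<in> Obj (\<S> Q)" and M: "M \<in> Obj \<M>" and N: "N \<in> Obj \<M>"
    and z: "\<zeta> \<in> Hom (\<S> Q) S T" and f: "f \<in> Hom \<M> M N"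
  shows "\<zeta> \<star> f \<in> Hom \<M> (act_obj K S M) (act_obj K T N)"
proof -
  note S = YDs_typing[OF S] and T = YDs_typing[OF T]
  have "\<zeta> \<star> f \<in> hom2 K (scell S \<cdot> mcell M) (scell T \<cdot> mcell N)"
    using hcomp_hom[OF S(1) RelMod_typing(1)[OF M]] YDs_Hom_hom2[OF z] f by (simp add: RelMod_Hom)
  then show ?thesis
    using colinear_act[OF F_typing(1) S(1) T(1) RelMod_typing(1)[OF M]
        RelMod_typing_target[OF f N]
        S(3) T(3) RelMod_typing(2)[OF M] RelMod_typing(2)[OF N], of \<zeta> f]
      linear_act[OF B_typing(1) S(1) T(1) RelMod_typing(1)[OF M] RelMod_typing_target[OF f N]
        S(4) T(4) RelMod_typing(3)[OF M] RelMod_typing(3)[OF N], of \<zeta> f]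
      z f
    by (simp add: RelMod_Hom YDs_Hom act_obj_def Mnd_arr_def Comnd_arr_def)
qed

lemma tensor_Hom_YDs:
  assumes "S \<in> Obj (\<S> Q)" "S' \<in> Obj (\<S> Q)" "T \<in> Obj (\<S> Q)" "T' \<in> Obj (\<S> Q)"
    and z: "\<zeta> \<in> Hom (\<S> Q) S S'" and x: "\<xi> \<in> Hom (\<S> Q) T T'"
  shows "\<xi> \<star> \<zeta> \<in> Hom (\<S> Q) (tensor_s K T S) (tensor_s K T' S')"
proof -
  note S = YDs_typing[OF assms(1)] and S' = YDs_typing[OF assms(2)]
    and T = YDs_typing[OF assms(3)] and T' = YDs_typing[OF assms(4)]
  show ?thesis
    using Mnd_arr_tensor[OF F_typing(1) S(1) S'(1) T(1) T'(1) S(2) S'(2) T(2) T'(2), of \<zeta> \<xi>]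
      Comnd_arr_tensor[OF F_typing(1) S(1) S'(1) T(1) T'(1) S(3) S'(3) T(3) T'(3), of \<zeta> \<xi>]
      Mnd_arr_tensor[OF B_typing(1) S(1) S'(1) T(1) T'(1) S(4) S'(4) T(4) T'(4), of \<zeta> \<xi>]
      z x
    by (simp add: YDs_Hom tensor_s_def Let_def)
qed

text \<open>Arrows upstairs respect \<open>tBX\<close>, arrows downstairs \<open>psi_B\<close>;
  \<open>psiB_arrow\<close> passes from the one to the other, and the remaining two conditions
  coincide.\<close>

lemma functor_assign: "is_functor \<Y> (\<S> (\<lambda>U. True)) im (\<lambda>\<zeta>. \<zeta>)"
  unfolding is_functor_def YDs_simps YDcl_simps
proof (intro conjI ballI category_YDcl category_YDs)
  fix U assume "U \<in> {U. yd U}"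
  then show "im U \<in> Obj (\<S> (\<lambda>U. True))" "\<langle>ycell U\<rangle> = \<langle>scell (im U)\<rangle>"
    by (auto simp: YDs_obj assign_def)
next
  fix U V \<zeta> assume "U \<in> {U. yd U}" "V \<in> {U. yd U}" and \<zeta>: "\<zeta> \<in> Hom \<Y> U V"
  then have U: "yd U" and V: "yd V" by auto
  note [simp] = X_typing[OF U] X_typing[OF V]
  have z: "\<zeta> \<in> hom2 K (ycell U) (ycell V)" using \<zeta> by (simp add: YDcl_Hom Mnd_arr_def)
  have "Mnd_arr K B (ycell U) (psi_B K F B lB U) (ycell V) (psi_B K F B lB V) \<zeta>"
    using psiB_arrow[OF U V z] \<zeta> z
        by (simp add: eqn_def Mnd_arr_def YDcl_Hom psi_F_def psi_B_def del: X_typing)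
  then show "\<zeta> \<in> Hom (\<S> (\<lambda>U. True)) (im U) (im V)"
    using \<zeta> by (simp add: YDs_Hom YDcl_Hom assign_def)
qed simp

section \<open>Strict unit and associativity laws\<close>

lemma unit_tensor_s:
  assumes "S \<in> Obj (\<S> Q)"
  shows "tensor_s K (unit_s K A F B) S = S" "tensor_s K S (unit_s K A F B) = S"
proof -
  note S = YDs_typing[OF assms]
  have t: "\<langle>scell S\<rangle> \<in> hom2 K (scell S) (scell S)" using S(1) hom1_One id2_hom by blast
  have FX: "F \<cdot> scell S \<in> hom1 K A A" "scell S \<cdot> F \<in> hom1 K A A" "B \<cdot> scell S \<in> hom1 K A A"
    using comp1_hom[OF F_typing(1) S(1)] comp1_hom[OF S(1) F_typing(1)]
        comp1_hom[OF B_typing(1) S(1)]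
    by auto
  show "tensor_s K (unit_s K A F B) S = S" "tensor_s K S (unit_s K A F B) = S"
    using S t FX
    by (simp_all add: tensor_s_def unit_s_def Let_def comp1_id_left comp1_id_right
        hcomp_id_left[OF FX(1)] hcomp_id_left[OF FX(2)] hcomp_id_left[OF FX(3)]
        hcomp_id_right[OF FX(1)] hcomp_id_right[OF FX(2)] hcomp_id_right[OF FX(3)]
        hcomp_id2[OF F_typing(1)] hcomp_id2[OF B_typing(1)] hcomp_id2[OF S(1) F_typing(1)]
        hcomp_id2[OF S(1) B_typing(1)]
        vcomp_id_left vcomp_id_right)
qed

lemma unit_act:
  assumes "M \<in> Obj \<M>"
  shows "act_obj K (unit_s K A F B) M = M"
proof -
  note M = RelMod_typing[OF assms]
  have BM: "B \<cdot> mcell M \<in> hom1 K (src K (mcell M)) A"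
    using comp1_hom[OF B_typing(1) M(1)] .
  have "\<one> A \<cdot> mcell M = mcell M" "\<langle>\<one> A\<rangle> \<star> mcoact M = mcoact M" "\<langle>\<one> A\<rangle> \<star> mact M = mact M"
    "\<langle>F\<rangle> \<star> \<langle>mcell M\<rangle> = \<langle>F \<cdot> mcell M\<rangle>" "\<langle>B\<rangle> \<star> \<langle>mcell M\<rangle> = \<langle>B \<cdot> mcell M\<rangle>"
    using comp1_id_left[OF M(1)] hcomp_id_left[OF M(1) M(2)] hcomp_id_left[OF BM M(3)]
      hcomp_id2[OF F_typing(1) M(1)] hcomp_id2[OF B_typing(1) M(1)] by auto
  then show ?thesis
    using vcomp_id_left[OF M(2)] vcomp_id_right[OF M(3)] by (simp add: act_obj_def unit_s_def)
qed

lemma tensor_s_assoc: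
  assumes "S \<in> Obj (\<S> Q)" "T \<in> Obj (\<S> Q)" "R \<in> Obj (\<S> Q)"
  shows "tensor_s K (tensor_s K R T) S = tensor_s K R (tensor_s K T S)"
proof -
  note S = YDs_typing[OF assms(1)] and T = YDs_typing[OF assms(2)] and R = YDs_typing[OF assms(3)]
  let ?X = "scell S" and ?Y = "scell T" and ?Z = "scell R"
  note [simp]
      = S T R S(1)[THEN hom1_typing(1)] T(1)[THEN hom1_typing(1)] R(1)[THEN hom1_typing(1)]
    S(1)[THEN hom1_typing(4)] T(1)[THEN hom1_typing(4)] R(1)[THEN hom1_typing(4)]
  let ?c = "\<lambda>G p X. Cell p [G, X] [X, G]" and ?d = "\<lambda>G p X. Cell p [X, G] [G, X]"
  \<comment> \<open>Stated for a general \<open>G\<close>, since the cells \<open>psiF\<close> (with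
    \<open>G = F\<close>) and \<open>psiB\<close> (with \<open>G = B\<close>) have the same shape;
    the cell \<open>phiF\<close> runs the other way and is treated separately.\<close>
  have m: "sem A (Wires [?Z, ?Y] \<otimes> ?c G p ?X \<odot> (\<lceil>?Z\<rceil> \<otimes> ?c G q ?Y \<odot> ?c G r ?Z \<otimes> \<lceil>?Y\<rceil>) \<otimes> \<lceil>?X\<rceil>)
      = sem A (\<lceil>?Z\<rceil> \<otimes> (\<lceil>?Y\<rceil> \<otimes> ?c G p ?X \<odot> ?c G q ?Y \<otimes> \<lceil>?X\<rceil>) \<odot> ?c G r ?Z \<otimes> Wires [?Y, ?X])"
    if "G \<in> hom1 K A A" "p \<in> hom2 K (G \<cdot> ?X) (?X \<cdot> G)" "q \<in> hom2 K (G \<cdot> ?Y) (?Y \<cdot> G)"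
      "r \<in> hom2 K (G \<cdot> ?Z) (?Z \<cdot> G)" for G p q r
    by (rule sem_eqI) (simp_all add: that that(1)[THEN hom1_typing(1)]
        that(1)[THEN hom1_typing(4)])
  have c: "sem A ((?d F (phiF R) ?Z \<otimes> \<lceil>?Y\<rceil> \<odot> \<lceil>?Z\<rceil> \<otimes> ?d F (phiF T) ?Y) \<otimes> \<lceil>?X\<rceil>
      \<odot> Wires [?Z, ?Y] \<otimes> ?d F (phiF S) ?X)
      = sem A (?d F (phiF R) ?Z \<otimes> Wires [?Y, ?X] \<odot> \<lceil>?Z\<rceil> \<otimes> (?d F (phiF T) ?Y \<otimes> \<lceil>?X\<rceil>
        \<odot> \<lceil>?Y\<rceil> \<otimes> ?d F (phiF S) ?X))"
    by (rule sem_eqI) simp_all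
  show ?thesis
    using m[OF F_typing(1) S(2) T(2) R(2)] m[OF B_typing(1) S(4) T(4) R(4)] c
      comp1_assoc[OF R(1) T(1) S(1)]
    by (simp add: tensor_s_def Let_def)
qed

text \<open>Both sides stack the same cells on the strands of \<open>T\<close>, \<open>S\<close> and
  \<open>M\<close>, so comparing layers suffices, whether or not \<open>tensor_s K T S\<close> is
  itself an object.\<close>

lemma act_obj_assoc:
  assumes "S \<in> Obj (\<S> Q)" "T \<in> Obj (\<S> Q)" "M \<in> Obj \<M>"
  shows "act_obj K (tensor_s K T S) M = act_obj K T (act_obj K S M)"
proof -
  note S = YDs_typing[OF assms(1)] and T = YDs_typing[OF assms(2)]
      and M = RelMod_typing[OF assms(3)]
  let ?X = "scell S" and ?Y = "scell T" and ?M = "mcell M" and ?a = "src K (mcell M)"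
  note [simp] = S T M S(1)[THEN hom1_typing(1)] T(1)[THEN hom1_typing(1)]
    S(1)[THEN hom1_typing(4)] T(1)[THEN hom1_typing(4)] M(1)[THEN hom1_typing(4)]
        M(1)[THEN hom1_typing(5)]
  let ?p = "\<lambda>p X. Cell p [B, X] [X, B]" and ?f = "\<lambda>p X. Cell p [X, F] [F, X]"
  have a: "sem ?a (Wires [?Y, ?X] \<otimes> Cell (mact M) [B, ?M] [?M] \<odot>
        (\<lceil>?Y\<rceil> \<otimes> ?p (psiB S) ?X \<odot> ?p (psiB T) ?Y \<otimes> \<lceil>?X\<rceil>) \<otimes> \<lceil>?M\<rceil>)
      = sem ?a (\<lceil>?Y\<rceil> \<otimes> (\<lceil>?X\<rceil> \<otimes> Cell (mact M) [B, ?M] [?M] \<odot> ?p (psiB S) ?X \<otimes> \<lceil>?M\<rceil>)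
        \<odot> ?p (psiB T) ?Y \<otimes> Wires [?X, ?M])"
    by (rule sem_eqI) simp_all
  have c: "sem ?a ((?f (phiF T) ?Y \<otimes> \<lceil>?X\<rceil> \<odot> \<lceil>?Y\<rceil> \<otimes> ?f (phiF S) ?X) \<otimes> \<lceil>?M\<rceil> \<odot>
        Wires [?Y, ?X] \<otimes> Cell (mcoact M) [?M] [F, ?M])
      = sem ?a (?f (phiF T) ?Y \<otimes> Wires [?X, ?M] \<odot>
        \<lceil>?Y\<rceil> \<otimes> (?f (phiF S) ?X \<otimes> \<lceil>?M\<rceil> \<odot> \<lceil>?X\<rceil> \<otimes> Cell (mcoact M) [?M] [F, ?M]))"
    by (rule sem_eqI) simp_all
  show ?thesis
    using a c comp1_assoc[OF T(1) S(1) M(1)]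
    by (simp add: act_obj_def tensor_s_def Let_def)
qed

section \<open>The action and the monoidal structure\<close>

lemma unit_in_YDs: "Q unit_cl \<Longrightarrow> unit_s K A F B \<in> Obj (\<S> Q)"
  using unit_yd assign_unit YDs_obj by metis

lemma Idn_unit: "Idn (\<S> Q) (unit_s K A F B) = \<langle>\<one> A\<rangle>"
  by (simp add: YDs_simps unit_s_def)

text \<open>On arrows the action is horizontal composition, so its functoriality is interchange and
  its coherence is strict associativity. The predicate \<open>Q\<close> enters only through the
  unit, which lets the same proof serve the full image and the Yang-Baxter part.\<close>

lemma strict_action_YDs:
  assumes "Q unit_cl"
  shows "strict_action (\<S> Q) (tensor_s K) (hcomp K) (unit_s K A F B) \<M> (act_obj K) (hcomp K)"
  unfolding strict_action_def Idn_unit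
proof (intro conjI ballI unit_in_YDs assms)
  show "is_functor (prod_cat (\<S> Q) \<M>) \<M> (\<lambda>(X, M). act_obj K X M) (\<lambda>(f, g). f \<star> g)"
    unfolding is_functor_def
  proof (intro conjI ballI category_prod_cat category_YDs category_RelMod)
    fix P assume "P \<in> Obj (prod_cat (\<S> Q) \<M>)"
    then obtain S M where P: "P = (S, M)" and S: "S \<in> Obj (\<S> Q)" and M: "M \<in> Obj \<M>"
      by (auto simp: prod_cat_def)
    show "(case P of (X, M) \<Rightarrow> act_obj K X M) \<in> Obj \<M>"
      using P act_obj_RelMod[OF S M] by simp
    show "(case Idn (prod_cat (\<S> Q) \<M>) P of (f, g) \<Rightarrow> f \<star> g)
        = Idn \<M> (case P of (X, M) \<Rightarrow> act_obj K X M)"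
      using P hcomp_id2[OF YDs_typing(1)[OF S] RelMod_typing(1)[OF M]]
      by (simp add: prod_cat_def YDs_simps RelMod_simps act_obj_def)
  next
    fix P P' p assume PP: "P \<in> Obj (prod_cat (\<S> Q) \<M>)" "P' \<in> Obj (prod_cat (\<S> Q) \<M>)"
      "p \<in> Hom (prod_cat (\<S> Q) \<M>) P P'"
    then show "(case p of (f, g) \<Rightarrow> f \<star> g)
        \<in> Hom \<M> (case P of (X, M) \<Rightarrow> act_obj K X M) (case P' of (X, M) \<Rightarrow> act_obj K X M)"
      by (auto simp: prod_cat_def intro: act_Hom_RelMod)
  next
    fix P P' P'' p p'
    assume PP: "P \<in> Obj (prod_cat (\<S> Q) \<M>)" "P' \<in> Obj (prod_cat (\<S> Q) \<M>)"
      "P'' \<in> Obj (prod_cat (\<S> Q) \<M>)"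
      "p \<in> Hom (prod_cat (\<S> Q) \<M>) P P'" "p' \<in> Hom (prod_cat (\<S> Q) \<M>) P' P''"
    obtain f g f' g' S M S' M' S'' M'' where p: "p = (f, g)" "p' = (f', g')"
        "P = (S, M)" "P' = (S', M')" "P'' = (S'', M'')"
      by (cases p, cases p', cases P, cases P', cases P'')
    have "S \<in> Obj (\<S> Q)" "M \<in> Obj \<M>" "f \<in> Hom (\<S> Q) S S'" "f' \<in> Hom (\<S> Q) S' S''"
        "g \<in> Hom \<M> M M'" "g' \<in> Hom \<M> M' M''"
      using PP by (auto simp: p prod_cat_def)
    then have "(f' \<bullet> f) \<star> (g' \<bullet> g) = (f' \<star> g') \<bullet> (f \<star> g)"
      using interchange[OF YDs_typing(1) RelMod_typing(1) YDs_Hom_hom2 YDs_Hom_hom2] RelMod_Hom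
        by blast
    then show "(case Cmp (prod_cat (\<S> Q) \<M>) p' p of (f, g) \<Rightarrow> f \<star> g)
        = Cmp \<M> (case p' of (f, g) \<Rightarrow> f \<star> g) (case p of (f, g) \<Rightarrow> f \<star> g)"
      by (simp add: p prod_cat_def YDs_simps RelMod_simps)
  qed
next
  fix M N f assume "M \<in> Obj \<M>" "f \<in> Hom \<M> M N"
  then show "\<langle>\<one> A\<rangle> \<star> f = f"
    using hcomp_id_left RelMod_typing(1) RelMod_Hom by blast
next
  fix S S' T T' M N x y f
  assume *: "S \<in> Obj (\<S> Q)" "T \<in> Obj (\<S> Q)" "M \<in> Obj \<M>"
    "x \<in> Hom (\<S> Q) S S'" "y \<in> Hom (\<S> Q) T T'" "f \<in> Hom \<M> M N"
  have "f \<in> hom2 K (mcell M) (mcell N)" using *(6) RelMod_Hom by simp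
  then show "y \<star> x \<star> f = y \<star> (x \<star> f)"
    using hcomp_assoc[OF YDs_typing(1)[OF *(2)] YDs_typing(1)[OF *(1)] RelMod_typing(1)[OF *(3)]
        YDs_Hom_hom2[OF *(5)] YDs_Hom_hom2[OF *(4)]] by blast
qed (auto intro: unit_act act_obj_assoc)

lemma strict_monoidal_YDs:
  assumes unit: "Q unit_cl"
    and tensor: "\<And>U V. yd U \<Longrightarrow> yd V \<Longrightarrow> Q U \<Longrightarrow> Q V \<Longrightarrow>
      yd (tensor_cl K F \<mu> \<Delta> V U) \<and> Q (tensor_cl K F \<mu> \<Delta> V U)"
  shows "strict_monoidal (\<S> Q) (tensor_s K) (hcomp K) (unit_s K A F B)"
  unfolding strict_monoidal_def Idn_unit
proof (intro conjI ballI unit_in_YDs assms(1))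
  show "is_functor (prod_cat (\<S> Q) (\<S> Q)) (\<S> Q) (\<lambda>(Y, X). tensor_s K Y X) (\<lambda>(g, f). g \<star> f)"
    unfolding is_functor_def
  proof (intro conjI ballI category_prod_cat category_YDs)
    fix P assume "P \<in> Obj (prod_cat (\<S> Q) (\<S> Q))"
    then obtain T S where P: "P = (T, S)" and T: "T \<in> Obj (\<S> Q)" and S: "S \<in> Obj (\<S> Q)"
      by (auto simp: prod_cat_def)
    \<comment> \<open>Closure is shown through preimages satisfying \<open>Q\<close>: their tensor
      product satisfies \<open>Q\<close> again, and its image is
      \<open>tensor_s K T S\<close>.\<close>
    obtain U V where UV: "yd U" "Q U" "S = im U" "yd V" "Q V" "T = im V"
      using S T YDs_obj by metis
    then have "tensor_s K T S \<in> Obj (\<S> Q)"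
      using tensor[OF UV(1,4,2,5)] assign_tensor[OF UV(1,4)] YDs_obj by metis
    then show "(case P of (Y, X) \<Rightarrow> tensor_s K Y X) \<in> Obj (\<S> Q)"
      using P by simp
    show "(case Idn (prod_cat (\<S> Q) (\<S> Q)) P of (g, f) \<Rightarrow> g \<star> f)
        = Idn (\<S> Q) (case P of (Y, X) \<Rightarrow> tensor_s K Y X)"
      using P hcomp_id2[OF YDs_typing(1)[OF T] YDs_typing(1)[OF S]]
      by (simp add: prod_cat_def YDs_simps tensor_s_def Let_def)
  next
    fix P P' p assume "P \<in> Obj (prod_cat (\<S> Q) (\<S> Q))" "P' \<in> Obj (prod_cat (\<S> Q) (\<S> Q))"
      "p \<in> Hom (prod_cat (\<S> Q) (\<S> Q)) P P'"
    then show "(case p of (g, f) \<Rightarrow> g \<star> f)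
        \<in> Hom (\<S> Q) (case P of (Y, X) \<Rightarrow> tensor_s K Y X) (case P' of (Y, X) \<Rightarrow> tensor_s K Y X)"
      by (auto simp: prod_cat_def intro: tensor_Hom_YDs)
  next
    fix P P' P'' p p'
    assume PP: "P \<in> Obj (prod_cat (\<S> Q) (\<S> Q))" "P' \<in> Obj (prod_cat (\<S> Q) (\<S> Q))"
      "P'' \<in> Obj (prod_cat (\<S> Q) (\<S> Q))"
      "p \<in> Hom (prod_cat (\<S> Q) (\<S> Q)) P P'" "p' \<in> Hom (prod_cat (\<S> Q) (\<S> Q)) P' P''"
    obtain f g f' g' S T S' T' S'' T'' where p: "p = (f, g)" "p' = (f', g')"
        "P = (T, S)" "P' = (T', S')" "P'' = (T'', S'')"
      by (cases p, cases p', cases P, cases P', cases P'')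
    have "T \<in> Obj (\<S> Q)" "S \<in> Obj (\<S> Q)" "f \<in> Hom (\<S> Q) T T'" "f' \<in> Hom (\<S> Q) T' T''"
        "g \<in> Hom (\<S> Q) S S'" "g' \<in> Hom (\<S> Q) S' S''"
      using PP by (auto simp: p prod_cat_def)
    then have "(f' \<bullet> f) \<star> (g' \<bullet> g) = (f' \<star> g') \<bullet> (f \<star> g)"
      by (intro interchange[OF YDs_typing(1) YDs_typing(1) YDs_Hom_hom2 YDs_Hom_hom2 YDs_Hom_hom2
        YDs_Hom_hom2])
    then show "(case Cmp (prod_cat (\<S> Q) (\<S> Q)) p' p of (g, f) \<Rightarrow> g \<star> f)
        = Cmp (\<S> Q) (case p' of (g, f) \<Rightarrow> g \<star> f) (case p of (g, f) \<Rightarrow> g \<star> f)"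
      by (simp add: p prod_cat_def YDs_simps)
  qed
next
  fix S T f assume *: "S \<in> Obj (\<S> Q)" "f \<in> Hom (\<S> Q) S T"
  show "\<langle>\<one> A\<rangle> \<star> f = f" "f \<star> \<langle>\<one> A\<rangle> = f"
    using hcomp_id_left hcomp_id_right YDs_typing(1)[OF *(1)] YDs_Hom_hom2[OF *(2)] by blast+
next
  fix S S' T T' R R' f g h
  assume *: "S \<in> Obj (\<S> Q)" "T \<in> Obj (\<S> Q)" "R \<in> Obj (\<S> Q)"
    "f \<in> Hom (\<S> Q) S S'" "g \<in> Hom (\<S> Q) T T'" "h \<in> Hom (\<S> Q) R R'"
  show "h \<star> g \<star> f = h \<star> (g \<star> f)"
    by (rule hcomp_assoc[OF YDs_typing(1)[OF *(3)] YDs_typing(1)[OF *(2)] YDs_typing(1)[OF *(1)]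
        YDs_Hom_hom2[OF *(6)] YDs_Hom_hom2[OF *(5)] YDs_Hom_hom2[OF *(4)]])
qed (auto intro: unit_tensor_s tensor_s_assoc)

lemma action_of_yd_modules:
  "is_functor \<Y> (\<S> (\<lambda>U. True)) im (\<lambda>\<zeta>. \<zeta>)
    \<and> (\<forall>V\<in>Obj \<Y>. \<forall>U\<in>Obj \<Y>. im (tensor_cl K F \<mu> \<Delta> V U) = tensor_s K (im V) (im U))
    \<and> strict_action (\<S> (\<lambda>U. True)) (tensor_s K) (hcomp K) (unit_s K A F B) \<M> (act_obj K) (hcomp K)
    \<and> strict_monoidal (\<S> (yang_baxter K F \<tau>)) (tensor_s K) (hcomp K) (unit_s K A F B)
    \<and> strict_action (\<S> (yang_baxter K F \<tau>)) (tensor_s K) (hcomp K) (unit_s K A F B) \<M> (act_obj K)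
        (hcomp K)"
  using functor_assign strict_action_YDs strict_monoidal_YDs assign_tensor unit_yang_baxter
      tensor_yd tensor_yang_baxter
  by (auto simp: YDcl_simps)

end

text \<open>The full image carries the action in the sense of the associativity law for all pairs of
  objects. On the part given by the Yang-Baxter equations the tensor product is in addition an
  internal operation, so there the action is one of a strict monoidal category.\<close>

theorem corollary7p15:
  fixes K :: "('o, 'h, 'c) two_cat"
    and A :: 'o and F B :: 'h and \<mu> \<eta> \<Delta> \<epsilon> \<tau> \<mu>B \<eta>B lB \<tau>BF :: 'c
  assumes "two_category K"
    and "tau_bimonad K A F \<mu> \<eta> \<Delta> \<epsilon> \<tau>"
    and "comodule_monad K A F \<mu> \<eta> \<Delta> \<epsilon> B \<mu>B \<eta>B lB \<tau>BF"
    and "bimonad_in_Mnd K A F \<mu> \<eta> \<Delta> \<epsilon> B \<tau>BF"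
    and "coaction_slides_F K F \<tau> B lB \<tau>BF"
  shows "let \<Y> = YDcl K A F \<mu> \<eta> \<Delta> \<epsilon> \<tau> B \<mu>B \<eta>B lB \<tau>BF;
             \<S> = YDs K A F \<mu> \<eta> \<Delta> \<epsilon> \<tau> B \<mu>B \<eta>B lB \<tau>BF;
             \<M> = RelMod K A F \<mu> \<Delta> \<epsilon> B \<mu>B \<eta>B lB \<tau>BF;
             im = assign K F \<mu> \<Delta> B lB;
             all = (\<lambda>U. True);
             yb = yang_baxter K F \<tau>;
             I = unit_s K A F B
         in is_functor \<Y> (\<S> all) im (\<lambda>\<zeta>. \<zeta>)
          \<and> (\<forall>V\<in>Obj \<Y>. \<forall>U\<in>Obj \<Y>. im (tensor_cl K F \<mu> \<Delta> V U) = tensor_s K (im V) (im U))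
          \<and> strict_action (\<S> all) (tensor_s K) (hcomp K) I \<M> (act_obj K) (hcomp K)
          \<and> strict_monoidal (\<S> yb) (tensor_s K) (hcomp K) I
          \<and> strict_action (\<S> yb) (tensor_s K) (hcomp K) I \<M> (act_obj K) (hcomp K)"
proof -
  interpret two_category K by (rule assms(1))
  interpret comodule_monad_setting K A F B \<mu> \<eta> \<Delta> \<epsilon> \<tau> \<mu>B \<eta>B lB \<tau>BF
    by unfold_locales (rule assms)+
  show ?thesis
    unfolding Let_def by (rule action_of_yd_modules)
qed

end
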